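(* Let $B$ be a finite Blaschke product, and let $Z(B')=\{z\in\mathbb{D}:B'(z)=0\}$. Suppose that (i) the restriction $B|_{Z(B')}$ is injective, and (ii) each point of $Z(B')$ is a simple zero of $B'$. Then $M_B$, acting on the Bergman space $L^2_a(\mathbb{D})$, has exactly two minimal reducing subspaces, and thus $\dim\mathcal{V}^*(B)=2$. Therefore, $\mathcal{V}^*(B)$ is abelian.
   Context: $L^2_a(\mathbb{D})$ is the Bergman space of holomorphic functions on the open unit disk $\mathbb{D}$ that are square integrable with respect to normalized area measure. For a bounded holomorphic $\phi$ on $\mathbb{D}$, $M_\phi$ is the operator of multiplication by $\phi$ on $L^2_a(\mathbb{D})$. A closed subspace $M$ is reducing for $M_\phi$ if $M_\phi M\subseteq M$ and $M_\phi^*M\subseteq M$; a minimal reducing subspace is a nonzero reducing subspace that contains no reducing subspace other than $\{0\}$ and itself. $\mathcal{V}^*(\phi)=\{M_\phi,M_\phi^*\}'$ is the von Neumann algebra of bounded operators on $L^2_a(\mathbb{D})$ commuting with both $M_\phi$ and $M_\phi^*$.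
   Formalization: The finite Blaschke product B is assumed to have order at least 2; for order 1 (e.g. B(z)=z) the set Z(B') is empty and (i), (ii) hold vacuously, but M_B is irreducible and dim V*(B)=1, so the claim fails. *)

theory Defs
  imports "HOL-Complex_Analysis.Complex_Analysis"
begin

abbreviation unit_disk :: "complex set" where
  "unit_disk \<equiv> ball 0 1"

abbreviation disk_area :: "complex measure" where
  "disk_area \<equiv> uniform_measure lborel unit_disk"


section \<open>The Bergman space\<close>

text \<open>Elements are represented by total functions that vanish outside the disk, so that
  equality of elements is equality of the functions on the disk.\<close>

definition bergman_functions :: "(complex \<Rightarrow> complex) set" where
  "bergman_functions = {f. f holomorphic_on unit_disk \<and>
     integrable disk_area (\<lambda>z. (norm (f z))\<^sup>2) \<and> (\<forall>z. z \<notin> unit_disk \<longrightarrow> f z = 0)}"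

lemma bergman_functions_measurable:
  assumes "f \<in> bergman_functions"
  shows "f \<in> borel_measurable borel"
proof -
  have "continuous_on unit_disk f"
    using assms by (simp add: bergman_functions_def holomorphic_on_imp_continuous_on)
  then have "(\<lambda>x. indicator unit_disk x *\<^sub>R f x) \<in> borel_measurable borel"
    by (intro borel_measurable_continuous_on_indicator) auto
  also have "(\<lambda>x. indicator unit_disk x *\<^sub>R f x) = f"
    using assms by (auto simp: bergman_functions_def indicator_def fun_eq_iff)
  finally show ?thesis .
qed

lemma bergman_functions_mult:
  assumes f: "f \<in> bergman_functions" and "\<phi> holomorphic_on unit_disk"
    and bd: "\<And>z. z \<in> unit_disk \<Longrightarrow> norm (\<phi> z) \<le> C"
  shows "(\<lambda>z. \<phi> z * f z) \<in> bergman_functions"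
proof -
  let ?g = "\<lambda>z. \<phi> z * f z"
  have hol: "?g holomorphic_on unit_disk"
    using assms by (auto simp: bergman_functions_def intro!: holomorphic_intros)
  have out: "?g z = 0" if "z \<notin> unit_disk" for z
    using f that by (simp add: bergman_functions_def)
  have "(\<lambda>x. indicator unit_disk x *\<^sub>R ?g x) \<in> borel_measurable borel"
    by (intro borel_measurable_continuous_on_indicator holomorphic_on_imp_continuous_on hol) auto
  also have "(\<lambda>x. indicator unit_disk x *\<^sub>R ?g x) = ?g"
    using out by (fastforce simp: indicator_def fun_eq_iff)
  finally have meas: "?g \<in> borel_measurable borel" .
  have le: "norm ((norm (?g z))\<^sup>2) \<le> norm (C\<^sup>2 * (norm (f z))\<^sup>2)" for z
  proof (cases "z \<in> unit_disk")
    case True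
    then have "(norm (\<phi> z))\<^sup>2 \<le> C\<^sup>2" by (intro power_mono bd) auto
    then show ?thesis
      by (simp add: norm_mult power_mult_distrib mult_right_mono)
  next
    case False
    have "norm (?g z) = 0" unfolding out[OF False] by (rule norm_zero)
    then show ?thesis by (simp only: power_zero_numeral norm_zero norm_ge_zero)
  qed
  have "integrable disk_area (\<lambda>z. C\<^sup>2 * (norm (f z))\<^sup>2)"
    using f by (simp add: bergman_functions_def)
  then have "integrable disk_area (\<lambda>z. (norm (?g z))\<^sup>2)"
    by (rule Bochner_Integration.integrable_bound) (use meas le in auto)
  then show ?thesis
    using hol out by (auto simp: bergman_functions_def)
qed

lemma bergman_functions_scale: "f \<in> bergman_functions \<Longrightarrow> (\<lambda>z. c * f z) \<in> bergman_functions"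
  by (rule bergman_functions_mult[where C = "norm c"]) auto

lemma bergman_functions_add:
  assumes f: "f \<in> bergman_functions" and g: "g \<in> bergman_functions"
  shows "(\<lambda>z. f z + g z) \<in> bergman_functions"
proof -
  have [measurable]: "f \<in> borel_measurable borel" "g \<in> borel_measurable borel"
    using assms bergman_functions_measurable by auto
  have le: "norm ((norm (f z + g z))\<^sup>2) \<le> norm (2 * (norm (f z))\<^sup>2 + 2 * (norm (g z))\<^sup>2)" for z
  proof -
    have "(norm (f z + g z))\<^sup>2 \<le> (norm (f z) + norm (g z))\<^sup>2"
      by (intro power_mono norm_triangle_ineq) auto
    also have "\<dots> \<le> 2 * (norm (f z))\<^sup>2 + 2 * (norm (g z))\<^sup>2"
      using sum_squares_bound[of "norm (f z)" "norm (g z)"] by (simp add: power2_sum)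
    finally show ?thesis by simp
  qed
  have "integrable disk_area (\<lambda>z. 2 * (norm (f z))\<^sup>2 + 2 * (norm (g z))\<^sup>2)"
    using f g by (simp add: bergman_functions_def)
  then have "integrable disk_area (\<lambda>z. (norm (f z + g z))\<^sup>2)"
    by (rule Bochner_Integration.integrable_bound) (use le in auto)
  then show ?thesis
    using f g by (auto simp: bergman_functions_def intro!: holomorphic_intros)
qed

lemma bergman_functions_uminus:
  assumes "f \<in> bergman_functions"
  shows "(\<lambda>z. - f z) \<in> bergman_functions"
  using bergman_functions_scale[OF assms, of "-1"] by (simp only: mult_minus1)

lemma bergman_functions_diff:
  assumes "f \<in> bergman_functions" and "g \<in> bergman_functions"
  shows "(\<lambda>z. f z - g z) \<in> bergman_functions"
  using bergman_functions_add[OF assms(1) bergman_functions_uminus[OF assms(2)]]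
  by (simp only: add_uminus_conv_diff)

lemma bergman_functions_zero: "(\<lambda>z. 0) \<in> bergman_functions"
  by (simp add: bergman_functions_def)

lemma bergman_functions_integrable:
  assumes f: "f \<in> bergman_functions" and g: "g \<in> bergman_functions"
  shows "integrable disk_area (\<lambda>z. f z * cnj (g z))"
proof -
  have [measurable]: "f \<in> borel_measurable borel" "g \<in> borel_measurable borel"
    using assms bergman_functions_measurable by auto
  have le: "norm (f z * cnj (g z)) \<le> norm ((norm (f z))\<^sup>2 + (norm (g z))\<^sup>2)" for z
  proof -
    have "2 * (norm (f z) * norm (g z)) \<le> (norm (f z))\<^sup>2 + (norm (g z))\<^sup>2"
      using sum_squares_bound[of "norm (f z)" "norm (g z)"] by (simp add: mult.assoc)
    moreover have "0 \<le> norm (f z) * norm (g z)" by simp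
    ultimately have "norm (f z) * norm (g z) \<le> (norm (f z))\<^sup>2 + (norm (g z))\<^sup>2" by linarith
    then show ?thesis by (simp add: norm_mult)
  qed
  have meas: "(\<lambda>z. f z * cnj (g z)) \<in> borel_measurable disk_area"
    using borel_measurable_continuous_on[OF continuous_on_cnj[OF continuous_on_id]] by measurable
  have "integrable disk_area (\<lambda>z. (norm (f z))\<^sup>2 + (norm (g z))\<^sup>2)"
    using f g by (simp add: bergman_functions_def)
  then show ?thesis
    by (rule Bochner_Integration.integrable_bound) (use le meas in auto)
qed

typedef bergman = bergman_functions
  morphisms bergman_fun Abs_bergman
  using bergman_functions_zero by blast

setup_lifting type_definition_bergman

lift_definition cscale :: "complex \<Rightarrow> bergman \<Rightarrow> bergman" is "\<lambda>c f z. c * f z"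
  by (rule bergman_functions_scale)

definition cinner :: "bergman \<Rightarrow> bergman \<Rightarrow> complex" where
  "cinner f g = (\<integral>z. bergman_fun f z * cnj (bergman_fun g z) \<partial>disk_area)"

instantiation bergman :: real_vector
begin

lift_definition zero_bergman :: bergman is "\<lambda>z. 0"
  by (rule bergman_functions_zero)

lift_definition plus_bergman :: "bergman \<Rightarrow> bergman \<Rightarrow> bergman" is "\<lambda>f g z. f z + g z"
  by (rule bergman_functions_add)

lift_definition uminus_bergman :: "bergman \<Rightarrow> bergman" is "\<lambda>f z. - f z"
  by (rule bergman_functions_uminus)

lift_definition minus_bergman :: "bergman \<Rightarrow> bergman \<Rightarrow> bergman" is "\<lambda>f g z. f z - g z"
  by (rule bergman_functions_diff)

lift_definition scaleR_bergman :: "real \<Rightarrow> bergman \<Rightarrow> bergman" is "\<lambda>r f z. of_real r * f z"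
  by (rule bergman_functions_scale)

instance
  by standard (transfer; simp add: algebra_simps fun_eq_iff)+

end

lemma scaleR_bergman_eq: "r *\<^sub>R f = cscale (of_real r) f"
  by transfer simp

global_interpretation bergman: vector_space cscale
  by standard (transfer; simp add: algebra_simps fun_eq_iff)+

lemma cinner_commute: "cinner f g = cnj (cinner g f)"
proof -
  have "cnj (cinner g f) = (\<integral>z. cnj (bergman_fun g z * cnj (bergman_fun f z)) \<partial>disk_area)"
    unfolding cinner_def by (rule Bochner_Integration.integral_cnj[symmetric])
  also have "\<dots> = cinner f g"
    unfolding cinner_def by (simp add: mult.commute)
  finally show ?thesis by simp
qed

lemma bergman_fun_in: "bergman_fun f \<in> bergman_functions"
  by (rule bergman_fun)

lemma cinner_add_left: "cinner (f + g) h = cinner f h + cinner g h"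
  by (simp add: cinner_def plus_bergman.rep_eq distrib_right
      bergman_functions_integrable[OF bergman_fun_in bergman_fun_in])

lemma cinner_cscale_left: "cinner (cscale c f) g = c * cinner f g"
  by (simp add: cinner_def cscale.rep_eq mult.assoc)

lemma cinner_self:
  "cinner f f = of_real (\<integral>z. (norm (bergman_fun f z))\<^sup>2 \<partial>disk_area)"
proof -
  have "cinner f f = (\<integral>z. complex_of_real ((norm (bergman_fun f z))\<^sup>2) \<partial>disk_area)"
    unfolding cinner_def complex_norm_square ..
  then show ?thesis
    unfolding integral_complex_of_real .
qed

lemma cinner_self_eq_0: "cinner f f = 0 \<longleftrightarrow> f = 0"
proof
  assume "cinner f f = 0"
  then have 0: "(\<integral>z. (norm (bergman_fun f z))\<^sup>2 \<partial>disk_area) = 0"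
    by (simp add: cinner_self)
  let ?F = "bergman_fun f"
  have F: "?F \<in> bergman_functions" by (rule bergman_fun_in)
  have "AE z in disk_area. (norm (?F z))\<^sup>2 = 0"
    using 0 F by (subst (asm) integral_nonneg_eq_0_iff_AE) (auto simp: bergman_functions_def)
  then have "AE z in lborel. z \<in> unit_disk \<longrightarrow> (norm (?F z))\<^sup>2 = 0"
    by (subst (asm) AE_uniform_measure)
      (auto simp: emeasure_lborel_ball_finite emeasure_ball unit_ball_vol_2 less_top)
  then have "AE z in lebesgue. z \<in> unit_disk \<longrightarrow> ?F z = 0"
    by (subst AE_completion) auto
  then have "{z. \<not> (z \<in> unit_disk \<longrightarrow> ?F z = 0)} \<in> null_sets lebesgue"
    by (simp add: completion.AE_iff_null_sets)
  moreover have "{z. \<not> (z \<in> unit_disk \<longrightarrow> ?F z = 0)} = unit_disk \<inter> ?F -` (- {0})"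
    by auto
  ultimately have "negligible (unit_disk \<inter> ?F -` (- {0}))"
    by (simp add: negligible_iff_null_sets)
  moreover have "open (unit_disk \<inter> ?F -` (- {0}))"
    using F by (intro continuous_open_preimage)
      (auto simp: bergman_functions_def holomorphic_on_imp_continuous_on)
  ultimately have "unit_disk \<inter> ?F -` (- {0}) = {}"
    using open_not_negligible by blast
  then have "?F z = 0" for z
    using F by (cases "z \<in> unit_disk") (auto simp: bergman_functions_def)
  then show "f = 0" by transfer auto
next
  assume "f = 0"
  then show "cinner f f = 0" by (simp add: cinner_def zero_bergman.rep_eq)
qed

text \<open>The underlying real Hilbert space structure, with inner product \<open>Re (cinner f g)\<close>.  It has
  the norm of the complex inner product and supplies the topology used for closedness and
  boundedness.\<close>

instantiation bergman :: real_inner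
begin

definition inner_bergman :: "bergman \<Rightarrow> bergman \<Rightarrow> real" where
  "inner_bergman f g = Re (cinner f g)"

definition norm_bergman :: "bergman \<Rightarrow> real" where
  "norm_bergman f = sqrt (Re (cinner f f))"

definition sgn_bergman :: "bergman \<Rightarrow> bergman" where
  "sgn_bergman f = f /\<^sub>R norm f"

definition dist_bergman :: "bergman \<Rightarrow> bergman \<Rightarrow> real" where
  "dist_bergman f g = norm (f - g)"

definition uniformity_bergman :: "(bergman \<times> bergman) filter" where
  "uniformity_bergman = (INF e\<in>{0<..}. principal {(f, g). dist f g < e})"

definition open_bergman :: "bergman set \<Rightarrow> bool" where
  "open_bergman U \<longleftrightarrow> (\<forall>f\<in>U. eventually (\<lambda>(f', g). f' = f \<longrightarrow> g \<in> U) uniformity)"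

instance
proof
  fix f g h :: bergman and r :: real
  show "inner f g = inner g f"
    using cinner_commute[of f g] by (simp add: inner_bergman_def)
  show "inner (f + g) h = inner f h + inner g h"
    by (simp add: inner_bergman_def cinner_add_left)
  show "inner (r *\<^sub>R f) g = r * inner f g"
    by (simp add: inner_bergman_def scaleR_bergman_eq cinner_cscale_left)
  show "0 \<le> inner f f"
    by (simp add: inner_bergman_def cinner_self)
  show "inner f f = 0 \<longleftrightarrow> f = 0"
    unfolding cinner_self_eq_0[symmetric] by (simp add: inner_bergman_def cinner_self)
  show "norm f = sqrt (inner f f)"
    by (simp add: norm_bergman_def inner_bergman_def)
qed (simp_all add: sgn_bergman_def dist_bergman_def uniformity_bergman_def open_bergman_def)

end

lemma norm_bergman_eq:
  "norm f = sqrt (\<integral>z. (norm (bergman_fun f z))\<^sup>2 \<partial>disk_area)"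
  by (simp add: norm_bergman_def cinner_self)

lemma norm_cscale: "norm (cscale c f) = norm c * norm f"
  by (simp add: norm_bergman_eq cscale.rep_eq norm_mult power_mult_distrib real_sqrt_mult)


section \<open>Operators on the Bergman space\<close>

text \<open>The type \<^typ>\<open>bergman \<Rightarrow>\<^sub>L bergman\<close> consists of the bounded real-linear operators; complex
  linearity is required separately.\<close>

definition complex_linear :: "(bergman \<Rightarrow>\<^sub>L bergman) \<Rightarrow> bool" where
  "complex_linear T \<longleftrightarrow> (\<forall>c f. T (cscale c f) = cscale c (T f))"

lemma bounded_linear_cscale: "bounded_linear (cscale c)"
proof (rule bounded_linear_intro)
  show "cscale c (f + g) = cscale c f + cscale c g" for f g
    by (rule bergman.scale_right_distrib)
  show "cscale c (r *\<^sub>R f) = r *\<^sub>R cscale c f" for r f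
    by (simp add: scaleR_bergman_eq mult.commute)
  show "norm (cscale c f) \<le> norm f * norm c" for f
    by (simp add: norm_cscale mult.commute)
qed

definition cscale_op :: "complex \<Rightarrow> (bergman \<Rightarrow>\<^sub>L bergman) \<Rightarrow> (bergman \<Rightarrow>\<^sub>L bergman)" where
  "cscale_op c T = Blinfun (cscale c) o\<^sub>L T"

lemma cscale_op_apply: "cscale_op c T f = cscale c (T f)"
  by (simp add: cscale_op_def bounded_linear_Blinfun_apply bounded_linear_cscale)

global_interpretation bergman_op: vector_space cscale_op
proof
  fix a b and x y :: "bergman \<Rightarrow>\<^sub>L bergman"
  show "cscale_op a (x + y) = cscale_op a x + cscale_op a y"
    by (rule blinfun_eqI) (simp add: cscale_op_apply blinfun.add_left bergman.scale_right_distrib)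
  show "cscale_op (a + b) x = cscale_op a x + cscale_op b x"
    by (rule blinfun_eqI) (simp add: cscale_op_apply blinfun.add_left bergman.scale_left_distrib)
  show "cscale_op a (cscale_op b x) = cscale_op (a * b) x"
    by (rule blinfun_eqI) (simp add: cscale_op_apply)
  show "cscale_op 1 x = x"
    by (rule blinfun_eqI) (simp add: cscale_op_apply)
qed

text \<open>On complex-linear operators this is the Hilbert space adjoint, which exists by completeness of
  the Bergman space and is unique by \<open>hilbert_adjoint_eqI\<close> below.\<close>

definition hilbert_adjoint :: "(bergman \<Rightarrow>\<^sub>L bergman) \<Rightarrow> (bergman \<Rightarrow>\<^sub>L bergman)" where
  "hilbert_adjoint T = (THE S :: bergman \<Rightarrow>\<^sub>L bergman. \<forall>f g. cinner (T f) g = cinner f (S g))"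

lemma hilbert_adjoint_eqI:
  fixes T S :: "bergman \<Rightarrow>\<^sub>L bergman"
  assumes "\<And>f g. cinner (T f) g = cinner f (S g)"
  shows "hilbert_adjoint T = S"
  unfolding hilbert_adjoint_def
proof (rule the_equality)
  fix S' :: "bergman \<Rightarrow>\<^sub>L bergman"
  assume "\<forall>f g. cinner (T f) g = cinner f (S' g)"
  then have eq: "cinner f (S' g) = cinner f (S g)" for f g using assms by metis
  show "S' = S"
  proof (rule blinfun_eqI)
    fix g
    have "inner f (S' g - S g) = 0" for f
      by (simp add: inner_diff_right) (simp add: inner_bergman_def eq)
    from this[of "S' g - S g"] have "S' g - S g = 0" by simp
    then show "S' g = S g" by simp
  qed
qed (use assms in auto)

text \<open>Only meaningful when \<open>\<phi>\<close> is bounded and holomorphic on the disk; see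
  \<open>mult_op_apply\<close> below.\<close>

definition mult_op :: "(complex \<Rightarrow> complex) \<Rightarrow> (bergman \<Rightarrow>\<^sub>L bergman)" where
  "mult_op \<phi> = Blinfun (\<lambda>f. Abs_bergman (\<lambda>z. \<phi> z * bergman_fun f z))"

lemma mult_op_apply:
  assumes hol: "\<phi> holomorphic_on unit_disk" and "bounded (\<phi> ` unit_disk)"
  shows "bergman_fun (mult_op \<phi> f) z = \<phi> z * bergman_fun f z"
proof -
  obtain C where C: "\<And>z. z \<in> unit_disk \<Longrightarrow> norm (\<phi> z) \<le> C"
    using assms(2) unfolding bounded_iff by (metis imageI)
  define T where "T f = Abs_bergman (\<lambda>z. \<phi> z * bergman_fun f z)" for f
  have T: "bergman_fun (T f) = (\<lambda>z. \<phi> z * bergman_fun f z)" for f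
    unfolding T_def
    by (intro Abs_bergman_inverse bergman_functions_mult[OF bergman_fun_in hol C])
  have "bounded_linear T"
  proof (rule bounded_linear_intro)
    show "T (f + g) = T f + T g" for f g
      by (simp add: bergman_fun_inject[symmetric] T plus_bergman.rep_eq distrib_left)
    show "T (r *\<^sub>R f) = r *\<^sub>R T f" for r f
      by (simp add: bergman_fun_inject[symmetric] T scaleR_bergman_eq cscale.rep_eq ac_simps)
    show "norm (T f) \<le> norm f * C" for f
    proof -
      have "0 \<le> C" using order_trans[OF norm_ge_zero C[of 0]] by simp
      have "(\<integral>z. (norm (bergman_fun (T f) z))\<^sup>2 \<partial>disk_area)
          \<le> (\<integral>z. C\<^sup>2 * (norm (bergman_fun f z))\<^sup>2 \<partial>disk_area)"
      proof (rule integral_mono)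
        show "integrable disk_area (\<lambda>z. (norm (bergman_fun (T f) z))\<^sup>2)"
          using bergman_fun_in[of "T f"] by (simp add: bergman_functions_def)
        show "integrable disk_area (\<lambda>z. C\<^sup>2 * (norm (bergman_fun f z))\<^sup>2)"
          using bergman_fun_in[of f] by (simp add: bergman_functions_def)
        show "(norm (bergman_fun (T f) z))\<^sup>2 \<le> C\<^sup>2 * (norm (bergman_fun f z))\<^sup>2" for z
        proof (cases "z \<in> unit_disk")
          case True
          then have "(norm (\<phi> z))\<^sup>2 \<le> C\<^sup>2" by (intro power_mono C) auto
          then show ?thesis
            by (simp add: T norm_mult power_mult_distrib mult_right_mono)
        next
          case False
          then show ?thesis
            using bergman_fun_in[of f] by (simp add: T bergman_functions_def)
        qed
      qed
      also have "\<dots> = C\<^sup>2 * (\<integral>z. (norm (bergman_fun f z))\<^sup>2 \<partial>disk_area)" by simp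
      finally have "norm (T f) \<le> sqrt (C\<^sup>2 * (\<integral>z. (norm (bergman_fun f z))\<^sup>2 \<partial>disk_area))"
        unfolding norm_bergman_eq by (rule real_sqrt_le_mono)
      then show ?thesis
        using \<open>0 \<le> C\<close> by (simp add: norm_bergman_eq real_sqrt_mult mult.commute)
    qed
  qed
  then have "blinfun_apply (mult_op \<phi>) = T"
    unfolding mult_op_def T_def by (rule bounded_linear_Blinfun_apply)
  then show ?thesis by (simp add: T)
qed

definition reducing_subspace :: "(bergman \<Rightarrow>\<^sub>L bergman) \<Rightarrow> bergman set \<Rightarrow> bool" where
  "reducing_subspace T M \<longleftrightarrow> bergman.subspace M \<and> closed M \<and>
     T ` M \<subseteq> M \<and> hilbert_adjoint T ` M \<subseteq> M"

definition minimal_reducing_subspace :: "(bergman \<Rightarrow>\<^sub>L bergman) \<Rightarrow> bergman set \<Rightarrow> bool" where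
  "minimal_reducing_subspace T M \<longleftrightarrow> reducing_subspace T M \<and> M \<noteq> {0} \<and>
     (\<forall>N. reducing_subspace T N \<and> N \<subseteq> M \<longrightarrow> N = {0} \<or> N = M)"

definition commutant :: "(bergman \<Rightarrow>\<^sub>L bergman) set \<Rightarrow> (bergman \<Rightarrow>\<^sub>L bergman) set" where
  "commutant \<A> = {T. complex_linear T \<and> (\<forall>A\<in>\<A>. T o\<^sub>L A = A o\<^sub>L T)}"

definition Vstar :: "(complex \<Rightarrow> complex) \<Rightarrow> (bergman \<Rightarrow>\<^sub>L bergman) set" where
  "Vstar \<phi> = commutant {mult_op \<phi>, hilbert_adjoint (mult_op \<phi>)}"


section \<open>Finite Blaschke products\<close>

text \<open>\<open>n\<close> is the order, i.e. the number of zeros \<open>a k\<close> counted with multiplicity; only the values of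
  \<open>B\<close> on the disk are constrained.\<close>

definition finite_Blaschke_product :: "nat \<Rightarrow> (complex \<Rightarrow> complex) \<Rightarrow> bool" where
  "finite_Blaschke_product n B \<longleftrightarrow> (\<exists>c a. norm c = 1 \<and> (\<forall>k<n. a k \<in> unit_disk) \<and>
     (\<forall>z\<in>unit_disk. B z = c * (\<Prod>k<n. (z - a k) / (1 - cnj (a k) * z))))"

definition critical_set :: "(complex \<Rightarrow> complex) \<Rightarrow> complex set" where
  "critical_set B = {z \<in> unit_disk. deriv B z = 0}"

end

theory Submission
  imports Defs
begin

text \<open>
  Let \<open>T\<close> commute with \<open>M = mult_op B\<close> and its adjoint.  A function that vanishes on a fiber of \<open>B\<close>
  without critical points is a multiple of \<open>B - w\<close>, so \<open>T f z = B' z \<cdot> (\<Sum>y. C z y \<cdot> f y / B' y)\<close>, where \<open>y\<close>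
  runs over the fiber of \<open>z\<close> and \<open>C\<close> depends holomorphically on the fiber.  All
  measures \<open>(T f \<cdot> cnj g - f \<cdot> cnj (T\<^sup>* g)) dA\<close> are mapped to \<open>0\<close> by \<open>B\<close>; taking densities shows that \<open>C\<close> is
  the conjugate of the transposed matrix of \<open>T\<^sup>*\<close>.  Hence \<open>C\<close> is both holomorphic and
  antiholomorphic, that is, locally constant.

  Around a critical value exactly two points of the fiber are exchanged.  Let
  \<open>G x = (\<Prod>y. x - y)\<close>, where \<open>y\<close> runs over the points of the fiber of \<open>x\<close> for which the transposition
  of \<open>x\<close> and \<open>y\<close> does not preserve the columns of \<open>C\<close> outside the rows \<open>x\<close> and \<open>y\<close>.  It
  extends to a holomorphic function on the disk without zeros, so it has a logarithm; near the
  circle, \<open>G x = x ^ k \<cdot> (\<Prod>y. 1 - y / x)\<close> with all factors \<open>1 - y / x\<close> in the slit plane, so \<open>G\<close> has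
  winding number \<open>k\<close>, the number of factors.  Therefore \<open>k = 0\<close>, and \<open>C\<close> has one value on and one value
  off the diagonal, which bounds the dimension of the commutant by 2.

  Conversely \<open>M\<^sup>* (B' B ^ k) = k / (k + 1) \<cdot> B' B ^ (k - 1)\<close> by Stokes' theorem and \<open>norm B = 1\<close> on the
  circle, so the functions \<open>B' B ^ k\<close> span a reducing subspace.  It is not the whole space, because
  \<open>f \<mapsto> f y / B' y\<close> is the same functional on it for all \<open>y\<close> in a fiber.
\<close>


section \<open>The normalized area measure\<close>

text \<open>The classical reason for two values is that \<open>C\<close> is invariant under the
  monodromy group, that this group is transitive because \<open>D0\<close> is connected, and that a
  transitive group generated by transpositions is the full symmetric group. Here neither the group
  nor a base point appears. Being swappable is a locally constant property of a pair in one fiber,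
  so it can be compared between neighbouring fibers, and a count of zeros replaces the argument
  about generators. The obstacle is that a product of all differences \<open>x - y\<close> would
  vanish at critical points; a factor that would vanish there belongs to a swappable pair and is
  therefore left out, which is why \<open>G\<close> has no zeros. Commutation with the adjoint of
  \<open>M\<close> is used in the form that the adjoint of \<open>T\<close> also commutes with
  \<open>M\<close>. This is what makes multiplication by \<open>cnj w\<close> available for the
  image measures, and the continuous test functions with it. Order at least 2 is essential: for
  order 1 the function \<open>B\<close> is an automorphism of the disk, all fibers are single points
  and the complement of the span of the functions \<open>B' B ^ k\<close> is zero.\<close>

lemma distr_lborel_orthogonal_transformation:
  fixes f :: "'a::euclidean_space \<Rightarrow> 'a"
  assumes f: "orthogonal_transformation f"
  shows "distr lborel borel f = lborel"
proof -
  have lin: "linear f" and bij: "bij f" and iso: "\<And>x y. dist (f x) (f y) = dist x y"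
    using f orthogonal_transformation_bij orthogonal_transformation_isometry
    by (auto simp: orthogonal_transformation_linear)
  define g where "g = inv f"
  have fg: "f (g x) = x" and gf: "g (f x) = x" for x
    using bij by (auto simp: g_def bij_is_inj bij_is_surj surj_f_inv_f)
  have g: "linear g"
    using orthogonal_transformation_inv[OF f] by (simp add: g_def orthogonal_transformation_linear)
  have [measurable]: "f \<in> borel \<rightarrow>\<^sub>M borel"
    by (intro borel_measurable_continuous_onI linear_continuous_on linear_linear[THEN iffD2] lin)
  let ?D = "distr lborel borel f"
  have vim: "f -` X = g ` X" for X
    using fg gf by (auto simp: image_iff) metis
  have ball: "emeasure ?D (ball x r) = emeasure lborel (ball x r)" for x r
  proof (cases "r \<ge> 0")
    case True
    have "f -` ball x r = ball (g x) r"
      using iso[of "g x"] by (auto simp: fg)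
    then show ?thesis
      using True by (simp add: emeasure_distr emeasure_ball)
  qed (simp add: ball_empty)
  \<comment> \<open>An isometry carries balls to balls of the same radius, and Vitali's theorem
    fills an open set with disjoint balls up to a negligible set. Agreement on open sets includes
    boxes, which identify \<open>lborel\<close>.\<close>
  have "emeasure ?D U = emeasure lborel U" if "open U" for U
  proof -
    define K where "K = {(x, r). 0 < r \<and> ball x r \<subseteq> U}"
    obtain C where C: "countable C" "C \<subseteq> K"
      "pairwise (\<lambda>i j. disjnt (ball (fst i) (snd i)) (ball (fst j) (snd j))) C"
      "negligible (U - (\<Union>i\<in>C. ball (fst i) (snd i)))"
    proof (rule Vitali_covering_theorem_balls[of U K fst snd])
      fix x d assume x: "x \<in> U" "(0::real) < d"
      obtain e where e: "e > 0" "ball x e \<subseteq> U" using \<open>open U\<close> x openE by blast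
      show "\<exists>i. i \<in> K \<and> x \<in> ball (fst i) (snd i) \<and> snd i < d"
        using e x by (intro exI[of _ "(x, min e (d/2))"]) (auto simp: K_def)
    qed blast
    define W where "W = (\<Union>i\<in>C. ball (fst i) (snd i))"
    have W: "W \<in> sets borel" "open W" unfolding W_def by (auto intro!: open_UN borel_open)
    have WU: "W \<subseteq> U" using C(2) unfolding W_def K_def by fastforce
    have neg: "negligible (U - W)" using C(4) by (simp add: W_def)
    have UW: "U - W \<in> sets borel" using that W by auto
    have null: "emeasure lborel X = 0" if "negligible X" "X \<in> sets borel" for X :: "'a set"
    proof -
      have "X \<in> null_sets lebesgue" using that by (simp add: negligible_iff_null_sets)
      then have "emeasure lebesgue X = 0" by auto
      then show ?thesis using that by (simp add: emeasure_completion)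
    qed
    have 1: "emeasure lborel (U - W) = 0" by (rule null[OF neg UW])
    have "negligible (f -` (U - W))"
      unfolding vim
      by (intro negligible_differentiable_image_negligible[OF order_refl neg])
        (use g in \<open>auto simp: linear_imp_differentiable_on\<close>)
    moreover have "f -` (U - W) \<in> sets borel"
      using measurable_sets_borel[OF \<open>f \<in> _\<close> UW] .
    ultimately have 2: "emeasure ?D (U - W) = 0"
      using UW by (simp add: emeasure_distr null)
    have dis: "disjoint_family_on (\<lambda>i. ball (fst i) (snd i)) C"
      using C(3) by (auto simp: disjoint_family_on_def pairwise_def disjnt_def)
    have 3: "emeasure ?D W = emeasure lborel W"
      unfolding W_def using C(1) dis
      by (subst (1 2) emeasure_UN_countable) (auto simp: ball)
    have "emeasure M U = emeasure M W + emeasure M (U - W)"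
      if "sets M = sets borel" for M
      using WU W UW that by (subst plus_emeasure) (auto simp: Un_absorb1)
    from this[of ?D] this[of lborel] show ?thesis by (simp add: 1 2 3)
  qed
  then have "emeasure ?D (box l u) = emeasure lborel (box l u)" for l u
    by blast
  then have "lborel = ?D"
    by (intro lborel_eqI) (auto simp: emeasure_lborel_box_eq)
  then show ?thesis by simp
qed

lemma orthogonal_transformation_unimodular_mult:
  "norm c = 1 \<Longrightarrow> orthogonal_transformation (\<lambda>z::complex. c * z)"
  by (auto simp: orthogonal_transformation norm_mult intro!: linearI algebra_simps)

lemma emeasure_unit_disk: "emeasure lborel unit_disk = ennreal pi"
  by (simp add: emeasure_ball unit_ball_vol_2)

lemma emeasure_disk_area:
  assumes "A \<in> sets borel"
  shows "emeasure disk_area A = emeasure lborel (unit_disk \<inter> A) / ennreal pi"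
  using assms by (simp add: emeasure_uniform_measure emeasure_unit_disk)

interpretation disk_area: finite_measure disk_area
  by (rule finite_measureI) (simp add: emeasure_disk_area emeasure_unit_disk ennreal_divide_eq_top_iff)

lemma measure_disk_area_ball:
  assumes "ball y r \<subseteq> unit_disk" "0 \<le> r"
  shows "measure disk_area (ball y r) = r\<^sup>2"
proof -
  have "emeasure disk_area (ball y r) = ennreal (pi * r\<^sup>2) / ennreal pi"
    using assms by (simp add: emeasure_disk_area Int_absorb1 emeasure_ball unit_ball_vol_2)
  also have "\<dots> = ennreal (r\<^sup>2)" by (simp add: divide_ennreal)
  finally show ?thesis by (simp add: measure_def)
qed

lemma AE_disk_area: "AE z in disk_area. z \<in> unit_disk"
  by (rule AE_uniform_measureI) auto

lemma distr_disk_area_rotation: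
  assumes "norm c = 1"
  shows "distr disk_area borel (\<lambda>z. c * z) = disk_area"
proof (rule measure_eqI)
  fix A assume "A \<in> sets (distr disk_area borel ((*) c))"
  then have A: "A \<in> sets borel" by simp
  have vim: "(*) c -` A \<in> sets borel"
    using measurable_sets_borel[of "(*) c" borel A] A by simp
  have "emeasure (distr disk_area borel ((*) c)) A = emeasure lborel (unit_disk \<inter> (*) c -` A) / ennreal pi"
    using A vim by (subst emeasure_distr) (simp_all add: emeasure_unit_disk)
  also have "unit_disk \<inter> (*) c -` A = (*) c -` (unit_disk \<inter> A)"
    using assms by (auto simp: norm_mult)
  also have "emeasure lborel \<dots> = emeasure (distr lborel borel ((*) c)) (unit_disk \<inter> A)"
    using A by (subst emeasure_distr) auto
  also have "\<dots> = emeasure lborel (unit_disk \<inter> A)"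
    using distr_lborel_orthogonal_transformation[OF orthogonal_transformation_unimodular_mult[OF assms]]
    by simp
  also have "\<dots> / ennreal pi = emeasure disk_area A"
    using A by (simp add: emeasure_unit_disk)
  finally show "emeasure (distr disk_area borel ((*) c)) A = emeasure disk_area A" .
qed simp

lemma integral_disk_area_rotation:
  fixes f :: "complex \<Rightarrow> complex"
  assumes "norm c = 1" "f \<in> borel_measurable borel"
  shows "(\<integral>z. f (c * z) \<partial>disk_area) = (\<integral>z. f z \<partial>disk_area)"
  using integral_distr[of "(*) c" disk_area borel f] assms by (simp add: distr_disk_area_rotation)

text \<open>A layer-cake argument takes the place of polar coordinates:
  \<open>norm z ^ (2 * m)\<close> is the integral of its radial derivative over
  \<open>0 \<le> s \<le> norm z\<close>. After exchanging the integrals only the normalized areas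
  \<open>r\<^sup>2 - s\<^sup>2\<close> of annuli occur.\<close>

lemma integral_disk_area_norm_power:
  assumes r: "0 \<le> r" "r \<le> 1"
  shows "(\<integral>z. indicator (ball 0 r) z * norm z ^ (2 * m) \<partial>disk_area) = r ^ (2 * m + 2) / (m + 1)"
proof (cases "m = 0")
  case True
  have "(\<integral>z. indicator (ball 0 r) z * norm z ^ (2 * m) \<partial>disk_area) = measure disk_area (ball 0 r)"
    using True by simp
  also have "\<dots> = r\<^sup>2" using r by (intro measure_disk_area_ball) auto
  finally show ?thesis using True by (simp add: power2_eq_square)
next
  case False
  \<comment> \<open>The derivative of \<open>s ^ (2 * m)\<close> is \<open>Suc k * s ^ k\<close>;
    the case \<open>m = 0\<close> was split off because the subtraction is truncated.\<close>
  define k where "k = 2 * m - 1"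
  have k: "2 * m = Suc k" using False by (simp add: k_def)
  let ?h = "\<lambda>(s::real) (z::complex). ennreal (Suc k * s ^ k) * indicator {0..r} s * indicator {z. s \<le> norm z \<and> norm z < r} z"
  have inner: "(\<integral>\<^sup>+s. ?h s z \<partial>lborel) = ennreal (indicator (ball 0 r) z * norm z ^ (2 * m))" for z :: complex
  proof (cases "norm z < r")
    case True
    have "(\<integral>\<^sup>+s. ?h s z \<partial>lborel) = (\<integral>\<^sup>+s. ennreal (Suc k * s ^ k) * indicator {0..norm z} s \<partial>lborel)"
      using True by (intro nn_integral_cong) (auto simp: indicator_def)
    also have "\<dots> = ennreal (norm z ^ Suc k - 0 ^ Suc k)"
      by (rule nn_integral_FTC_Icc[where F = "\<lambda>s. s ^ Suc k"])
        (auto intro!: derivative_eq_intros simp del: power_Suc)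
    finally show ?thesis using True by (simp add: k)
  qed (simp add: indicator_def)
  have outer: "(\<integral>\<^sup>+z. ?h s z \<partial>disk_area) = ennreal (Suc k * s ^ k * (r\<^sup>2 - s\<^sup>2)) * indicator {0..r} s" for s :: real
  proof (cases "s \<in> {0..r}")
    case True
    have "{z::complex. s \<le> norm z \<and> norm z < r} = ball 0 r - ball 0 s" by auto
    moreover have "emeasure disk_area (ball 0 r - ball 0 s) = ennreal (r\<^sup>2 - s\<^sup>2)"
    proof -
      have "measure disk_area (ball 0 r - ball 0 s) = measure disk_area (ball 0 r) - measure disk_area (ball 0 s)"
        using True by (intro disk_area.finite_measure_Diff) auto
      also have "\<dots> = r\<^sup>2 - s\<^sup>2" using True r by (subst (1 2) measure_disk_area_ball) auto
      finally show ?thesis by (simp add: disk_area.emeasure_eq_measure)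
    qed
    ultimately show ?thesis using True
      by (simp add: nn_integral_cmult_indicator ennreal_mult[symmetric] power_mono
          del: emeasure_uniform_measure of_nat_Suc)
  qed simp
  have sf: "pair_sigma_finite lborel disk_area"
    by (simp add: pair_sigma_finite_def lborel.sigma_finite_measure_axioms disk_area.sigma_finite_measure_axioms)
  have "(\<integral>\<^sup>+z. ennreal (indicator (ball 0 r) z * norm z ^ (2 * m)) \<partial>disk_area)
      = (\<integral>\<^sup>+z. \<integral>\<^sup>+s. ?h s z \<partial>lborel \<partial>disk_area)"
    by (simp only: inner)
  also have "\<dots> = (\<integral>\<^sup>+s. \<integral>\<^sup>+z. ?h s z \<partial>disk_area \<partial>lborel)"
    by (rule pair_sigma_finite.Fubini'[OF sf]) measurable
  also have "\<dots> = (\<integral>\<^sup>+s. ennreal (Suc k * s ^ k * (r\<^sup>2 - s\<^sup>2)) * indicator {0..r} s \<partial>lborel)"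
    by (simp only: outer)
  also have "\<dots> = ennreal ((r ^ Suc k * r\<^sup>2 - Suc k / (k + 3) * r ^ (k + 3)) - (0 ^ Suc k * r\<^sup>2 - Suc k / (k + 3) * 0 ^ (k + 3)))"
  proof (rule nn_integral_FTC_Icc[where F = "\<lambda>s. s ^ Suc k * r\<^sup>2 - Suc k / (k + 3) * s ^ (k + 3)"])
    show "((\<lambda>s. s ^ Suc k * r\<^sup>2 - Suc k / (k + 3) * s ^ (k + 3)) has_real_derivative Suc k * s ^ k * (r\<^sup>2 - s\<^sup>2)) (at s)"
      if "s \<in> {0..r}" for s :: real
    proof -
      have "((\<lambda>s. s ^ Suc k * r\<^sup>2 - Suc k / (k + 3) * s ^ (k + 3)) has_real_derivative
          Suc k * s ^ k * r\<^sup>2 - Suc k / (k + 3) * ((k + 3) * s ^ (k + 2))) (at s)"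
        by (auto intro!: derivative_eq_intros simp del: power_Suc simp: numeral_3_eq_3)
      also have "Suc k * s ^ k * r\<^sup>2 - Suc k / (k + 3) * ((k + 3) * s ^ (k + 2)) = Suc k * s ^ k * (r\<^sup>2 - s\<^sup>2)"
        by (simp add: field_simps power_add power2_eq_square)
      finally show ?thesis .
    qed
    show "0 \<le> Suc k * s ^ k * (r\<^sup>2 - s\<^sup>2)" if "s \<in> {0..r}" for s :: real
      using that by (auto simp: power_mono intro!: mult_nonneg_nonneg)
  qed (use r in auto)
  also have "(r ^ Suc k * r\<^sup>2 - Suc k / (k + 3) * r ^ (k + 3)) - (0 ^ Suc k * r\<^sup>2 - Suc k / (k + 3) * 0 ^ (k + 3))
      = r ^ (2 * m + 2) / (m + 1)"
  proof -
    have e: "k + 3 = 2 * m + 2" using k by simp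
    have R: "r ^ Suc k * r\<^sup>2 = r ^ (2 * m + 2)"
      using k by (simp add: power_add power2_eq_square mult_ac)
    have q: "real (Suc k) / real (k + 3) = m / (m + 1)"
      unfolding e k[symmetric] by (simp add: field_simps)
    have z: "(0::real) ^ (2 * m + 2) = 0" "(0::real) ^ Suc k = 0" by simp_all
    show ?thesis unfolding q unfolding R e z by (simp add: field_simps del: power_Suc)
  qed
  finally have nn: "(\<integral>\<^sup>+z. ennreal (indicator (ball 0 r) z * norm z ^ (2 * m)) \<partial>disk_area)
      = ennreal (r ^ (2 * m + 2) / (m + 1))" .
  have "(\<lambda>z::complex. indicator (ball 0 r) z * norm z ^ (2 * m)) \<in> borel_measurable borel"
    by (intro borel_measurable_times borel_measurable_indicator borel_measurable_continuous_onI continuous_intros) auto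
  then show ?thesis
    using r nn by (subst integral_eq_nn_integral) (auto simp: zero_le_divide_iff)
qed

section \<open>Monomials and point evaluation\<close>

text \<open>The cut-off is forced by the representation of elements by functions vanishing off the
  disk. For bounded holomorphic \<open>\<phi>\<close> the result has the expected values, by
  \<open>bergman_fun_bergman_of\<close>.\<close>

definition bergman_of :: "(complex \<Rightarrow> complex) \<Rightarrow> bergman" where
  "bergman_of \<phi> = Abs_bergman (\<lambda>z. if z \<in> unit_disk then \<phi> z else 0)"

lemma bergman_fun_bergman_of:
  assumes hol: "\<phi> holomorphic_on unit_disk" and "bounded (\<phi> ` unit_disk)"
  shows "bergman_fun (bergman_of \<phi>) = (\<lambda>z. if z \<in> unit_disk then \<phi> z else 0)"
proof -
  obtain C where C: "\<And>z. z \<in> unit_disk \<Longrightarrow> norm (\<phi> z) \<le> C"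
    using assms(2) unfolding bounded_iff by (metis imageI)
  let ?f = "\<lambda>z. if z \<in> unit_disk then \<phi> z else 0"
  have "?f holomorphic_on unit_disk"
    using hol by (rule holomorphic_transform) auto
  moreover have meas: "?f \<in> borel_measurable borel"
  proof -
    have "(\<lambda>z. indicator unit_disk z *\<^sub>R \<phi> z) \<in> borel_measurable borel"
      by (intro borel_measurable_continuous_on_indicator holomorphic_on_imp_continuous_on hol) auto
    also have "(\<lambda>z. indicator unit_disk z *\<^sub>R \<phi> z) = ?f" by (auto simp: indicator_def)
    finally show ?thesis .
  qed
  moreover have "integrable disk_area (\<lambda>z. (norm (?f z))\<^sup>2)"
  proof (rule disk_area.integrable_const_bound[where B = "C\<^sup>2"])
    have "norm ((norm (?f z))\<^sup>2) \<le> C\<^sup>2" for z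
      using power_mono[OF C, of z 2] by auto
    then show "AE z in disk_area. norm ((norm (?f z))\<^sup>2) \<le> C\<^sup>2" by simp
  qed (use meas in simp)
  ultimately show ?thesis
    unfolding bergman_of_def by (intro Abs_bergman_inverse) (auto simp: bergman_functions_def)
qed

lemma bergman_fun_holomorphic: "bergman_fun f holomorphic_on unit_disk"
  using bergman_fun_in[of f] by (simp add: bergman_functions_def)

lemma bergman_fun_outside: "z \<notin> unit_disk \<Longrightarrow> bergman_fun f z = 0"
  using bergman_fun_in[of f] by (simp add: bergman_functions_def)

lemma bergman_fun_measurable [measurable]: "bergman_fun f \<in> borel_measurable borel"
  by (rule bergman_functions_measurable[OF bergman_fun_in])

lemma bergman_eqI:
  assumes "\<And>z. z \<in> unit_disk \<Longrightarrow> bergman_fun f z = bergman_fun g z"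
  shows "f = g"
  unfolding bergman_fun_inject[symmetric] using assms bergman_fun_outside by fastforce

lemma bergman_of_polynomial:
  assumes "\<phi> holomorphic_on UNIV" "z \<in> unit_disk"
  shows "bergman_fun (bergman_of \<phi>) z = \<phi> z"
proof -
  have "compact (\<phi> ` cball 0 1)"
    by (intro compact_continuous_image holomorphic_on_imp_continuous_on holomorphic_on_subset[OF assms(1)]) auto
  then have "bounded (\<phi> ` unit_disk)"
    by (rule bounded_subset[OF compact_imp_bounded]) auto
  then show ?thesis
    using assms by (subst bergman_fun_bergman_of) (auto intro: holomorphic_on_subset)
qed

lemma norm_cinner_le: "norm (cinner f g) \<le> norm f * norm g"
proof (cases "cinner f g = 0")
  case False
  \<comment> \<open>Rotating \<open>f\<close> by the unimodular \<open>u\<close> makes the inner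
    product real and nonnegative, so the real Cauchy-Schwarz inequality applies.\<close>
  define u where "u = cnj (sgn (cinner f g))"
  have u: "norm u = 1" using False by (simp add: u_def norm_sgn)
  have "u * cinner f g = of_real ((norm (cinner f g))\<^sup>2) / of_real (norm (cinner f g))"
    unfolding complex_norm_square by (simp add: u_def sgn_eq)
  then have "u * cinner f g = of_real (norm (cinner f g))"
    using False by (simp add: power2_eq_square)
  then have "norm (cinner f g) = Re (cinner (cscale u f) g)"
    by (simp add: cinner_cscale_left)
  also have "\<dots> \<le> norm (cscale u f) * norm g"
    using norm_cauchy_schwarz[of "cscale u f" g] by (simp add: inner_bergman_def)
  finally show ?thesis by (simp add: norm_cscale u)
qed simp

lemma measure_disk_area_UNIV: "measure disk_area UNIV = 1"
  by (simp add: measure_def emeasure_disk_area emeasure_unit_disk)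

lemma integral_disk_area_monomials_eq_0:
  fixes k m :: nat
  assumes "k \<noteq> m"
  shows "(\<integral>z. indicator (ball 0 r) z *\<^sub>R (z ^ k * cnj z ^ m) \<partial>disk_area) = 0"
proof -
  \<comment> \<open>Rotation by this angle multiplies the integrand by \<open>-1\<close>; rotation
    invariance makes the integral equal to its own negative.\<close>
  define t where "t = pi / (real k - real m)"
  define c where "c = cis t"
  have c: "norm c = 1" by (simp add: c_def)
  have "c ^ k * cnj c ^ m = cis (t * (real k - real m))"
    by (simp add: c_def cis_cnj Complex.DeMoivre cis_mult algebra_simps)
  also have "\<dots> = -1" using assms by (simp add: t_def)
  finally have c': "c ^ k * cnj c ^ m = -1" .
  let ?g = "\<lambda>z. indicator (ball 0 r) z *\<^sub>R (z ^ k * cnj z ^ m)"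
  have "?g (c * z) = - ?g z" for z
  proof -
    have "(c * z) ^ k * cnj (c * z) ^ m = (c ^ k * cnj c ^ m) * (z ^ k * cnj z ^ m)"
      by (simp add: power_mult_distrib)
    moreover have "indicator (ball 0 r) (c * z) = (indicator (ball 0 r) z :: real)"
      using c by (simp add: indicator_def norm_mult)
    ultimately show ?thesis by (simp add: c')
  qed
  moreover have "?g \<in> borel_measurable borel"
    by (intro borel_measurable_continuous_on_indicator continuous_intros) auto
  ultimately have "(\<integral>z. - ?g z \<partial>disk_area) = (\<integral>z. ?g z \<partial>disk_area)"
    using integral_disk_area_rotation[OF c, of ?g] by simp
  then show ?thesis by (simp add: equation_minus_iff)
qed

abbreviation taylor_coeff :: "bergman \<Rightarrow> nat \<Rightarrow> complex" where
  "taylor_coeff f k \<equiv> (deriv ^^ k) (bergman_fun f) 0 / fact k"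

lemma taylor_coeff_sums:
  "z \<in> unit_disk \<Longrightarrow> (\<lambda>k. taylor_coeff f k * z ^ k) sums bergman_fun f z"
  using holomorphic_power_series[OF bergman_fun_holomorphic[of f], of z] by simp

text \<open>For radius \<open>r < 1\<close> the Taylor series converges absolutely and uniformly, so
  it may be integrated term by term; by orthogonality only the term of order \<open>m\<close>
  survives.\<close>

lemma integral_ball_monomial:
  assumes r: "0 < r" "r < 1"
  shows "(\<integral>z. indicator (ball 0 r) z *\<^sub>R (bergman_fun f z * cnj z ^ m) \<partial>disk_area)
    = taylor_coeff f m * of_real (r ^ (2 * m + 2) / (m + 1))"
proof -
  let ?a = "taylor_coeff f"
  define h where "h k z = indicator (ball 0 r) z *\<^sub>R (?a k * z ^ k * cnj z ^ m)" for k and z :: complex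
  have summ: "summable (\<lambda>k. norm (?a k) * r ^ k)"
  proof -
    \<comment> \<open>A point of the unit disk beyond radius \<open>r\<close>: convergence there
      implies absolute convergence at \<open>r\<close>.\<close>
    have n: "norm (complex_of_real ((1 + r) / 2)) = (1 + r) / 2"
      using r by (simp del: of_real_divide of_real_add)
    then have "complex_of_real ((1 + r) / 2) \<in> unit_disk"
      using r by (simp del: of_real_divide of_real_add)
    then have "summable (\<lambda>k. ?a k * complex_of_real ((1 + r) / 2) ^ k)"
      using taylor_coeff_sums sums_summable by blast
    then have "summable (\<lambda>k. norm (?a k * of_real r ^ k))"
      by (rule powser_insidea) (use r in \<open>simp add: n del: of_real_divide of_real_add\<close>)
    then show ?thesis using r by (simp add: norm_mult norm_power norm_divide)
  qed
  have le: "norm (h k z) \<le> norm (?a k) * r ^ k" for k z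
  proof (cases "norm z < r")
    case True
    then have "norm z ^ k * norm z ^ m \<le> r ^ k * 1"
      using r by (intro mult_mono power_mono power_le_one) auto
    then have "norm (?a k) * (norm z ^ k * norm z ^ m) \<le> norm (?a k) * r ^ k"
      by (intro mult_left_mono) auto
    then show ?thesis using True by (simp add: h_def norm_mult norm_power norm_divide mult.assoc)
  qed (use r in \<open>simp add: h_def\<close>)
  have meas: "h k \<in> borel_measurable borel" for k
    unfolding h_def by (intro borel_measurable_continuous_on_indicator continuous_intros) auto
  have int: "integrable disk_area (h k)" for k
    by (rule disk_area.integrable_const_bound[where B = "norm (?a k) * r ^ k"]) (use le meas in auto)
  have "(\<lambda>k. \<integral>z. h k z \<partial>disk_area) sums (\<integral>z. (\<Sum>k. h k z) \<partial>disk_area)"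
  proof (rule sums_integral[OF int])
    show "AE z in disk_area. summable (\<lambda>k. norm (h k z))"
      using le by (auto intro!: summable_comparison_test'[OF summ, of 0])
    have "(\<integral>z. norm (h k z) \<partial>disk_area) \<le> (\<integral>z. norm (?a k) * r ^ k \<partial>disk_area)" for k
      by (intro integral_mono integrable_norm int le) simp
    then have "norm (\<integral>z. norm (h k z) \<partial>disk_area) \<le> norm (?a k) * r ^ k" for k
      by (simp add: measure_disk_area_UNIV)
    then show "summable (\<lambda>k. \<integral>z. norm (h k z) \<partial>disk_area)"
      by (intro summable_comparison_test'[OF summ, of 0]) auto
  qed
  moreover have "(\<Sum>k. h k z) = indicator (ball 0 r) z *\<^sub>R (bergman_fun f z * cnj z ^ m)" for z
  proof (cases "norm z < r")
    case True
    then have "(\<lambda>k. ?a k * z ^ k * cnj z ^ m) sums (bergman_fun f z * cnj z ^ m)"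
      using r by (intro sums_mult2 taylor_coeff_sums) auto
    then show ?thesis using True by (simp add: h_def sums_iff)
  qed (simp add: h_def)
  moreover have "(\<integral>z. h k z \<partial>disk_area) = (if k = m then ?a m * of_real (r ^ (2 * m + 2) / (m + 1)) else 0)" for k
  proof -
    have "(\<integral>z. h k z \<partial>disk_area) = ?a k * (\<integral>z. indicator (ball 0 r) z *\<^sub>R (z ^ k * cnj z ^ m) \<partial>disk_area)"
      unfolding h_def by (subst integral_mult_right_zero[symmetric]) (simp add: mult.assoc)
    also have "\<dots> = (if k = m then ?a m * of_real (r ^ (2 * m + 2) / (m + 1)) else 0)"
    proof (cases "k = m")
      case True
      have "z ^ m * cnj z ^ m = of_real (norm z ^ (2 * m))" for z
        by (simp add: power_mult_distrib[symmetric] complex_norm_square[symmetric] power_mult)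
      then have "indicator (ball 0 r) z *\<^sub>R (z ^ m * cnj z ^ m)
          = complex_of_real (indicator (ball 0 r) z * norm z ^ (2 * m))" for z :: complex
        by (simp add: scaleR_conv_of_real)
      then show ?thesis
        using True integral_disk_area_norm_power[of r m] r by (simp del: of_real_mult)
    qed (simp add: integral_disk_area_monomials_eq_0)
    finally show ?thesis .
  qed
  ultimately have "(\<lambda>k. if k = m then ?a m * of_real (r ^ (2 * m + 2) / (m + 1)) else 0) sums
      (\<integral>z. indicator (ball 0 r) z *\<^sub>R (bergman_fun f z * cnj z ^ m) \<partial>disk_area)"
    by simp
  moreover have "(\<lambda>k. if k = m then ?a m * of_real (r ^ (2 * m + 2) / (m + 1)) else 0) sums (?a m * of_real (r ^ (2 * m + 2) / (m + 1)))"
    using sums_If_finite_set[of "{m}" "\<lambda>k. ?a m * of_real (r ^ (2 * m + 2) / (m + 1))"] by simp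
  ultimately show ?thesis by (rule sums_unique2)
qed

lemma cinner_bergman_of:
  assumes "\<phi> holomorphic_on unit_disk" "bounded (\<phi> ` unit_disk)"
  shows "cinner f (bergman_of \<phi>) = (\<integral>z. bergman_fun f z * cnj (\<phi> z) \<partial>disk_area)"
  unfolding cinner_def bergman_fun_bergman_of[OF assms]
  by (intro Bochner_Integration.integral_cong) (auto simp: bergman_fun_outside)

lemma bounded_monomial: "bounded ((\<lambda>z::complex. z ^ m) ` unit_disk)"
  by (auto simp: bounded_iff norm_power intro!: exI[of _ 1] power_le_one)

text \<open>The radius in \<open>integral_ball_monomial\<close> tends to 1, with dominated
  convergence. Pairing with monomials thus reads off Taylor coefficients; \<open>1 / (m + 1)\<close>
  is the squared norm of \<open>z ^ m\<close>.\<close>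

lemma cinner_monomial: "cinner f (bergman_of (\<lambda>z. z ^ m)) = taylor_coeff f m / (m + 1)"
proof -
  define r where "r n = 1 - 1 / (real n + 2)" for n
  have r: "0 < r n" "r n < 1" for n by (auto simp: r_def field_simps)
  have lim: "r \<longlonglongrightarrow> 1" unfolding r_def by real_asymp
  let ?g = "\<lambda>z. bergman_fun f z * cnj z ^ m"
  have [measurable]: "?g \<in> borel_measurable borel"
    by (intro borel_measurable_times bergman_fun_measurable borel_measurable_continuous_onI continuous_intros)
  have eval: "bergman_fun (bergman_of (\<lambda>z. z ^ m)) = (\<lambda>z. if z \<in> unit_disk then z ^ m else 0)"
    by (intro bergman_fun_bergman_of bounded_monomial holomorphic_intros)
  have ev: "\<forall>\<^sub>F n in sequentially. z \<in> ball 0 (r n)" if "z \<in> unit_disk" for z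
    using order_tendstoD(1)[OF lim, of "norm z"] that by simp
  have "(\<lambda>n. \<integral>z. indicator (ball 0 (r n)) z *\<^sub>R ?g z \<partial>disk_area) \<longlonglongrightarrow> (\<integral>z. ?g z \<partial>disk_area)"
  proof (rule integral_dominated_convergence[where w = "\<lambda>z. norm (?g z)"])
    have "integrable disk_area ?g"
      using bergman_functions_integrable[OF bergman_fun_in[of f] bergman_fun_in[of "bergman_of (\<lambda>z. z ^ m)"]]
      by (rule Bochner_Integration.integrable_cong[THEN iffD1, rotated -1]) (auto simp: eval bergman_fun_outside)
    then show "integrable disk_area (\<lambda>z. norm (?g z))" by (rule integrable_norm)
    show "AE z in disk_area. (\<lambda>n. indicator (ball 0 (r n)) z *\<^sub>R ?g z) \<longlonglongrightarrow> ?g z"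
      using AE_disk_area
    proof eventually_elim
      case (elim z)
      have "\<forall>\<^sub>F n in sequentially. indicator (ball 0 (r n)) z *\<^sub>R ?g z = ?g z"
        using ev[OF elim] by eventually_elim simp
      then show ?case by (rule tendsto_eventually)
    qed
  qed (auto simp: indicator_def)
  moreover have "(\<lambda>n. \<integral>z. indicator (ball 0 (r n)) z *\<^sub>R ?g z \<partial>disk_area)
      \<longlonglongrightarrow> taylor_coeff f m * of_real (1 ^ (2 * m + 2) / (m + 1))"
    unfolding integral_ball_monomial[OF r] by (intro tendsto_intros lim) simp
  ultimately have "(\<integral>z. ?g z \<partial>disk_area) = taylor_coeff f m * of_real (1 ^ (2 * m + 2) / (m + 1))"
    by (rule LIMSEQ_unique)
  then show ?thesis
    by (subst cinner_bergman_of) (auto intro!: bounded_monomial holomorphic_intros simp: divide_simps add.commute)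
qed

lemma norm_bergman_of_le:
  assumes "\<phi> holomorphic_on unit_disk" "\<And>z. z \<in> unit_disk \<Longrightarrow> norm (\<phi> z) \<le> C"
  shows "norm (bergman_of \<phi>) \<le> C"
proof -
  have C: "0 \<le> C" using order_trans[OF norm_ge_zero assms(2)[of 0]] by simp
  have eval: "bergman_fun (bergman_of \<phi>) = (\<lambda>z. if z \<in> unit_disk then \<phi> z else 0)"
    by (intro bergman_fun_bergman_of) (use assms in \<open>auto simp: bounded_iff intro!: exI[of _ C]\<close>)
  have "(\<integral>z. (norm (bergman_fun (bergman_of \<phi>) z))\<^sup>2 \<partial>disk_area) \<le> (\<integral>z. C\<^sup>2 \<partial>disk_area)"
  proof (rule integral_mono)
    show "integrable disk_area (\<lambda>z. (norm (bergman_fun (bergman_of \<phi>) z))\<^sup>2)"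
      using bergman_fun_in[of "bergman_of \<phi>"] by (simp add: bergman_functions_def)
  qed (use power_mono[OF assms(2)] in \<open>auto simp: eval\<close>)
  then have "norm (bergman_of \<phi>) \<le> sqrt (C\<^sup>2)"
    unfolding norm_bergman_eq by (intro real_sqrt_le_mono) (simp add: measure_disk_area_UNIV)
  then show ?thesis using C by simp
qed

text \<open>Pairing with \<open>z ^ k\<close>, of norm at most 1, bounds the Taylor coefficients by
  \<open>(k + 1) * norm f\<close>, and these bounds sum to a geometric derivative series. Bounded
  point evaluation is used for completeness and for Riesz representation of functionals built from
  values.\<close>

lemma norm_bergman_fun_le:
  assumes "z \<in> unit_disk"
  shows "norm (bergman_fun f z) \<le> norm f / (1 - norm z)\<^sup>2"
proof -
  have a: "norm (taylor_coeff f k) \<le> Suc k * norm f" for k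
  proof -
    have "norm (cinner f (bergman_of (\<lambda>z. z ^ k))) \<le> norm f * 1"
      by (rule order_trans[OF norm_cinner_le], intro mult_left_mono norm_bergman_of_le)
        (auto intro!: holomorphic_intros simp: norm_power power_le_one)
    moreover have "norm (cinner f (bergman_of (\<lambda>z. z ^ k))) = norm (taylor_coeff f k) / Suc k"
      unfolding cinner_monomial norm_divide using norm_of_nat[of "Suc k", where 'a = complex] by simp
    ultimately show ?thesis
      by (simp add: pos_divide_le_eq mult.commute del: of_nat_Suc)
  qed
  have le: "norm (taylor_coeff f k * z ^ k) \<le> norm f * (Suc k * norm z ^ k)" for k
    using mult_right_mono[OF a, of "norm z ^ k" k] by (simp add: norm_mult norm_power norm_divide mult_ac)
  have "(\<lambda>k. norm f * (Suc k * norm z ^ k)) sums (norm f * (1 / (1 - norm z)\<^sup>2))"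
    using assms by (intro sums_mult geometric_deriv_sums) auto
  moreover note taylor_coeff_sums[OF assms, of f]
  ultimately have "norm (bergman_fun f z) \<le> norm f * (1 / (1 - norm z)\<^sup>2)"
    by (intro norm_sums_le[OF _ _ le])
  then show ?thesis by simp
qed

section \<open>Completeness and orthogonal projections\<close>

text \<open>Bounded point evaluation turns a Cauchy sequence into a locally uniformly convergent
  one, so the pointwise limit is holomorphic; Fatou's lemma bounds the distance to the
  limit.\<close>

instance bergman :: complete_space
proof
  fix X :: "nat \<Rightarrow> bergman"
  assume X: "Cauchy X"
  define g where "g z = lim (\<lambda>n. bergman_fun (X n) z)" for z
  have diff: "bergman_fun (f - h) z = bergman_fun f z - bergman_fun h z" for f h z
    by (simp add: minus_bergman.rep_eq)
  have unif: "uniform_limit (cball 0 r) (\<lambda>n. bergman_fun (X n)) g sequentially" if r: "0 \<le> r" "r < 1" for r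
  proof -
    have "uniformly_Cauchy_on (cball 0 r) (\<lambda>n. bergman_fun (X n))"
    proof (rule uniformly_Cauchy_onI)
      fix e :: real assume e: "e > 0"
      obtain M where M: "\<And>m n. m \<ge> M \<Longrightarrow> n \<ge> M \<Longrightarrow> dist (X m) (X n) < e * (1 - r)\<^sup>2"
        using X e r unfolding Cauchy_def by (metis diff_gt_0_iff_gt mult_pos_pos zero_less_power)
      have "dist (bergman_fun (X m) z) (bergman_fun (X n) z) < e" if "z \<in> cball 0 r" "m \<ge> M" "n \<ge> M" for z m n
      proof -
        have "dist (bergman_fun (X m) z) (bergman_fun (X n) z) \<le> norm (X m - X n) / (1 - norm z)\<^sup>2"
          using norm_bergman_fun_le[of z "X m - X n"] that r by (simp add: dist_norm diff)
        also have "\<dots> \<le> norm (X m - X n) / (1 - r)\<^sup>2"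
          using that r by (intro divide_left_mono power_mono mult_pos_pos zero_less_power) auto
        also have "\<dots> < e"
          using M[OF that(2,3)] r by (simp add: dist_norm pos_divide_less_eq)
        finally show ?thesis .
      qed
      then show "\<exists>M. \<forall>x\<in>cball 0 r. \<forall>m\<ge>M. \<forall>n\<ge>M. dist (bergman_fun (X m) x) (bergman_fun (X n) x) < e"
        by blast
    qed
    then have "uniformly_convergent_on (cball 0 r) (\<lambda>n. bergman_fun (X n))"
      by (rule Cauchy_uniformly_convergent)
    then show ?thesis
      unfolding uniformly_convergent_uniform_limit_iff g_def .
  qed
  have lim: "(\<lambda>n. bergman_fun (X n) z) \<longlonglongrightarrow> g z" for z
  proof (cases "z \<in> unit_disk")
    case True
    then show ?thesis using tendsto_uniform_limitI[OF unif[of "norm z"], of z] by simp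
  qed (simp add: g_def bergman_fun_outside)
  have hol: "g holomorphic_on unit_disk"
  proof (rule holomorphic_uniform_sequence)
    fix z assume z: "z \<in> unit_disk"
    define d where "d = (1 - norm z) / 2"
    have d: "0 < d" "norm z + d < 1" using z by (auto simp: d_def field_simps)
    have sub: "cball z d \<subseteq> cball 0 (norm z + d)" by (rule cball_subset_cball_iff[THEN iffD2]) (use d in \<open>auto simp: dist_norm\<close>)
    have "cball 0 (norm z + d) \<subseteq> unit_disk" using d by auto
    then show "\<exists>d>0. cball z d \<subseteq> unit_disk \<and> uniform_limit (cball z d) (\<lambda>n. bergman_fun (X n)) g sequentially"
      using d sub uniform_limit_on_subset[OF unif[of "norm z + d"] sub]
      by (intro exI[of _ d]) (auto intro: order_trans)
  qed (auto intro: bergman_fun_holomorphic)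
  have out: "g z = 0" if "z \<notin> unit_disk" for z
    using that by (simp add: g_def bergman_fun_outside)
  have meas[measurable]: "g \<in> borel_measurable borel"
    by (rule borel_measurable_LIMSEQ_metric[OF _ lim]) measurable
  have fatou: "(\<integral>\<^sup>+z. ennreal ((norm (bergman_fun (X n) z - g z))\<^sup>2) \<partial>disk_area) \<le> ennreal (e\<^sup>2)"
    if e: "e > 0" and n: "\<And>m. m \<ge> N \<Longrightarrow> dist (X n) (X m) < e" for n N e
  proof -
    let ?u = "\<lambda>m z. ennreal ((norm (bergman_fun (X n) z - bergman_fun (X m) z))\<^sup>2)"
    have lim_u: "(\<lambda>m. ?u m z) \<longlonglongrightarrow> ennreal ((norm (bergman_fun (X n) z - g z))\<^sup>2)" for z
      by (intro tendsto_intros lim)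
    have "(\<integral>\<^sup>+z. ennreal ((norm (bergman_fun (X n) z - g z))\<^sup>2) \<partial>disk_area)
        = (\<integral>\<^sup>+z. liminf (\<lambda>m. ?u m z) \<partial>disk_area)"
      by (intro nn_integral_cong lim_imp_Liminf[OF sequentially_bot lim_u, symmetric])
    also have "\<dots> \<le> liminf (\<lambda>m. \<integral>\<^sup>+z. ?u m z \<partial>disk_area)"
      by (intro nn_integral_liminf) measurable
    also have "\<dots> \<le> ennreal (e\<^sup>2)"
    proof (rule Liminf_le[OF sequentially_bot], rule eventually_sequentiallyI[of N])
      fix m assume "m \<ge> N"
      then have le: "norm (X n - X m) \<le> e" using n[of m] by (simp add: dist_norm)
      have int: "integrable disk_area (\<lambda>z. (norm (bergman_fun (X n - X m) z))\<^sup>2)"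
        using bergman_fun_in[of "X n - X m"] by (simp add: bergman_functions_def)
      have "(\<integral>\<^sup>+z. ?u m z \<partial>disk_area) = ennreal (\<integral>z. (norm (bergman_fun (X n - X m) z))\<^sup>2 \<partial>disk_area)"
        unfolding diff[symmetric] by (rule nn_integral_eq_integral[OF int]) simp
      also have "(\<integral>z. (norm (bergman_fun (X n - X m) z))\<^sup>2 \<partial>disk_area) = (norm (X n - X m))\<^sup>2"
        by (simp add: norm_bergman_eq)
      also have "ennreal \<dots> \<le> ennreal (e\<^sup>2)"
        using le by (intro ennreal_leI power_mono) auto
      finally show "(\<integral>\<^sup>+z. ?u m z \<partial>disk_area) \<le> ennreal (e\<^sup>2)" .
    qed
    finally show ?thesis .
  qed
  have in_space: "(\<lambda>z. bergman_fun (X n) z - g z) \<in> bergman_functions"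
    if e: "e > 0" and n: "\<And>m. m \<ge> N \<Longrightarrow> dist (X n) (X m) < e" for n N e
  proof -
    have "(\<integral>\<^sup>+z. ennreal ((norm (bergman_fun (X n) z - g z))\<^sup>2) \<partial>disk_area) < \<infinity>"
      using fatou[OF that] le_less_trans by fastforce
    then have "integrable disk_area (\<lambda>z. (norm (bergman_fun (X n) z - g z))\<^sup>2)"
      by (intro integrableI_bounded) auto
    then show ?thesis
      using hol out by (auto simp: bergman_functions_def bergman_fun_outside intro!: holomorphic_intros bergman_fun_holomorphic)
  qed
  obtain N where N: "\<And>m. m \<ge> N \<Longrightarrow> dist (X N) (X m) < 1"
    using X unfolding Cauchy_def by (metis le_refl zero_less_one)
  \<comment> \<open>Fatou's lemma controls differences \<open>X N - g\<close>, so the limit is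
    recovered by subtracting such a difference from \<open>X N\<close>.\<close>
  have "(\<lambda>z. bergman_fun (X N) z - (bergman_fun (X N) z - g z)) \<in> bergman_functions"
    by (intro bergman_functions_diff bergman_fun_in in_space[OF _ N]) auto
  then have "g \<in> bergman_functions" by simp
  then have G: "bergman_fun (Abs_bergman g) = g" by (rule Abs_bergman_inverse)
  have "X \<longlonglongrightarrow> Abs_bergman g"
  proof (rule LIMSEQ_I)
    fix e :: real assume "e > 0"
    then have e: "e / 2 > 0" by simp
    obtain M where M: "\<And>m n. m \<ge> M \<Longrightarrow> n \<ge> M \<Longrightarrow> dist (X n) (X m) < e / 2"
      using X e unfolding Cauchy_def by metis
    have "norm (X n - Abs_bergman g) < e" if n: "n \<ge> M" for n
    proof -
      have int: "integrable disk_area (\<lambda>z. (norm (bergman_fun (X n - Abs_bergman g) z))\<^sup>2)"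
        using bergman_fun_in[of "X n - Abs_bergman g"] by (simp add: bergman_functions_def)
      have "ennreal ((norm (X n - Abs_bergman g))\<^sup>2) = (\<integral>\<^sup>+z. ennreal ((norm (bergman_fun (X n - Abs_bergman g) z))\<^sup>2) \<partial>disk_area)"
        by (subst nn_integral_eq_integral[OF int]) (auto simp: norm_bergman_eq)
      also have "\<dots> \<le> ennreal ((e / 2)\<^sup>2)"
        using fatou[OF e M[OF _ n]] by (simp only: diff G)
      finally have "(norm (X n - Abs_bergman g))\<^sup>2 \<le> (e / 2)\<^sup>2"
        by (simp add: ennreal_le_iff)
      then have "norm (X n - Abs_bergman g) \<le> e / 2"
        by (rule power2_le_imp_le) (use e in simp)
      then show ?thesis using \<open>e > 0\<close> by simp
    qed
    then show "\<exists>no. \<forall>n\<ge>no. norm (X n - Abs_bergman g) < e" by blast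
  qed
  then show "convergent X" by (auto simp: convergent_def)
qed

section \<open>Nearest points and orthogonal projections in real Hilbert spaces\<close>

lemma closest_point_exists_complete:
  fixes S :: "'a::{real_inner, complete_space} set"
  assumes "closed S" "convex S" "S \<noteq> {}"
  shows "\<exists>y\<in>S. \<forall>z\<in>S. dist x y \<le> dist x z"
proof -
  define d where "d = infdist x S"
  have d: "d \<le> dist x z" if "z \<in> S" for z using that by (simp add: d_def infdist_le)
  have d0: "0 \<le> d" by (simp add: d_def infdist_nonneg)
  have "\<exists>y\<in>S. dist x y < d + 1 / Suc n" for n
  proof -
    have "Inf (dist x ` S) < d + 1 / Suc n" using assms(3) by (simp add: d_def infdist_def)
    then show ?thesis using cInf_lessD[of "dist x ` S"] assms(3) by blast
  qed
  then obtain Y where Y: "\<And>n. Y n \<in> S" "\<And>n. dist x (Y n) < d + 1 / Suc n" by metis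
  \<comment> \<open>Parallelogram law: the midpoint of \<open>a\<close> and \<open>b\<close> lies in
    \<open>S\<close>, so its distance from \<open>x\<close> is at least \<open>d\<close>. Almost
    nearest points are therefore close to each other, and a minimizing sequence is Cauchy.\<close>
  have par: "(norm (a - b))\<^sup>2 \<le> 2 * (norm (x - a))\<^sup>2 + 2 * (norm (x - b))\<^sup>2 - 4 * d\<^sup>2" if "a \<in> S" "b \<in> S" for a b
  proof -
    have "(1/2) *\<^sub>R a + (1/2) *\<^sub>R b \<in> S"
      by (rule convexD[OF assms(2) that]) auto
    then have "d \<le> norm (x - ((1/2) *\<^sub>R a + (1/2) *\<^sub>R b))" using d by (simp add: dist_norm)
    then have "d\<^sup>2 \<le> (norm (x - ((1/2) *\<^sub>R a + (1/2) *\<^sub>R b)))\<^sup>2"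
      using d0 by (intro power_mono)
    moreover have "(norm (a - b))\<^sup>2 = 2 * (norm (x - a))\<^sup>2 + 2 * (norm (x - b))\<^sup>2
        - 4 * (norm (x - ((1/2) *\<^sub>R a + (1/2) *\<^sub>R b)))\<^sup>2"
      unfolding power2_norm_eq_inner
      by (simp add: inner_simps inner_commute[of b a] inner_commute[of a x] inner_commute[of b x] field_simps)
    ultimately show ?thesis by linarith
  qed
  have sq: "(norm (x - Y n))\<^sup>2 \<le> (d + 1 / Suc n)\<^sup>2" for n
    using Y(2)[of n] by (intro power_mono) (auto simp: dist_norm)
  have inv: "(\<lambda>n. 1 / real (Suc n)) \<longlonglongrightarrow> 0" by real_asymp
  have "Cauchy Y"
  proof (rule metric_CauchyI)
    fix e :: real assume e: "e > 0"
    have "(\<lambda>n. 4 * ((d + 1 / Suc n)\<^sup>2 - d\<^sup>2)) \<longlonglongrightarrow> 4 * ((d + 0)\<^sup>2 - d\<^sup>2)"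
      by (intro tendsto_intros inv)
    then have "(\<lambda>n. 4 * ((d + 1 / Suc n)\<^sup>2 - d\<^sup>2)) \<longlonglongrightarrow> 0" by simp
    then have "\<forall>\<^sub>F n in sequentially. 4 * ((d + 1 / Suc n)\<^sup>2 - d\<^sup>2) < e\<^sup>2"
      using e by (intro order_tendstoD) auto
    then obtain M where M: "\<And>n. n \<ge> M \<Longrightarrow> 4 * ((d + 1 / Suc n)\<^sup>2 - d\<^sup>2) < e\<^sup>2"
      by (auto simp: eventually_sequentially)
    have "dist (Y m) (Y n) < e" if "m \<ge> M" "n \<ge> M" for m n
    proof -
      have "(norm (Y m - Y n))\<^sup>2 < e\<^sup>2"
        using par[OF Y(1) Y(1), of m n] sq[of m] sq[of n] M[OF that(1)] M[OF that(2)] by argo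
      then show ?thesis using e power_less_imp_less_base[of _ 2 e] by (simp add: dist_norm)
    qed
    then show "\<exists>M. \<forall>m\<ge>M. \<forall>n\<ge>M. dist (Y m) (Y n) < e" by blast
  qed
  then obtain y where y: "Y \<longlonglongrightarrow> y" using Cauchy_convergent convergent_def by blast
  have "y \<in> S" using assms(1) Y(1) y closed_sequentially by blast
  moreover have "dist x y \<le> d"
  proof (rule LIMSEQ_le)
    show "(\<lambda>n. dist x (Y n)) \<longlonglongrightarrow> dist x y" by (intro tendsto_intros y)
    show "(\<lambda>n. d + 1 / Suc n) \<longlonglongrightarrow> d" using tendsto_add[OF tendsto_const inv, of d] by simp
  qed (use Y(2) less_imp_le in blast)
  ultimately show ?thesis using d order_trans by blast
qed

lemma orthogonal_projection_exists:
  fixes S :: "'a::{real_inner, complete_space} set"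
  assumes "closed S" "subspace S"
  obtains y where "y \<in> S" "\<And>z. z \<in> S \<Longrightarrow> inner (x - y) z = 0"
proof -
  obtain y where y: "y \<in> S" "\<And>z. z \<in> S \<Longrightarrow> dist x y \<le> dist x z"
    using closest_point_exists_complete[OF assms(1) subspace_imp_convex[OF assms(2)], of x] assms(2) subspace_0
    by blast
  define w where "w = x - y"
  have "inner w z = 0" if z: "z \<in> S" for z
  proof (cases "z = 0")
    case False
    \<comment> \<open>The value that minimizes \<open>norm (w - t *\<^sub>R z)\<close>; since
      \<open>y\<close> is nearest, it cannot improve on \<open>t = 0\<close>.\<close>
    define t where "t = inner w z / inner z z"
    have "y + t *\<^sub>R z \<in> S" using y(1) z assms(2) by (simp add: subspace_add subspace_scale)
    then have "norm w \<le> norm (w - t *\<^sub>R z)"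
      using y(2)[of "y + t *\<^sub>R z"] by (simp add: dist_norm w_def diff_diff_add)
    then have "(norm w)\<^sup>2 \<le> (norm (w - t *\<^sub>R z))\<^sup>2"
      by (intro power_mono) auto
    also have "\<dots> = (norm w)\<^sup>2 - (inner w z)\<^sup>2 / inner z z"
      using False unfolding power2_norm_eq_inner
      by (simp add: inner_diff_left inner_diff_right inner_commute[of z w] t_def power2_eq_square)
    finally have "(inner w z)\<^sup>2 / inner z z \<le> 0" by simp
    moreover have "inner z z > 0" using False by simp
    ultimately have "(inner w z)\<^sup>2 \<le> 0" using divide_pos_pos linorder_not_less by metis
    then show ?thesis by simp
  qed simp
  with y(1) show ?thesis using that by (auto simp: w_def)
qed

section \<open>Adjoints and commutants\<close>

lemma cinner_add_right: "cinner f (g + h) = cinner f g + cinner f h"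
  by (subst (1 2 3) cinner_commute) (simp add: cinner_add_left)

lemma cinner_cscale_right: "cinner f (cscale c g) = cnj c * cinner f g"
  by (subst (1 2) cinner_commute) (simp add: cinner_cscale_left)

lemma uminus_bergman_eq: "- f = cscale (-1) f" for f :: bergman
  by transfer simp

lemma cinner_minus_left: "cinner (- f) g = - cinner f g"
  by (simp add: uminus_bergman_eq cinner_cscale_left del: bergman.scale_minus_left)

lemma cinner_minus_right: "cinner f (- g) = - cinner f g"
  by (subst (1 2) cinner_commute) (simp add: cinner_minus_left)

lemma cinner_diff_left: "cinner (f - g) h = cinner f h - cinner g h"
  using cinner_add_left[of f "- g" h] by (simp add: cinner_minus_left)

lemma cinner_diff_right: "cinner f (g - h) = cinner f g - cinner f h"
  using cinner_add_right[of f g "- h"] by (simp add: cinner_minus_right)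

lemma cinner_zero [simp]: "cinner 0 f = 0" "cinner f 0 = 0"
  using cinner_cscale_left[of 0 0 f] cinner_cscale_right[of f 0 0] by simp_all

lemma cinner_ext_right:
  assumes "\<And>f. cinner f g = cinner f h"
  shows "g = h"
proof -
  have "cinner (g - h) (g - h) = 0" by (subst cinner_diff_right) (simp add: assms)
  then show ?thesis by (simp add: cinner_self_eq_0)
qed

lemma bounded_linear_cinner_left: "bounded_linear (\<lambda>f. cinner f h)"
  by (rule bounded_linear_intro[where K = "norm h"])
    (simp_all add: cinner_add_left scaleR_bergman_eq cinner_cscale_left scaleR_conv_of_real norm_cinner_le)

lemma subspace_of_complex: "bergman.subspace M \<Longrightarrow> subspace M"
  unfolding bergman.subspace_def subspace_def scaleR_bergman_eq by blast

lemma complex_orthogonal_projection: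
  assumes "bergman.subspace M" "closed M"
  obtains g where "g \<in> M" "\<And>h. h \<in> M \<Longrightarrow> cinner (f - g) h = 0"
proof -
  obtain g where g: "g \<in> M" "\<And>h. h \<in> M \<Longrightarrow> inner (f - g) h = 0"
    using orthogonal_projection_exists[OF assms(2) subspace_of_complex[OF assms(1)]] by metis
  have "cinner (f - g) h = 0" if h: "h \<in> M" for h
  proof (rule complex_eqI)
    show "Re (cinner (f - g) h) = Re 0" using g(2)[OF h] by (simp add: inner_bergman_def)
    \<comment> \<open>Real orthogonality to \<open>cscale \<i> h\<close> gives the imaginary part of
      the complex inner product with \<open>h\<close>.\<close>
    have "cscale \<i> h \<in> M" using assms(1) h by (simp add: bergman.subspace_scale)
    from g(2)[OF this] show "Im (cinner (f - g) h) = Im 0"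
      by (simp add: inner_bergman_def cinner_cscale_right)
  qed
  with g(1) show ?thesis using that by blast
qed

lemma riesz_representation_bergman:
  assumes add: "\<And>f g. \<phi> (f + g) = \<phi> f + \<phi> g" and scale: "\<And>c f. \<phi> (cscale c f) = c * \<phi> f"
    and bound: "\<And>f. norm (\<phi> f) \<le> C * norm f"
  obtains k where "\<And>f. \<phi> f = cinner f k"
proof (cases "\<forall>f. \<phi> f = 0")
  case True
  then show ?thesis using that[of 0] by simp
next
  case False
  then obtain f0 where f0: "\<phi> f0 \<noteq> 0" by blast
  have lin: "bounded_linear \<phi>"
    by (rule bounded_linear_intro[where K = C])
      (use bound in \<open>simp_all add: add scale scaleR_bergman_eq scaleR_conv_of_real mult.commute\<close>)
  have diff: "\<phi> (f - g) = \<phi> f - \<phi> g" for f g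
    using lin by (simp add: linear_diff bounded_linear.linear)
  define M where "M = {f. \<phi> f = 0}"
  have "bergman.subspace M"
    using linear_0[OF bounded_linear.linear[OF lin]]
    by (auto simp: bergman.subspace_def M_def add scale)
  moreover have "closed M"
    unfolding M_def by (intro closed_Collect_eq linear_continuous_on lin continuous_on_const)
  ultimately obtain g where g: "g \<in> M" "\<And>h. h \<in> M \<Longrightarrow> cinner (f0 - g) h = 0"
    using complex_orthogonal_projection[of M f0] by metis
  \<comment> \<open>A vector orthogonal to the kernel of \<open>\<phi>\<close>; every
    \<open>f\<close> is a multiple of \<open>e\<close> up to an element of that kernel.\<close>
  define e where "e = f0 - g"
  have e: "\<phi> e \<noteq> 0" using f0 g(1) by (simp add: e_def diff M_def)
  then have e0: "cinner e e \<noteq> 0"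
    using linear_0[OF bounded_linear.linear[OF lin]] by (auto simp: cinner_self_eq_0)
  have "\<phi> f = cinner f (cscale (cnj (\<phi> e / cinner e e)) e)" for f
  proof -
    have "\<phi> (f - cscale (\<phi> f / \<phi> e) e) = 0" using e by (simp add: diff scale)
    then have "cinner e (f - cscale (\<phi> f / \<phi> e) e) = 0" using g(2) by (simp add: M_def e_def)
    then have "cinner (f - cscale (\<phi> f / \<phi> e) e) e = 0"
      by (subst cinner_commute) simp
    then have "cinner f e = \<phi> f / \<phi> e * cinner e e"
      by (simp add: cinner_diff_left cinner_cscale_left)
    then show ?thesis using e e0 by (simp add: cinner_cscale_right)
  qed
  then show ?thesis by (rule that)
qed

lemma complex_linear_apply: "complex_linear T \<Longrightarrow> T (cscale c f) = cscale c (T f)"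
  by (simp add: complex_linear_def)

text \<open>Riesz representation provides the adjoint vector by vector; with this the definite
  description in the definition of \<open>hilbert_adjoint\<close> denotes something.\<close>

lemma hilbert_adjoint:
  assumes T: "complex_linear T"
  shows "cinner (T f) g = cinner f (hilbert_adjoint T g)"
proof -
  have "\<exists>k. \<forall>f. cinner (T f) g = cinner f k" for g
  proof -
    have "norm (cinner (T f) g) \<le> norm T * norm g * norm f" for f
      using order_trans[OF norm_cinner_le mult_right_mono[OF norm_blinfun[of T f] norm_ge_zero[of g]]]
      by (simp add: mult_ac)
    then show ?thesis
      using riesz_representation_bergman[of "\<lambda>f. cinner (T f) g" "norm T * norm g"]
      by (metis (no_types, lifting) T blinfun.add_right cinner_add_left cinner_cscale_left complex_linear_apply)
  qed
  then obtain S where S: "\<And>f g. cinner (T f) g = cinner f (S g)" by metis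
  have "bounded_linear S"
  proof (rule bounded_linear_intro[where K = "norm T"])
    show "S (f + g) = S f + S g" for f g
      by (rule cinner_ext_right) (simp add: S[symmetric] cinner_add_right)
    show "S (r *\<^sub>R f) = r *\<^sub>R S f" for r f
      by (rule cinner_ext_right) (simp add: S[symmetric] cinner_cscale_right scaleR_bergman_eq)
    show "norm (S f) \<le> norm f * norm T" for f
    proof (cases "S f = 0")
      case False
      \<comment> \<open>The square equals the modulus of the inner product of \<open>T (S f)\<close>
        with \<open>f\<close>, so one factor \<open>norm (S f)\<close> cancels from the
        estimate.\<close>
      have "(norm (S f))\<^sup>2 = norm (cinner (S f) (S f))"
        unfolding cinner_self norm_bergman_eq norm_of_real by (simp add: integral_nonneg_AE)
      also have "\<dots> = norm (cinner (T (S f)) f)" by (simp only: S)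
      also have "\<dots> \<le> norm (T (S f)) * norm f" by (rule norm_cinner_le)
      also have "\<dots> \<le> norm T * norm (S f) * norm f" by (intro mult_right_mono norm_blinfun) simp
      finally have "norm (S f) * norm (S f) \<le> norm (S f) * (norm f * norm T)"
        by (simp add: power2_eq_square mult_ac)
      then show ?thesis using False by simp
    qed simp
  qed
  then have "cinner (T f) g = cinner f (Blinfun S g)" for f g
    by (simp add: bounded_linear_Blinfun_apply S)
  then show ?thesis using hilbert_adjoint_eqI by metis
qed

lemma hilbert_adjoint':
  assumes "complex_linear T"
  shows "cinner (hilbert_adjoint T f) g = cinner f (T g)"
  using hilbert_adjoint[OF assms, of g f] by (metis cinner_commute)

lemma complex_linear_hilbert_adjoint:
  assumes "complex_linear T"
  shows "complex_linear (hilbert_adjoint T)"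
  unfolding complex_linear_def
  by (intro allI cinner_ext_right) (simp add: hilbert_adjoint[OF assms, symmetric] cinner_cscale_right)

lemma commutant_apply:
  fixes S A :: "bergman \<Rightarrow>\<^sub>L bergman"
  assumes "S \<in> commutant \<A>" and "A \<in> \<A>"
  shows "S (A f) = A (S f)"
  using assms unfolding commutant_def
  by (metis (mono_tags, lifting) blinfun_apply_blinfun_compose mem_Collect_eq)

lemma commutantI:
  fixes S :: "bergman \<Rightarrow>\<^sub>L bergman" and \<A> :: "(bergman \<Rightarrow>\<^sub>L bergman) set"
  assumes "complex_linear S" and "\<And>A f. A \<in> \<A> \<Longrightarrow> S (A f) = A (S f)"
  shows "S \<in> commutant \<A>"
  using assms by (auto simp: commutant_def intro!: blinfun_eqI)

lemma commutant_complex_linear: "S \<in> commutant \<A> \<Longrightarrow> complex_linear S"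
  by (simp add: commutant_def)

text \<open>Taking adjoints interchanges the two generators: commutation of \<open>S\<close> with
  the adjoint of \<open>T\<close> becomes commutation of the adjoint of \<open>S\<close> with
  \<open>T\<close>.\<close>

lemma hilbert_adjoint_in_commutant:
  assumes T: "complex_linear T" and S: "S \<in> commutant {T, hilbert_adjoint T}"
  shows "hilbert_adjoint S \<in> commutant {T, hilbert_adjoint T}"
proof (rule commutantI)
  have S': "complex_linear S" by (rule commutant_complex_linear[OF S])
  then show "complex_linear (hilbert_adjoint S)" by (rule complex_linear_hilbert_adjoint)
  have TS: "S (T f) = T (S f)" "S (hilbert_adjoint T f) = hilbert_adjoint T (S f)" for f
    using commutant_apply[OF S] by simp_all
  have "hilbert_adjoint S (T f) = T (hilbert_adjoint S f)" for f
    by (rule cinner_ext_right)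
      (metis TS(2) T S' hilbert_adjoint hilbert_adjoint')
  moreover have "hilbert_adjoint S (hilbert_adjoint T f) = hilbert_adjoint T (hilbert_adjoint S f)" for f
    by (rule cinner_ext_right)
      (metis TS(1) T S' hilbert_adjoint hilbert_adjoint')
  ultimately show "hilbert_adjoint S (A f) = A (hilbert_adjoint S f)" if "A \<in> {T, hilbert_adjoint T}" for A f
    using that by auto
qed

section \<open>Orthogonal projections as operators\<close>

definition is_orthogonal_projection :: "(bergman \<Rightarrow>\<^sub>L bergman) \<Rightarrow> bergman set \<Rightarrow> bool" where
  "is_orthogonal_projection P M \<longleftrightarrow> complex_linear P \<and> (\<forall>f. P f \<in> M) \<and> (\<forall>f\<in>M. P f = f) \<and>
     (\<forall>f. \<forall>h\<in>M. cinner (f - P f) h = 0)"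

lemma orthogonal_projection_operator_exists:
  assumes M: "bergman.subspace M" "closed M"
  obtains P where "is_orthogonal_projection P M"
proof -
  obtain p where p: "\<And>f. p f \<in> M" "\<And>f h. h \<in> M \<Longrightarrow> cinner (f - p f) h = 0"
  proof -
    have "\<exists>g. g \<in> M \<and> (\<forall>h\<in>M. cinner (f - g) h = 0)" for f
      using complex_orthogonal_projection[OF M, of f] by metis
    then show thesis using that by metis
  qed
  \<comment> \<open>Orthogonality characterizes \<open>p f\<close>; linearity of \<open>p\<close>
    follows by checking it for sums and multiples.\<close>
  have uniq: "p f = g" if g: "g \<in> M" and o: "\<And>h. h \<in> M \<Longrightarrow> cinner (f - g) h = 0" for f g
  proof -
    have m: "p f - g \<in> M" using g p(1) M(1) by (simp add: bergman.subspace_diff)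
    have "cinner (p f - g) (p f - g) = cinner (f - g) (p f - g) - cinner (f - p f) (p f - g)"
      by (simp add: cinner_diff_left)
    also have "\<dots> = 0" using o[OF m] p(2)[OF m] by simp
    finally show ?thesis by (simp add: cinner_self_eq_0)
  qed
  have add: "p (f + g) = p f + p g" for f g
  proof (rule uniq)
    show "cinner (f + g - (p f + p g)) h = 0" if "h \<in> M" for h
      using p(2)[OF that, of f] p(2)[OF that, of g] by (simp add: cinner_diff_left cinner_add_left)
  qed (use M(1) p(1) in \<open>simp add: bergman.subspace_add\<close>)
  have scale: "p (cscale c f) = cscale c (p f)" for c f
  proof (rule uniq)
    show "cinner (cscale c f - cscale c (p f)) h = 0" if "h \<in> M" for h
      using p(2)[OF that, of f] by (simp add: cinner_diff_left cinner_cscale_left)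
  qed (use M(1) p(1) in \<open>simp add: bergman.subspace_scale\<close>)
  have "norm (p f) \<le> norm f" for f
  proof -
    have "inner (f - p f) (p f) = 0" using p(2)[OF p(1), of f f] by (simp add: inner_bergman_def)
    then have "(norm (p f))\<^sup>2 \<le> (norm f)\<^sup>2"
      using inner_ge_zero[of "f - p f"] unfolding power2_norm_eq_inner
      by (simp add: inner_diff_left inner_diff_right inner_commute)
    then show ?thesis by (rule power2_le_imp_le) simp
  qed
  then have "bounded_linear p"
    by (intro bounded_linear_intro[where K = 1]) (simp_all add: add scale scaleR_bergman_eq)
  then have "blinfun_apply (Blinfun p) = p" by (rule bounded_linear_Blinfun_apply)
  then have "is_orthogonal_projection (Blinfun p) M"
    using p uniq by (auto simp: is_orthogonal_projection_def complex_linear_def scale)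
  then show ?thesis by (rule that)
qed

lemma orthogonal_projection_in_commutant:
  assumes T: "complex_linear T" and M: "reducing_subspace T M" and P: "is_orthogonal_projection P M"
  shows "P \<in> commutant {T, hilbert_adjoint T}"
proof (rule commutantI)
  have P': "complex_linear P" "\<And>f. P f \<in> M" "\<And>f. f \<in> M \<Longrightarrow> P f = f"
    "\<And>f h. h \<in> M \<Longrightarrow> cinner (f - P f) h = 0"
    using P by (auto simp: is_orthogonal_projection_def)
  show "complex_linear P" by (rule P')
  \<comment> \<open>Stated for any two mutually adjoint operators preserving \<open>M\<close>, so
    that it applies to \<open>T\<close> and its adjoint in either order.\<close>
  have comm: "P (A f) = A (P f)"
    if A: "\<And>g. g \<in> M \<Longrightarrow> A g \<in> M" "\<And>g. g \<in> M \<Longrightarrow> A' g \<in> M"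
      and adj: "\<And>g h. cinner (A g) h = cinner g (A' h)" for A A' :: "bergman \<Rightarrow>\<^sub>L bergman" and f
  proof -
    have "cinner (A f - A (P f)) h = 0" if "h \<in> M" for h
    proof -
      have "cinner (A f - A (P f)) h = cinner (f - P f) (A' h)"
        by (simp add: adj[symmetric] blinfun.diff_right)
      then show ?thesis using P'(4) A(2)[OF that] by simp
    qed
    moreover have sub: "bergman.subspace M" using M by (simp add: reducing_subspace_def)
    ultimately have "cinner (P (A f) - A (P f)) h = 0" if "h \<in> M" for h
      using P'(4)[OF that, of "A f"] that by (simp add: cinner_diff_left)
    moreover have "P (A f) - A (P f) \<in> M"
      using sub A(1) P'(2) by (simp add: bergman.subspace_diff)
    ultimately show ?thesis using cinner_self_eq_0 by fastforce
  qed
  have TM: "\<And>g. g \<in> M \<Longrightarrow> T g \<in> M" "\<And>g. g \<in> M \<Longrightarrow> hilbert_adjoint T g \<in> M"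
    using M by (auto simp: reducing_subspace_def)
  show "P (A f) = A (P f)" if "A \<in> {T, hilbert_adjoint T}" for A f
    using that comm[OF TM hilbert_adjoint[OF T]] comm[OF TM(2,1) hilbert_adjoint'[OF T]] by auto
qed

section \<open>Finite Blaschke products and their fibers\<close>

definition blaschke_factor :: "complex \<Rightarrow> complex \<Rightarrow> complex" where
  "blaschke_factor a z = (z - a) / (1 - cnj a * z)"

text \<open>Divided by \<open>(norm (1 - cnj a * z))\<^sup>2\<close>, the left side is 1 minus the
  squared modulus of the Blaschke factor; the sign of the right side then locates its values
  relative to the unit circle.\<close>

lemma norm_blaschke_identity:
  "(norm (1 - cnj a * z))\<^sup>2 - (norm (z - a))\<^sup>2 = (1 - (norm a)\<^sup>2) * (1 - (norm z)\<^sup>2)"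
  unfolding cmod_power2 by (simp add: power2_eq_square algebra_simps)

lemma one_minus_cnj_mult_neq_0:
  assumes "norm a * norm z < 1"
  shows "1 - cnj a * z \<noteq> 0"
proof
  assume "1 - cnj a * z = 0"
  then have "norm (cnj a * z) = 1" by simp
  with assms show False by (simp add: norm_mult)
qed

lemma norm_blaschke_factor_less_1:
  assumes "norm a < 1" "norm z < 1"
  shows "norm (blaschke_factor a z) < 1"
proof -
  have "norm a * norm z < 1" using assms mult_strict_mono[of "norm a" 1 "norm z" 1] by simp
  then have nz: "1 - cnj a * z \<noteq> 0" by (rule one_minus_cnj_mult_neq_0)
  have "0 < (1 - (norm a)\<^sup>2) * (1 - (norm z)\<^sup>2)"
    using assms by (simp add: power_less_one_iff)
  then have "(norm (z - a))\<^sup>2 < (norm (1 - cnj a * z))\<^sup>2" using norm_blaschke_identity[of a z] by linarith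
  then have "norm (z - a) < norm (1 - cnj a * z)" by (rule power2_less_imp_less) simp
  then show ?thesis using nz by (simp add: blaschke_factor_def norm_divide)
qed

lemma norm_blaschke_factor_eq_1:
  assumes "norm a < 1" "norm z = 1"
  shows "norm (blaschke_factor a z) = 1"
proof -
  have nz: "1 - cnj a * z \<noteq> 0" by (rule one_minus_cnj_mult_neq_0) (use assms in simp)
  have "(norm (z - a))\<^sup>2 = (norm (1 - cnj a * z))\<^sup>2" using norm_blaschke_identity[of a z] assms by simp
  then have "norm (z - a) = norm (1 - cnj a * z)" by simp
  then show ?thesis using nz by (simp add: blaschke_factor_def norm_divide)
qed

text \<open>By \<open>norm_blaschke_identity\<close> it suffices to compare
  \<open>(1 - (norm z)\<^sup>2) / (norm (1 - cnj a * z))\<^sup>2\<close> at \<open>z\<close> and at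
  \<open>s * z\<close>. The condition \<open>norm a \<le> norm z\<close> matters: on the way out to
  its zero a factor decreases in modulus.\<close>

lemma norm_blaschke_factor_radial_strict_mono:
  assumes a: "norm a \<le> norm z" and z: "0 < norm z" and s: "s > 1" "norm (of_real s * z) < 1"
  shows "norm (blaschke_factor a z) < norm (blaschke_factor a (of_real s * z))"
proof -
  define \<alpha> t x where "\<alpha> = norm a" and "t = norm z" and "x = Re (cnj a * z)"
  have st: "s * t < 1" using s by (simp add: norm_mult t_def)
  have t: "0 < t" "\<alpha> \<le> t" "0 \<le> \<alpha>" using a z by (auto simp: t_def \<alpha>_def)
  have "t < s * t" using s t by simp
  then have t1: "t < 1" "\<alpha> < s * t" "\<alpha> < 1" using st t by linarith+
  have x: "\<bar>x\<bar> \<le> \<alpha> * t"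
    using abs_Re_le_cmod[of "cnj a * z"] by (simp add: x_def \<alpha>_def t_def norm_mult)
  have den: "(norm (1 - cnj a * (of_real r * z)))\<^sup>2 = 1 - 2 * r * x + r\<^sup>2 * (\<alpha>\<^sup>2 * t\<^sup>2)" for r
    unfolding cmod_power2 \<alpha>_def t_def x_def
    by (simp add: cmod_power2 power2_eq_square algebra_simps)
  have id: "(norm (1 - cnj a * (of_real r * z)))\<^sup>2 - (norm (of_real r * z - a))\<^sup>2 = (1 - \<alpha>\<^sup>2) * (1 - r\<^sup>2 * t\<^sup>2)" for r
    using norm_blaschke_identity[of a "of_real r * z"] by (simp add: \<alpha>_def t_def norm_mult power_mult_distrib)
  define P Q where "P = (norm (1 - cnj a * z))\<^sup>2" and "Q = (norm (1 - cnj a * (of_real s * z)))\<^sup>2"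
  have nz: "1 - cnj a * z \<noteq> 0" "1 - cnj a * (of_real s * z) \<noteq> 0"
  proof -
    have "\<alpha> * t < 1" "\<alpha> * (s * t) < 1"
      using t t1 st mult_strict_mono[of \<alpha> 1 t 1] mult_strict_mono[of \<alpha> 1 "s * t" 1] s by auto
    then show "1 - cnj a * z \<noteq> 0" "1 - cnj a * (of_real s * z) \<noteq> 0"
      using s one_minus_cnj_mult_neq_0[of a z] one_minus_cnj_mult_neq_0[of a "of_real s * z"]
      by (simp_all add: \<alpha>_def t_def norm_mult)
  qed
  then have PQ: "P > 0" "Q > 0" by (auto simp: P_def Q_def)
  have P: "P = 1 - 2 * x + \<alpha>\<^sup>2 * t\<^sup>2" and Q: "Q = 1 - 2 * s * x + s\<^sup>2 * (\<alpha>\<^sup>2 * t\<^sup>2)"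
    using den[of 1] den[of s] by (simp_all add: P_def Q_def)
  have pos: "0 < (t - \<alpha>) * (1 - \<alpha> * (s * t)) + (s * t - \<alpha>) * (1 - \<alpha> * t)"
  proof -
    have "\<alpha> * t < 1" "\<alpha> * (s * t) < 1"
      using t t1 st mult_strict_mono[of \<alpha> 1 t 1] mult_strict_mono[of \<alpha> 1 "s * t" 1] s by auto
    then show ?thesis using t t1 by (intro add_nonneg_pos mult_nonneg_nonneg mult_pos_pos) auto
  qed
  \<comment> \<open>The difference is affine and decreasing in \<open>x\<close>, which is at most
    \<open>\<alpha> * t\<close>; at this extreme value, where \<open>a\<close> lies on the ray of
    \<open>z\<close>, it is a positive multiple of the quantity in \<open>pos\<close>.\<close>
  have "(1 - t\<^sup>2) * Q - (1 - s\<^sup>2 * t\<^sup>2) * P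
      = (s - 1) * ((\<alpha>\<^sup>2 * t\<^sup>2 + t\<^sup>2) * (s + 1) - 2 * x * (1 + s * t\<^sup>2))"
    unfolding P Q by (simp add: power2_eq_square algebra_simps)
  moreover have "(\<alpha>\<^sup>2 * t\<^sup>2 + t\<^sup>2) * (s + 1) - 2 * (\<alpha> * t) * (1 + s * t\<^sup>2)
      = t * ((t - \<alpha>) * (1 - \<alpha> * (s * t)) + (s * t - \<alpha>) * (1 - \<alpha> * t))"
    by (simp add: power2_eq_square algebra_simps)
  moreover have "x * (1 + s * t\<^sup>2) \<le> (\<alpha> * t) * (1 + s * t\<^sup>2)"
    using x s by (intro mult_right_mono) auto
  moreover have "0 < t * ((t - \<alpha>) * (1 - \<alpha> * (s * t)) + (s * t - \<alpha>) * (1 - \<alpha> * t))"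
    using pos t by simp
  ultimately have "(1 - s\<^sup>2 * t\<^sup>2) * P < (1 - t\<^sup>2) * Q"
    using s mult_pos_pos[of "s - 1" "(\<alpha>\<^sup>2 * t\<^sup>2 + t\<^sup>2) * (s + 1) - 2 * x * (1 + s * t\<^sup>2)"] by linarith
  moreover have "1 - \<alpha>\<^sup>2 > 0" using t1 t by (simp add: power_less_one_iff)
  ultimately have "(1 - \<alpha>\<^sup>2) * ((1 - s\<^sup>2 * t\<^sup>2) * P) < (1 - \<alpha>\<^sup>2) * ((1 - t\<^sup>2) * Q)"
    by (rule mult_strict_left_mono)
  then have "(Q - (norm (of_real s * z - a))\<^sup>2) * P < (P - (norm (z - a))\<^sup>2) * Q"
    using id[of 1] id[of s] by (simp add: P_def Q_def mult.assoc)
  then have "(norm (z - a))\<^sup>2 / P < (norm (of_real s * z - a))\<^sup>2 / Q"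
    using PQ by (simp add: field_simps)
  then have "(norm (blaschke_factor a z))\<^sup>2 < (norm (blaschke_factor a (of_real s * z)))\<^sup>2"
    by (simp add: blaschke_factor_def norm_divide power_divide P_def Q_def)
  then show ?thesis by (rule power2_less_imp_less) simp
qed

section \<open>The Blaschke product on the closed disk, its fibers and its local inverses\<close>

locale blaschke =
  fixes n :: nat and c :: complex and a :: "nat \<Rightarrow> complex"
  assumes n: "n \<ge> 2" and c: "norm c = 1" and a: "\<And>k. k < n \<Longrightarrow> a k \<in> unit_disk"
begin

definition B :: "complex \<Rightarrow> complex" where
  "B z = c * (\<Prod>k<n. blaschke_factor (a k) z)"

text \<open>All zeros lie within radius \<open>\<rho>\<close>, so the poles have modulus at least
  \<open>1 / \<rho>\<close>, and from radius \<open>\<rho>\<close> on every factor grows along rays.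
  The entry \<open>1/2\<close> keeps \<open>\<rho>\<close> positive when all zeros are 0.\<close>

definition \<rho> :: real where
  "\<rho> = Max (insert (1/2) ((\<lambda>k. norm (a k)) ` {..<n}))"

lemma \<rho>: "1/2 \<le> \<rho>" "\<rho> < 1" "\<And>k. k < n \<Longrightarrow> norm (a k) \<le> \<rho>"
proof -
  let ?S = "insert (1/2) ((\<lambda>k. norm (a k)) ` {..<n})"
  show "1/2 \<le> \<rho>" "\<And>k. k < n \<Longrightarrow> norm (a k) \<le> \<rho>" unfolding \<rho>_def by (intro Max_ge; simp)+
  show "\<rho> < 1" unfolding \<rho>_def using a by (subst Max_less_iff) auto
qed

abbreviation big_disk :: "complex set" where "big_disk \<equiv> ball 0 (1 / \<rho>)"

lemma cball_subset_big_disk: "cball 0 1 \<subseteq> big_disk"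
proof -
  have "1 < 1 / \<rho>" using \<rho>(1,2) by simp
  then show ?thesis by auto
qed

lemma unit_disk_subset_big_disk: "unit_disk \<subseteq> big_disk"
  using cball_subset_big_disk by auto

lemma B_holomorphic: "B holomorphic_on big_disk"
  unfolding B_def blaschke_factor_def
proof (intro holomorphic_intros)
  fix k z assume k: "k \<in> {..<n}" and z: "z \<in> big_disk"
  have "norm (a k) * norm z \<le> \<rho> * norm z" using k \<rho>(3) by (intro mult_right_mono) auto
  also have "\<dots> < 1" using z \<rho>(1) by (simp add: field_simps)
  finally show "1 - cnj (a k) * z \<noteq> 0" by (rule one_minus_cnj_mult_neq_0)
qed

lemma B_holomorphic_disk: "B holomorphic_on unit_disk"
  using B_holomorphic unit_disk_subset_big_disk by (rule holomorphic_on_subset)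

lemma B_continuous: "continuous_on (cball 0 1) B"
  using B_holomorphic cball_subset_big_disk by (meson holomorphic_on_imp_continuous_on holomorphic_on_subset)

lemma norm_B: "norm (B z) = (\<Prod>k<n. norm (blaschke_factor (a k) z))"
  using c by (simp add: B_def norm_mult prod_norm)

lemma norm_B_less_1: "z \<in> unit_disk \<Longrightarrow> norm (B z) < 1"
proof -
  assume z: "z \<in> unit_disk"
  have "(\<Prod>k<n. norm (blaschke_factor (a k) z)) < (\<Prod>k<n. 1)"
    using n z a by (intro prod_mono_strict[of 0]) (auto intro: norm_blaschke_factor_less_1 less_imp_le)
  then show ?thesis by (simp add: norm_B)
qed

lemma norm_B_eq_1: "norm z = 1 \<Longrightarrow> norm (B z) = 1"
  unfolding norm_B using a by (intro prod.neutral) (auto intro: norm_blaschke_factor_eq_1)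

lemma bounded_B: "bounded (B ` unit_disk)"
  using norm_B_less_1 by (auto simp: bounded_iff intro!: exI[of _ 1] less_imp_le)

lemma norm_B_radial:
  assumes "\<rho> \<le> norm z" "s > 1" "norm (of_real s * z) < 1"
  shows "norm (B z) < norm (B (of_real s * z))"
proof -
  have lt: "norm (blaschke_factor (a k) z) < norm (blaschke_factor (a k) (of_real s * z))" if "k < n" for k
    using assms \<rho>(1) \<rho>(3)[OF that] by (intro norm_blaschke_factor_radial_strict_mono) linarith+
  show ?thesis
    unfolding norm_B using n lt le_less_trans[OF norm_ge_zero lt]
    by (intro prod_mono_strict[of 0]) (auto intro: less_imp_le)
qed

lemma B_not_constant: "open U \<Longrightarrow> U \<noteq> {} \<Longrightarrow> U \<subseteq> big_disk \<Longrightarrow> \<not> B constant_on U"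
proof
  assume U: "open U" "U \<noteq> {}" "U \<subseteq> big_disk" and "B constant_on U"
  then obtain w where w: "\<And>z. z \<in> U \<Longrightarrow> B z = w" by (auto simp: constant_on_def)
  obtain u where "u \<in> U" using U by blast
  have "B z = w" if "z \<in> big_disk" for z
  proof -
    have "B z - w = 0"
    proof (rule analytic_continuation[where f = "\<lambda>z. B z - w" and S = big_disk and U = U and \<xi> = u])
      show "u islimpt U" using \<open>u \<in> U\<close> U interior_limit_point interior_open by blast
    qed (use w that U \<open>u \<in> U\<close> in \<open>auto intro!: holomorphic_intros B_holomorphic\<close>)
    then show ?thesis by simp
  qed
  \<comment> \<open>One point is inside the disk, where the modulus of \<open>B\<close> is less than
    1, the other on the circle, where it is 1.\<close>
  then have "B 0 = B 1" using cball_subset_big_disk by (metis (no_types) mem_cball_0 norm_one norm_zero order_refl subsetD zero_le_one)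
  then show False using norm_B_less_1[of 0] norm_B_eq_1[of 1] by simp
qed

definition fiber :: "complex \<Rightarrow> complex set" where
  "fiber w = {z \<in> unit_disk. B z = w}"

lemma finite_fiber: "finite (fiber w)"
proof -
  have "finite {z \<in> cball 0 1. B z - w = 0}"
  proof (rule holomorphic_compact_finite_zeros[of _ big_disk])
    have "\<not> B constant_on big_disk" using \<rho> by (intro B_not_constant) auto
    then show "\<not> (\<lambda>z. B z - w) constant_on big_disk"
      unfolding constant_on_def by (metis diff_add_cancel)
  qed (use cball_subset_big_disk in \<open>auto intro!: holomorphic_intros B_holomorphic\<close>)
  then show ?thesis by (rule rev_finite_subset) (auto simp: fiber_def)
qed

definition crit :: "complex set" where "crit = critical_set B"

lemma finite_crit: "finite crit"
proof (cases "deriv B constant_on big_disk")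
  case False
  have "finite {z \<in> cball 0 1. deriv B z = 0}"
    using False cball_subset_big_disk
    by (intro holomorphic_compact_finite_zeros[of _ big_disk] holomorphic_deriv B_holomorphic) auto
  then show ?thesis by (rule rev_finite_subset) (auto simp: crit_def critical_set_def)
next
  case True
  then obtain k where k: "\<And>z. z \<in> big_disk \<Longrightarrow> deriv B z = k" by (auto simp: constant_on_def)
  have "k \<noteq> 0"
  proof
    assume "k = 0"
    have "B constant_on big_disk"
    proof (rule has_field_derivative_0_imp_constant_on)
      fix z assume z: "z \<in> big_disk"
      then have "(B has_field_derivative deriv B z) (at z)"
        using B_holomorphic holomorphic_derivI open_ball by blast
      then show "(B has_field_derivative 0) (at z)" using k[OF z] \<open>k = 0\<close> by simp
    qed auto
    moreover have "\<not> B constant_on big_disk" using \<rho> by (intro B_not_constant) auto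
    ultimately show False by simp
  qed
  then have "crit = {}" using k unit_disk_subset_big_disk by (auto simp: crit_def critical_set_def)
  then show ?thesis by simp
qed

text \<open>Whole fibers are removed, not just the critical points, so that \<open>D0\<close> is a
  union of fibers consisting of regular points; as \<open>exc\<close> is finite, \<open>D0\<close>
  remains connected.\<close>

definition exc :: "complex set" where "exc = (\<Union>w\<in>B ` crit. fiber w)"

abbreviation D0 :: "complex set" where "D0 \<equiv> unit_disk - exc"

lemma finite_exc: "finite exc"
  by (simp add: exc_def finite_crit finite_fiber)

lemma crit_subset: "crit \<subseteq> exc"
  by (auto simp: exc_def fiber_def crit_def critical_set_def)

lemma exc_subset: "exc \<subseteq> unit_disk"
  by (auto simp: exc_def fiber_def)

lemma open_D0: "open D0"
  by (simp add: finite_exc finite_imp_closed open_Diff)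

lemma connected_D0: "connected D0"
  by (rule connected_open_delete_finite) (auto simp: finite_exc)

lemma D0_iff: "z \<in> D0 \<longleftrightarrow> z \<in> unit_disk \<and> B z \<notin> B ` crit"
  by (auto simp: exc_def fiber_def)

lemma D0_transfer: "x \<in> D0 \<Longrightarrow> y \<in> fiber (B x) \<Longrightarrow> y \<in> D0"
  unfolding D0_iff by (auto simp: fiber_def)

lemma D0_deriv: "x \<in> D0 \<Longrightarrow> deriv B x \<noteq> 0"
  using crit_subset by (auto simp: crit_def critical_set_def)

lemma B_has_derivative: "z \<in> unit_disk \<Longrightarrow> (B has_field_derivative deriv B z) (at z)"
  using B_holomorphic_disk holomorphic_derivI open_ball by blast

text \<open>Properness of \<open>B\<close>: on the compact part of the closed disk outside
  \<open>U\<close> the distance of \<open>B\<close> from \<open>w0\<close> has a positive minimum,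
  since \<open>B\<close> has modulus 1 on the circle and cannot take the value \<open>w0\<close>
  there.\<close>

lemma fiber_near:
  assumes w0: "norm w0 < 1" and U: "open U" "fiber w0 \<subseteq> U"
  obtains e where "e > 0" "\<And>w. w \<in> ball w0 e \<Longrightarrow> fiber w \<subseteq> U"
proof (cases "cball 0 1 - U = {}")
  case True
  then show ?thesis by (intro that[of 1]) (auto simp: fiber_def)
next
  case False
  have K: "compact (cball 0 1 - U)" using U by (simp add: compact_diff)
  have "continuous_on (cball 0 1 - U) (\<lambda>z. norm (B z - w0))"
    by (intro continuous_intros continuous_on_subset[OF B_continuous]) auto
  then obtain x where x: "x \<in> cball 0 1 - U" "\<And>y. y \<in> cball 0 1 - U \<Longrightarrow> norm (B x - w0) \<le> norm (B y - w0)"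
    using continuous_attains_inf[OF K False] by blast
  have "B x \<noteq> w0"
  proof
    assume e: "B x = w0"
    then have "norm x \<noteq> 1" using norm_B_eq_1[of x] w0 by auto
    then have "x \<in> fiber w0" using x(1) e by (auto simp: fiber_def)
    then show False using x(1) U by auto
  qed
  then have "norm (B x - w0) > 0" by simp
  moreover have "fiber w \<subseteq> U" if w: "w \<in> ball w0 (norm (B x - w0))" for w
  proof
    fix y assume y: "y \<in> fiber w"
    show "y \<in> U"
    proof (rule ccontr)
      assume "y \<notin> U"
      then have "norm (B x - w0) \<le> norm (B y - w0)" using y by (intro x(2)) (auto simp: fiber_def)
      then show False using w y by (auto simp: fiber_def dist_norm norm_minus_commute)
    qed
  qed
  ultimately show ?thesis by (rule that)
qed

lemma local_inverse:
  assumes y: "y \<in> unit_disk" "deriv B y \<noteq> 0" and r0: "r0 > 0"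
  obtains r u e where "0 < r" "r \<le> r0" "ball y r \<subseteq> unit_disk" "inj_on B (ball y r)" "0 < e"
    "u holomorphic_on ball (B y) e" "\<And>w. w \<in> ball (B y) e \<Longrightarrow> u w \<in> ball y r \<and> B (u w) = w"
    "\<And>z. z \<in> ball y r \<Longrightarrow> u (B z) = z"
proof -
  obtain r1 where r1: "r1 > 0" "ball y r1 \<subseteq> unit_disk" "inj_on B (ball y r1)"
    using has_complex_derivative_locally_injective[OF B_holomorphic_disk y(1) open_ball y(2)] by blast
  define r where "r = min r1 r0"
  have r: "0 < r" "r \<le> r0" "ball y r \<subseteq> ball y r1" using r1 r0 by (auto simp: r_def)
  have hol: "B holomorphic_on ball y r" and inj: "inj_on B (ball y r)"
    using B_holomorphic_disk r1 r holomorphic_on_subset inj_on_subset by blast+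
  obtain u where u: "u holomorphic_on (B ` ball y r)"
    "\<And>z. z \<in> ball y r \<Longrightarrow> deriv B z * deriv u (B z) = 1" "\<And>z. z \<in> ball y r \<Longrightarrow> u (B z) = z"
    by (rule holomorphic_has_inverse[OF hol open_ball inj]) (rule that)
  have "open (B ` ball y r)" by (rule open_mapping_thm3[OF hol open_ball inj])
  moreover have "B y \<in> B ` ball y r" using r by simp
  ultimately obtain e where e: "e > 0" "ball (B y) e \<subseteq> B ` ball y r" by (rule openE)
  show ?thesis
  proof (rule that[of r e u])
    show "u w \<in> ball y r \<and> B (u w) = w" if "w \<in> ball (B y) e" for w
      using that e u(3) by fastforce
  qed (use r r1 e u inj in \<open>auto intro: holomorphic_on_subset\<close>)
qed

text \<open>An evenly covered disk around \<open>w0\<close>: \<open>u y\<close> is the sheet through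
  \<open>y\<close>, a holomorphic section of \<open>B\<close>, and the disks of radius
  \<open>r\<close> around the points of the fiber keep the sheets apart.\<close>

definition branches :: "complex \<Rightarrow> real \<Rightarrow> (complex \<Rightarrow> complex \<Rightarrow> complex) \<Rightarrow> real \<Rightarrow> bool" where
  "branches w0 e u r \<longleftrightarrow> 0 < e \<and> 0 < r \<and> ball w0 e \<subseteq> ball 0 1 - B ` crit \<and>
     (\<forall>y\<in>fiber w0. u y holomorphic_on ball w0 e \<and> u y w0 = y) \<and>
     (\<forall>w\<in>ball w0 e. fiber w = (\<lambda>y. u y w) ` fiber w0 \<and> inj_on (\<lambda>y. u y w) (fiber w0)) \<and>
     (\<forall>y\<in>fiber w0. ball y r \<subseteq> unit_disk \<and> inj_on B (ball y r) \<and> (\<forall>w\<in>ball w0 e. u y w \<in> ball y r) \<and>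
        (\<forall>z\<in>ball y r. B z \<in> ball w0 e \<longrightarrow> u y (B z) = z)) \<and>
     (\<forall>y\<in>fiber w0. \<forall>z\<in>fiber w0. y \<noteq> z \<longrightarrow> ball y r \<inter> ball z r = {})"

lemma branches_exist:
  assumes w0: "norm w0 < 1" "w0 \<notin> B ` crit"
  obtains e u r where "branches w0 e u r"
proof -
  let ?F = "fiber w0"
  have F: "y \<in> unit_disk" "B y = w0" "deriv B y \<noteq> 0" if "y \<in> ?F" for y
    using that w0 by (auto simp: fiber_def crit_def critical_set_def)
  obtain r0 where r0: "r0 > 0" "\<And>y z. y \<in> ?F \<Longrightarrow> z \<in> ?F \<Longrightarrow> y \<noteq> z \<Longrightarrow> ball y r0 \<inter> ball z r0 = {}"
  proof -
    define S where "S = insert 1 ((\<lambda>(y, z). dist y z / 2) ` {(y, z). y \<in> ?F \<and> z \<in> ?F \<and> y \<noteq> z})"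
    have "{(y, z). y \<in> ?F \<and> z \<in> ?F \<and> y \<noteq> z} \<subseteq> ?F \<times> ?F" by auto
    then have fin: "finite S" unfolding S_def using finite_fiber finite_subset by blast
    show thesis
    proof (rule that[of "Min S"])
      show "Min S > 0" using fin by (subst Min_gr_iff) (auto simp: S_def)
      fix y z assume yz: "y \<in> ?F" "z \<in> ?F" "y \<noteq> z"
      then have "Min S \<le> dist y z / 2" using fin by (intro Min_le) (auto simp: S_def)
      then show "ball y (Min S) \<inter> ball z (Min S) = {}" by (intro disjoint_ballI) simp
    qed
  qed
  have "\<exists>r u e. 0 < r \<and> r \<le> r0 \<and> ball y r \<subseteq> unit_disk \<and> inj_on B (ball y r) \<and> 0 < e \<and>
    u holomorphic_on ball w0 e \<and> (\<forall>w\<in>ball w0 e. u w \<in> ball y r \<and> B (u w) = w) \<and>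
    (\<forall>z\<in>ball y r. u (B z) = z)" if "y \<in> ?F" for y
    using local_inverse[OF F(1,3)[OF that] r0(1)] unfolding F(2)[OF that] by metis
  then obtain R0 u0 E0 where 0: "\<And>y. y \<in> ?F \<Longrightarrow> 0 < R0 y \<and> R0 y \<le> r0 \<and> ball y (R0 y) \<subseteq> unit_disk \<and> inj_on B (ball y (R0 y)) \<and> 0 < E0 y \<and>
    u0 y holomorphic_on ball w0 (E0 y) \<and> (\<forall>w\<in>ball w0 (E0 y). u0 y w \<in> ball y (R0 y) \<and> B (u0 y w) = w) \<and>
    (\<forall>z\<in>ball y (R0 y). u0 y (B z) = z)" by metis
  define r where "r = Min (insert r0 (R0 ` ?F))"
  have r: "0 < r" "r \<le> r0" "\<And>y. y \<in> ?F \<Longrightarrow> r \<le> R0 y"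
    unfolding r_def using 0 r0(1) finite_fiber by (auto simp: Min_gr_iff intro: Min_le)
  \<comment> \<open>The first round of local inverses serves to find one radius \<open>r\<close> at
    which \<open>B\<close> is injective around each point of the fiber. The second round makes the
    values of the sections stay within that radius.\<close>
  have "\<exists>r' u e. 0 < r' \<and> r' \<le> r \<and> ball y r' \<subseteq> unit_disk \<and> 0 < e \<and>
    u holomorphic_on ball w0 e \<and> (\<forall>w\<in>ball w0 e. u w \<in> ball y r' \<and> B (u w) = w)" if "y \<in> ?F" for y
    using local_inverse[OF F(1,3)[OF that] r(1)] unfolding F(2)[OF that] by metis
  then obtain R u E where 1: "\<And>y. y \<in> ?F \<Longrightarrow> 0 < R y \<and> R y \<le> r \<and> 0 < E y \<and>
    u y holomorphic_on ball w0 (E y) \<and> (\<forall>w\<in>ball w0 (E y). u y w \<in> ball y (R y) \<and> B (u y w) = w)" by metis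
  \<comment> \<open>No point of a nearby fiber lies outside the disks, so the sections exhaust
    it.\<close>
  obtain e1 where e1: "e1 > 0" "\<And>w. w \<in> ball w0 e1 \<Longrightarrow> fiber w \<subseteq> (\<Union>y\<in>?F. ball y r)"
    by (rule fiber_near[OF w0(1), of "\<Union>y\<in>?F. ball y r"]) (use r(1) in auto)
  have "open (ball 0 1 - B ` crit)" by (intro open_Diff finite_imp_closed finite_imageI finite_crit) auto
  then obtain e2 where e2: "e2 > 0" "ball w0 e2 \<subseteq> ball 0 1 - B ` crit"
    using w0 openE[of "ball 0 1 - B ` crit" w0] by auto
  define e where "e = Min (insert e1 (insert e2 (E ` ?F)))"
  have e: "0 < e" "e \<le> e1" "e \<le> e2" "\<And>y. y \<in> ?F \<Longrightarrow> e \<le> E y"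
  proof -
    show "0 < e" unfolding e_def using 1 e1(1) e2(1) finite_fiber by (subst Min_gr_iff) auto
    show "e \<le> e1" "e \<le> e2" "\<And>y. y \<in> ?F \<Longrightarrow> e \<le> E y"
      unfolding e_def by (intro Min_le; simp add: finite_fiber)+
  qed
  have inj: "inj_on B (ball y r)" "ball y r \<subseteq> unit_disk" if "y \<in> ?F" for y
    using 0[OF that] r(3)[OF that] by (meson inj_on_subset subset_ball subset_trans)+
  have u: "u y w \<in> ball y r" "B (u y w) = w" if "y \<in> ?F" "w \<in> ball w0 e" for y w
  proof -
    have "w \<in> ball w0 (E y)" using that e(4)[of y] by auto
    then have "dist y (u y w) < R y" "B (u y w) = w" using 1[OF that(1)] by (meson mem_ball)+
    then show "u y w \<in> ball y r" "B (u y w) = w" using 1[OF that(1)] by auto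
  qed
  have uB: "u y (B z) = z" if "y \<in> ?F" "z \<in> ball y r" "B z \<in> ball w0 e" for y z
    using inj_onD[OF inj(1)[OF that(1)]] u[OF that(1,3)] that(2) by blast
  have disj: "ball y r \<inter> ball z r = {}" if "y \<in> ?F" "z \<in> ?F" "y \<noteq> z" for y z
    using r0(2)[OF that] subset_ball[OF r(2)] by blast
  have fib: "fiber w = (\<lambda>y. u y w) ` ?F" if w: "w \<in> ball w0 e" for w
  proof
    show "fiber w \<subseteq> (\<lambda>y. u y w) ` ?F"
    proof
      fix z assume z: "z \<in> fiber w"
      have "w \<in> ball w0 e1" using w e by auto
      then obtain y where y: "y \<in> ?F" "z \<in> ball y r" using e1(2) z by blast
      have "u y w = z" using uB[OF y] z w by (auto simp: fiber_def)
      then show "z \<in> (\<lambda>y. u y w) ` ?F" using y by blast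
    qed
    show "(\<lambda>y. u y w) ` ?F \<subseteq> fiber w"
    proof
      fix z assume "z \<in> (\<lambda>y. u y w) ` ?F"
      then obtain y where y: "y \<in> ?F" "z = u y w" by blast
      have "z \<in> unit_disk" using u(1)[OF y(1) w] inj(2)[OF y(1)] y(2) by blast
      then show "z \<in> fiber w" using u(2)[OF y(1) w] y(2) by (simp add: fiber_def)
    qed
  qed
  have injw: "inj_on (\<lambda>y. u y w) ?F" if w: "w \<in> ball w0 e" for w
  proof (rule inj_onI, rule ccontr)
    fix y z assume yz: "y \<in> ?F" "z \<in> ?F" "u y w = u z w" "y \<noteq> z"
    then show False using u(1)[OF yz(1) w] u(1)[OF yz(2) w] disj[OF yz(1,2,4)] by (metis disjoint_iff)
  qed
  have w0e: "w0 \<in> ball w0 e" using e by simp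
  have uw0: "u y w0 = y" if "y \<in> ?F" for y
    using uB[OF that, of y] F(2)[OF that] r(1) w0e by simp
  have uhol: "u y holomorphic_on ball w0 e" if "y \<in> ?F" for y
    using 1[OF that] e(4)[OF that] subset_ball holomorphic_on_subset by blast
  have sub: "ball w0 e \<subseteq> ball 0 1 - B ` crit"
    using e2(2) subset_ball[OF e(3), of w0] by blast
  have "branches w0 e u r"
    unfolding branches_def
    by (intro conjI ballI impI; (rule e(1) r(1) sub uhol uw0 fib injw inj u uB disj; assumption))
  then show ?thesis by (rule that)
qed

end

section \<open>Monodromy around the critical points\<close>

context blaschke
begin

lemma branchesD:
  assumes "branches w0 e u r"
  shows "0 < e" "0 < r" "\<And>w. w \<in> ball w0 e \<Longrightarrow> norm w < 1 \<and> w \<notin> B ` crit"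
    "\<And>y. y \<in> fiber w0 \<Longrightarrow> u y holomorphic_on ball w0 e" "\<And>y. y \<in> fiber w0 \<Longrightarrow> u y w0 = y"
    "\<And>w. w \<in> ball w0 e \<Longrightarrow> fiber w = (\<lambda>y. u y w) ` fiber w0"
    "\<And>w. w \<in> ball w0 e \<Longrightarrow> inj_on (\<lambda>y. u y w) (fiber w0)"
    "\<And>y. y \<in> fiber w0 \<Longrightarrow> ball y r \<subseteq> unit_disk" "\<And>y. y \<in> fiber w0 \<Longrightarrow> inj_on B (ball y r)"
    "\<And>y w. y \<in> fiber w0 \<Longrightarrow> w \<in> ball w0 e \<Longrightarrow> u y w \<in> ball y r"
    "\<And>y z. y \<in> fiber w0 \<Longrightarrow> z \<in> ball y r \<Longrightarrow> B z \<in> ball w0 e \<Longrightarrow> u y (B z) = z"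
    "\<And>y z. y \<in> fiber w0 \<Longrightarrow> z \<in> fiber w0 \<Longrightarrow> y \<noteq> z \<Longrightarrow> ball y r \<inter> ball z r = {}"
    "\<And>y w. y \<in> fiber w0 \<Longrightarrow> w \<in> ball w0 e \<Longrightarrow> u y w \<in> fiber w"
proof -
  have 1: "0 < e" and 2: "0 < r" and 3: "ball w0 e \<subseteq> ball 0 1 - B ` crit"
    and 4: "\<forall>y\<in>fiber w0. u y holomorphic_on ball w0 e \<and> u y w0 = y"
    and 5: "\<forall>w\<in>ball w0 e. fiber w = (\<lambda>y. u y w) ` fiber w0 \<and> inj_on (\<lambda>y. u y w) (fiber w0)"
    and 6: "\<forall>y\<in>fiber w0. ball y r \<subseteq> unit_disk \<and> inj_on B (ball y r) \<and> (\<forall>w\<in>ball w0 e. u y w \<in> ball y r) \<and>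
        (\<forall>z\<in>ball y r. B z \<in> ball w0 e \<longrightarrow> u y (B z) = z)"
    and 7: "\<forall>y\<in>fiber w0. \<forall>z\<in>fiber w0. y \<noteq> z \<longrightarrow> ball y r \<inter> ball z r = {}"
    using assms[unfolded branches_def] by - (elim conjE, assumption)+
  show "0 < e" "0 < r" by (rule 1 2)+
  show "norm w < 1 \<and> w \<notin> B ` crit" if "w \<in> ball w0 e" for w using subsetD[OF 3 that] by simp
  show "u y holomorphic_on ball w0 e" "u y w0 = y" if "y \<in> fiber w0" for y using bspec[OF 4 that] by simp_all
  show "fiber w = (\<lambda>y. u y w) ` fiber w0" "inj_on (\<lambda>y. u y w) (fiber w0)" if "w \<in> ball w0 e" for w
    using bspec[OF 5 that] by simp_all
  then show "u y w \<in> fiber w" if "y \<in> fiber w0" "w \<in> ball w0 e" for y w using that by blast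
  show "ball y r \<subseteq> unit_disk" "inj_on B (ball y r)" "w \<in> ball w0 e \<Longrightarrow> u y w \<in> ball y r"
    "z \<in> ball y r \<Longrightarrow> B z \<in> ball w0 e \<Longrightarrow> u y (B z) = z" if "y \<in> fiber w0" for y z w
    using bspec[OF 6 that] by blast+
  show "ball y r \<inter> ball z r = {}" if "y \<in> fiber w0" "z \<in> fiber w0" "y \<noteq> z" for y z
    using 7 that by blast
qed

lemma fiberD: "y \<in> fiber w \<Longrightarrow> y \<in> unit_disk" "y \<in> fiber w \<Longrightarrow> B y = w"
  by (auto simp: fiber_def)

lemma D0_in_fiber: "x \<in> D0 \<Longrightarrow> x \<in> fiber (B x)"
  by (simp add: fiber_def)

lemma branches_at_D0:
  assumes "x \<in> D0"
  obtains e u r where "branches (B x) e u r"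
  using branches_exist[of "B x"] assms norm_B_less_1[of x] unfolding D0_iff by blast

lemma B_isCont: "x \<in> unit_disk \<Longrightarrow> isCont B x"
  using B_has_derivative DERIV_isCont by blast

lemma branches_near:
  assumes x: "x \<in> D0" and br: "branches (B x) e u r" and d: "0 < d" "d \<le> e"
  obtains \<delta> where "\<delta> > 0" "\<And>y. y \<in> ball x \<delta> \<Longrightarrow> y \<in> D0 \<and> B y \<in> ball (B x) d \<and> B y \<in> ball (B x) e \<and> u x (B y) = y"
proof -
  have "(B \<longlongrightarrow> B x) (nhds x)" using B_isCont[of x] x by (simp add: isCont_def tendsto_at_iff_tendsto_nhds)
  then have "\<forall>\<^sub>F y in nhds x. B y \<in> ball (B x) d"
    using d by (intro topological_tendstoD) auto
  moreover have "\<forall>\<^sub>F y in nhds x. y \<in> D0" using open_D0 x by (rule eventually_nhds_in_open)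
  moreover have "\<forall>\<^sub>F y in nhds x. y \<in> ball x r" using branchesD(2)[OF br] by (intro eventually_nhds_in_open) auto
  ultimately have "\<forall>\<^sub>F y in nhds x. y \<in> D0 \<and> B y \<in> ball (B x) d \<and> B y \<in> ball (B x) e \<and> u x (B y) = y"
  proof eventually_elim
    case (elim y)
    have "B y \<in> ball (B x) e" using elim(1) subset_ball[OF d(2)] by blast
    then show ?case using branchesD(11)[OF br D0_in_fiber[OF x] elim(3)] elim by blast
  qed
  then show ?thesis using that unfolding eventually_nhds_metric by (auto simp: dist_commute)
qed

text \<open>Pairs of points in a common fiber form a covering of \<open>D0\<close>; this is local
  constancy on that covering. Values of \<open>C\<close> at other arguments are ignored.\<close>

definition loc_const :: "(complex \<Rightarrow> complex \<Rightarrow> complex) \<Rightarrow> bool" where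
  "loc_const C \<longleftrightarrow> (\<forall>x\<in>D0. \<forall>y\<in>fiber (B x). \<exists>e>0. \<forall>x'\<in>D0. \<forall>y'\<in>fiber (B x').
     dist x' x < e \<longrightarrow> dist y' y < e \<longrightarrow> C x' y' = C x y)"

lemma loc_const_branches:
  assumes C: "loc_const C" and br: "branches w0 e u r"
  obtains d where "0 < d" "d \<le> e"
    "\<And>w y z. w \<in> ball w0 d \<Longrightarrow> y \<in> fiber w0 \<Longrightarrow> z \<in> fiber w0 \<Longrightarrow> C (u y w) (u z w) = C y z"
proof -
  have w0: "w0 \<in> ball w0 e" using branchesD(1)[OF br] by simp
  have D0: "u y w \<in> D0" if "y \<in> fiber w0" "w \<in> ball w0 e" for y w
    using branchesD(13)[OF br that] branchesD(3)[OF br that(2)] unfolding D0_iff by (auto simp: fiber_def)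
  have lim: "((\<lambda>w. u y w) \<longlongrightarrow> y) (nhds w0)" if "y \<in> fiber w0" for y
  proof -
    have "isCont (u y) w0"
      by (rule field_differentiable_imp_continuous_at holomorphic_on_imp_differentiable_at[OF branchesD(4)[OF br that] open_ball w0])+
    then show ?thesis
      using branchesD(5)[OF br that] tendsto_at_iff_tendsto_nhds[of "u y" w0] by (simp add: isCont_def)
  qed
  have ev: "\<forall>\<^sub>F w in nhds w0. C (u y w) (u z w) = C y z" if y: "y \<in> fiber w0" and z: "z \<in> fiber w0" for y z
  proof -
    have yD: "y \<in> D0" using D0[OF y w0] branchesD(5)[OF br y] by simp
    have "z \<in> fiber (B y)" using y z by (simp add: fiber_def)
    then obtain \<epsilon> where \<epsilon>: "\<epsilon> > 0" "\<And>x' y'. x' \<in> D0 \<Longrightarrow> y' \<in> fiber (B x') \<Longrightarrow> dist x' y < \<epsilon> \<Longrightarrow> dist y' z < \<epsilon> \<Longrightarrow> C x' y' = C y z"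
      using C yD unfolding loc_const_def by meson
    have "\<forall>\<^sub>F w in nhds w0. dist (u y w) y < \<epsilon>" "\<forall>\<^sub>F w in nhds w0. dist (u z w) z < \<epsilon>"
      using lim[OF y] lim[OF z] \<epsilon>(1) by (auto dest: tendstoD)
    moreover have "\<forall>\<^sub>F w in nhds w0. w \<in> ball w0 e" using w0 by (intro eventually_nhds_in_open) auto
    ultimately show ?thesis
    proof eventually_elim
      case (elim w)
      have "u z w \<in> fiber (B (u y w))"
        using branchesD(13)[OF br y elim(3)] branchesD(13)[OF br z elim(3)] by (simp add: fiber_def)
      then show ?case using \<epsilon>(2)[OF D0[OF y elim(3)] _ elim(1,2)] by blast
    qed
  qed
  have "\<forall>\<^sub>F w in nhds w0. \<forall>y\<in>fiber w0. \<forall>z\<in>fiber w0. C (u y w) (u z w) = C y z"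
    using ev by (simp add: eventually_ball_finite_distrib finite_fiber)
  then obtain d where d: "d > 0" "\<And>w. dist w w0 < d \<Longrightarrow> \<forall>y\<in>fiber w0. \<forall>z\<in>fiber w0. C (u y w) (u z w) = C y z"
    unfolding eventually_nhds_metric by blast
  show ?thesis
    by (rule that[of "min d e"]) (use d branchesD(1)[OF br] in \<open>auto simp: dist_commute\<close>)
qed

text \<open>Composition with a path of pairs gives a locally constant function on a connected
  parameter set. This is how monodromy enters.\<close>

lemma loc_const_path:
  fixes S :: "real set"
  assumes C: "loc_const C" and S: "connected S" and cont: "continuous_on S t" "continuous_on S x"
    and dom: "\<And>\<theta>. \<theta> \<in> S \<Longrightarrow> t \<theta> \<in> D0 \<and> x \<theta> \<in> fiber (B (t \<theta>))" and \<theta>: "\<theta> \<in> S" "\<theta>' \<in> S"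
  shows "C (t \<theta>) (x \<theta>) = C (t \<theta>') (x \<theta>')"
proof -
  have "(\<lambda>\<theta>. C (t \<theta>) (x \<theta>)) constant_on S"
  proof (rule locally_constant_imp_constant[OF S])
    fix s assume s: "s \<in> S"
    obtain e where e: "e > 0" "\<And>x' y'. x' \<in> D0 \<Longrightarrow> y' \<in> fiber (B x') \<Longrightarrow> dist x' (t s) < e \<Longrightarrow> dist y' (x s) < e
        \<Longrightarrow> C x' y' = C (t s) (x s)"
      using C dom[OF s] unfolding loc_const_def by meson
    let ?T = "(S \<inter> t -` ball (t s) e) \<inter> (S \<inter> x -` ball (x s) e)"
    have "openin (top_of_set S) ?T"
      by (intro openin_Int continuous_openin_preimage_gen cont) auto
    moreover have "s \<in> ?T" using s e(1) by simp
    moreover have "\<forall>q\<in>?T. C (t q) (x q) = C (t s) (x s)"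
      using e(2) dom by (auto simp: dist_commute)
    ultimately show "\<exists>T. openin (top_of_set S) T \<and> s \<in> T \<and> (\<forall>q\<in>T. C (t q) (x q) = C (t s) (x s))" by blast
  qed
  then show ?thesis using \<theta> unfolding constant_on_def by metis
qed

lemma locally_constant_D0:
  assumes "\<And>x. x \<in> D0 \<Longrightarrow> \<exists>\<delta>>0. \<forall>y\<in>ball x \<delta>. g y = g x" and xy: "x \<in> D0" "y \<in> D0"
  shows "g x = g y"
proof -
  have "g constant_on D0"
  proof (rule locally_constant_imp_constant[OF connected_D0])
    fix s assume s: "s \<in> D0"
    obtain \<delta> where "\<delta> > 0" "\<forall>y\<in>ball s \<delta>. g y = g s" using assms(1)[OF s] by (elim exE conjE)
    then show "\<exists>T. openin (top_of_set D0) T \<and> s \<in> T \<and> (\<forall>q\<in>T. g q = g s)"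
      using s openin_open_Int[OF open_ball, of D0 s \<delta>] by (intro exI[of _ "D0 \<inter> ball s \<delta>"] conjI) (assumption, simp, blast)
  qed
  then show ?thesis using xy unfolding constant_on_def by metis
qed

text \<open>The transposition of \<open>x\<close> and \<open>y\<close> preserves the columns of \<open>C\<close> outside the rows \<open>x\<close> and \<open>y\<close>.\<close>

definition swappable :: "(complex \<Rightarrow> complex \<Rightarrow> complex) \<Rightarrow> complex \<Rightarrow> complex \<Rightarrow> bool" where
  "swappable C x y \<longleftrightarrow> (\<forall>t\<in>fiber (B x) - {x, y}. C t x = C t y)"

definition nonswap :: "(complex \<Rightarrow> complex \<Rightarrow> complex) \<Rightarrow> complex \<Rightarrow> complex set" where
  "nonswap C x = {y \<in> fiber (B x). y \<noteq> x \<and> \<not> swappable C x y}"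

lemma finite_nonswap: "finite (nonswap C x)"
  by (simp add: nonswap_def finite_fiber)

text \<open>On an evenly covered disk the values of \<open>C\<close> are carried along by the
  sheets, and swappability with them; \<open>v y\<close> is the sheet through \<open>y\<close>
  composed with \<open>B\<close>.\<close>

lemma nonswap_local:
  assumes C: "loc_const C" and x: "x \<in> D0"
  obtains \<delta> v where "\<delta> > 0" "ball x \<delta> \<subseteq> D0" "\<And>y. y \<in> nonswap C x \<Longrightarrow> v y holomorphic_on ball x \<delta>"
    "\<And>z. z \<in> ball x \<delta> \<Longrightarrow> nonswap C z = (\<lambda>y. v y z) ` nonswap C x"
    "\<And>z. z \<in> ball x \<delta> \<Longrightarrow> inj_on (\<lambda>y. v y z) (nonswap C x)"
proof -
  obtain e u r where br: "branches (B x) e u r" using branches_at_D0[OF x] .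
  obtain d where d: "0 < d" "d \<le> e"
    "\<And>w y z. w \<in> ball (B x) d \<Longrightarrow> y \<in> fiber (B x) \<Longrightarrow> z \<in> fiber (B x) \<Longrightarrow> C (u y w) (u z w) = C y z"
    using loc_const_branches[OF C br] by blast
  obtain \<delta> where \<delta>: "\<delta> > 0" "\<And>y. y \<in> ball x \<delta> \<Longrightarrow> y \<in> D0 \<and> B y \<in> ball (B x) d \<and> B y \<in> ball (B x) e \<and> u x (B y) = y"
    using branches_near[OF x br d(1,2)] by blast
  let ?F = "fiber (B x)"
  have xF: "x \<in> ?F" by (rule D0_in_fiber[OF x])
  have sw: "swappable C z (u y (B z)) \<longleftrightarrow> swappable C x y" and ne: "u y (B z) = z \<longleftrightarrow> y = x"
    if z: "z \<in> ball x \<delta>" and y: "y \<in> ?F" for z y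
  proof -
    note zz = \<delta>(2)[OF z]
    have inj: "u s (B z) = u t (B z) \<longleftrightarrow> s = t" if "s \<in> ?F" "t \<in> ?F" for s t
      using branchesD(7)[OF br, of "B z"] zz that by (auto simp: inj_on_def)
    show "u y (B z) = z \<longleftrightarrow> y = x" using inj[OF y xF] zz by auto
    have "swappable C z (u y (B z)) \<longleftrightarrow> (\<forall>t\<in>?F. u t (B z) \<noteq> u x (B z) \<longrightarrow> u t (B z) \<noteq> u y (B z) \<longrightarrow>
        C (u t (B z)) (u x (B z)) = C (u t (B z)) (u y (B z)))"
      unfolding swappable_def using branchesD(6)[OF br, of "B z"] zz by auto
    also have "\<dots> \<longleftrightarrow> (\<forall>t\<in>?F. t \<noteq> x \<longrightarrow> t \<noteq> y \<longrightarrow> C t x = C t y)"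
    proof (intro ball_cong refl)
      have dd: "B z \<in> ball (B x) d" using zz by blast
      show "(u t (B z) \<noteq> u x (B z) \<longrightarrow> u t (B z) \<noteq> u y (B z) \<longrightarrow> C (u t (B z)) (u x (B z)) = C (u t (B z)) (u y (B z)))
          = (t \<noteq> x \<longrightarrow> t \<noteq> y \<longrightarrow> C t x = C t y)" if t: "t \<in> ?F" for t
        unfolding inj[OF t xF] inj[OF t y] d(3)[OF dd t xF] d(3)[OF dd t y] ..
    qed
    also have "\<dots> \<longleftrightarrow> swappable C x y" by (auto simp: swappable_def)
    finally show "swappable C z (u y (B z)) \<longleftrightarrow> swappable C x y" .
  qed
  show ?thesis
  proof (rule that[of \<delta> "\<lambda>y z. u y (B z)"])
    show "ball x \<delta> \<subseteq> D0" using \<delta>(2) by blast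
    then have hol: "B holomorphic_on ball x \<delta>" using holomorphic_on_subset[OF B_holomorphic_disk] by blast
    show "(\<lambda>z. u y (B z)) holomorphic_on ball x \<delta>" if "y \<in> nonswap C x" for y
    proof (rule holomorphic_on_compose_gen[OF hol branchesD(4)[OF br, of y], unfolded o_def])
      show "B ` ball x \<delta> \<subseteq> ball (B x) e" using \<delta>(2) by blast
    qed (use that in \<open>auto simp: nonswap_def\<close>)
    show "nonswap C z = (\<lambda>y. u y (B z)) ` nonswap C x" if z: "z \<in> ball x \<delta>" for z
      unfolding nonswap_def using branchesD(6)[OF br, of "B z"] \<delta>(2)[OF z] sw[OF z] ne[OF z] by auto
    show "inj_on (\<lambda>y. u y (B z)) (nonswap C x)" if z: "z \<in> ball x \<delta>" for z
      using branchesD(7)[OF br, of "B z"] \<delta>(2)[OF z] by (auto simp: nonswap_def inj_on_def)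
  qed (rule \<delta>(1))
qed

end

locale blaschke_simple = blaschke +
  assumes inj_crit: "inj_on B crit"
    and simple_crit: "\<And>p. p \<in> crit \<Longrightarrow> deriv (deriv B) p \<noteq> 0"
begin

text \<open>Turning once around a critical value exchanges the two points of the fiber that are close to
  the critical point, while the other points of the fiber return to themselves.\<close>

lemma swappable_near_critical:
  assumes C: "loc_const C" and p: "p \<in> crit"
  obtains r where "r > 0" "\<And>x y. x \<in> D0 \<Longrightarrow> x \<in> ball p r \<Longrightarrow> y \<in> D0 \<Longrightarrow> y \<in> ball p r \<Longrightarrow> B x = B y \<Longrightarrow> x \<noteq> y
    \<Longrightarrow> swappable C x y"
proof -
  have pD: "p \<in> unit_disk" and p0: "deriv B p = 0" using p by (auto simp: crit_def critical_set_def)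
  define l where "l = B p"
  \<comment> \<open>\<open>B - B p\<close> vanishes to order exactly 2 at \<open>p\<close>, hence is
    locally a square; \<open>\<phi>\<close> below is a coordinate in which \<open>B\<close> becomes
    \<open>l + \<phi>\<^sup>2\<close>.\<close>
  obtain g r1 where r1: "0 < r1" "g holomorphic_on ball p r1"
    "\<And>w. w \<in> ball p r1 \<Longrightarrow> B w - B p = ((w - p) * g w) ^ 2" "\<And>w. w \<in> ball p r1 \<Longrightarrow> g w \<noteq> 0"
  proof (rule holomorphic_factor_order_of_zero_strong[OF B_holomorphic_disk open_ball pD, of 2])
    show "(deriv ^^ 2) B p \<noteq> 0" using simple_crit[OF p] by (simp add: numeral_2_eq_2)
    show "(deriv ^^ i) B p = 0" if "0 < i" "i < 2" for i
      using that p0 by (cases "i = 1") auto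
  qed auto
  define \<phi> where "\<phi> w = (w - p) * g w" for w
  have \<phi>hol: "\<phi> holomorphic_on ball p r1" unfolding \<phi>_def by (intro holomorphic_intros r1)
  have sq: "B w = l + (\<phi> w)\<^sup>2" if "w \<in> ball p r1" for w
    using r1(3)[OF that] by (simp add: \<phi>_def l_def algebra_simps)
  have gdiff: "(g has_field_derivative deriv g p) (at p)"
    using r1 by (intro holomorphic_derivI[of g "ball p r1"]) auto
  have "(\<phi> has_field_derivative (1 * g p + deriv g p * (p - p))) (at p)"
    unfolding \<phi>_def by (rule DERIV_mult[OF _ gdiff]) (auto intro!: derivative_eq_intros)
  then have "deriv \<phi> p = g p" by (simp add: DERIV_imp_deriv)
  then have "deriv \<phi> p \<noteq> 0" using r1 by simp
  then obtain r2 where r2: "r2 > 0" "ball p r2 \<subseteq> ball p r1" "inj_on \<phi> (ball p r2)"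
    using has_complex_derivative_locally_injective[OF \<phi>hol _ open_ball] r1(1) by (metis centre_in_ball)
  define r3 where "r3 = min r2 (1 - norm p)"
  have r3: "r3 > 0" "ball p r3 \<subseteq> ball p r1" "ball p r3 \<subseteq> unit_disk" "inj_on \<phi> (ball p r3)"
  proof -
    show "r3 > 0" using r2 pD by (simp add: r3_def)
    have s: "ball p r3 \<subseteq> ball p r2" by (rule subset_ball) (simp add: r3_def)
    show "ball p r3 \<subseteq> ball p r1" "inj_on \<phi> (ball p r3)" using s r2 inj_on_subset by blast+
    show "ball p r3 \<subseteq> unit_disk" by (rule ball_subset_ball_iff[THEN iffD2]) (auto simp: r3_def dist_norm)
  qed
  have hol3: "\<phi> holomorphic_on ball p r3" using \<phi>hol r3(2) by (rule holomorphic_on_subset)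
  obtain \<psi> where \<psi>: "\<psi> holomorphic_on \<phi> ` ball p r3" "\<And>z. z \<in> ball p r3 \<Longrightarrow> deriv \<phi> z * deriv \<psi> (\<phi> z) = 1"
    "\<And>z. z \<in> ball p r3 \<Longrightarrow> \<psi> (\<phi> z) = z"
    by (rule holomorphic_has_inverse[OF hol3 open_ball r3(4)]) (rule that)
  have op: "open (\<phi> ` ball p r3)" by (rule open_mapping_thm3[OF hol3 open_ball r3(4)])
  have "0 \<in> \<phi> ` ball p r3" using r3(1) by (auto simp: \<phi>_def image_iff intro!: bexI[of _ p])
  then obtain \<delta>0 where \<delta>0: "\<delta>0 > 0" "ball 0 \<delta>0 \<subseteq> \<phi> ` ball p r3" using openE[OF op] by metis
  let ?Q = "fiber l - {p}"
  have Q: "q \<in> unit_disk \<and> B q = l \<and> deriv B q \<noteq> 0" if q: "q \<in> ?Q" for q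
  proof -
    \<comment> \<open>Injectivity of \<open>B\<close> on the critical points: \<open>p\<close> is
      the only one over \<open>l\<close>.\<close>
    have "q \<notin> crit" using q inj_onD[OF inj_crit _ _ p, of q] by (auto simp: fiber_def l_def)
    then show ?thesis using q by (auto simp: fiber_def crit_def critical_set_def)
  qed
  have "\<exists>r u e. 0 < r \<and> ball q r \<subseteq> unit_disk \<and> 0 < e \<and> u holomorphic_on ball l e \<and>
      (\<forall>w\<in>ball l e. u w \<in> ball q r \<and> B (u w) = w) \<and> (\<forall>z\<in>ball q r. u (B z) = z)" if q: "q \<in> ?Q" for q
  proof -
    have q': "q \<in> unit_disk" "deriv B q \<noteq> 0" "B q = l" using Q[OF q] by auto
    show ?thesis using local_inverse[OF q'(1,2) zero_less_one] unfolding q'(3) by metis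
  qed
  then obtain R u E where u: "\<And>q. q \<in> ?Q \<Longrightarrow> 0 < R q \<and> ball q (R q) \<subseteq> unit_disk \<and> 0 < E q \<and> u q holomorphic_on ball l (E q) \<and>
      (\<forall>w\<in>ball l (E q). u q w \<in> ball q (R q) \<and> B (u q w) = w) \<and> (\<forall>z\<in>ball q (R q). u q (B z) = z)" by metis
  define U where "U = ball p r3 \<union> (\<Union>q\<in>?Q. ball q (R q))"
  have U: "open U" "fiber l \<subseteq> U"
  proof -
    show "open U" unfolding U_def by (intro open_Un open_UN ballI open_ball)
    have "p \<in> U" using r3(1) by (simp add: U_def)
    moreover have "q \<in> U" if "q \<in> ?Q" for q
      unfolding U_def using u[OF that] that by (intro UnI2 UN_I[of q]) simp_all
    ultimately show "fiber l \<subseteq> U" by blast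
  qed
  have "norm l < 1" using norm_B_less_1[OF pD] by (simp add: l_def)
  then obtain e1 where e1: "e1 > 0" "\<And>w. w \<in> ball l e1 \<Longrightarrow> fiber w \<subseteq> U"
    using fiber_near[OF _ U] by blast
  \<comment> \<open>Near \<open>l\<close> there is no critical value except \<open>l\<close> itself,
    so the path constructed below stays in \<open>D0\<close>.\<close>
  have "open (- (B ` crit - {l}))" by (intro open_Compl finite_imp_closed finite_Diff finite_imageI finite_crit)
  then obtain e2 where e2: "e2 > 0" "ball l e2 \<subseteq> - (B ` crit - {l})" by (rule openE[of _ l]) auto
  define \<epsilon> where "\<epsilon> = Min (insert e1 (insert e2 (E ` ?Q)))"
  have \<epsilon>: "0 < \<epsilon>" "\<epsilon> \<le> e1" "\<epsilon> \<le> e2" "\<And>q. q \<in> ?Q \<Longrightarrow> \<epsilon> \<le> E q"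
  proof -
    show "0 < \<epsilon>" unfolding \<epsilon>_def using u e1(1) e2(1) finite_fiber by (subst Min_gr_iff) auto
    show "\<epsilon> \<le> e1" "\<epsilon> \<le> e2" "\<And>q. q \<in> ?Q \<Longrightarrow> \<epsilon> \<le> E q"
      unfolding \<epsilon>_def by (intro Min_le; simp add: finite_fiber)+
  qed
  \<comment> \<open>For \<open>norm s < 1\<close> the square has no larger modulus than
    \<open>s\<close>, so \<open>l + s\<^sup>2\<close> stays within \<open>\<epsilon>\<close> of
    \<open>l\<close>.\<close>
  define \<delta> where "\<delta> = min \<delta>0 (min 1 \<epsilon>)"
  have \<delta>: "\<delta> > 0" "ball 0 \<delta> \<subseteq> \<phi> ` ball p r3" using \<delta>0 \<epsilon> by (auto simp: \<delta>_def)
  have \<delta>sq: "norm (s\<^sup>2) < \<epsilon>" if "norm s < \<delta>" for s :: complex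
  proof -
    have "norm s * norm s \<le> norm s * 1" using that by (intro mult_left_mono) (auto simp: \<delta>_def)
    then show ?thesis using that by (simp add: norm_mult power2_eq_square \<delta>_def)
  qed
  have "p \<in> ball p r1" using r1(1) by simp
  then have "isCont \<phi> p"
    by (rule field_differentiable_imp_continuous_at[OF holomorphic_on_imp_differentiable_at[OF \<phi>hol open_ball]])
  moreover have "\<phi> p = 0" by (simp add: \<phi>_def)
  ultimately obtain r4 where r4: "r4 > 0" "\<And>x. dist x p < r4 \<Longrightarrow> norm (\<phi> x) < \<delta>"
    using \<delta>(1) unfolding continuous_at_eps_delta by (metis dist_0_norm dist_commute)
  define r where "r = min r3 r4"
  show ?thesis
  proof (rule that[of r])
    show "r > 0" using r3 r4 by (simp add: r_def)
    fix x y assume x: "x \<in> D0" "x \<in> ball p r" and y: "y \<in> D0" "y \<in> ball p r" and Bxy: "B x = B y" and "x \<noteq> y"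
    define s where "s = \<phi> x"
    have x3: "x \<in> ball p r3" "y \<in> ball p r3" using x y by (auto simp: r_def)
    have s\<delta>: "norm s < \<delta>" using r4(2)[of x] x(2) by (simp add: s_def r_def dist_commute)
    have Bx: "B x = l + s\<^sup>2" using sq[of x] x3(1) r3(2) by (auto simp: s_def)
    have "(\<phi> y)\<^sup>2 = s\<^sup>2" using sq[of y] x3(2) r3(2) Bx Bxy by auto
    moreover have "\<phi> y \<noteq> s" using inj_onD[OF r3(4) _ x3] \<open>x \<noteq> y\<close> by (auto simp: s_def)
    ultimately have \<phi>y: "\<phi> y = - s" by (simp add: power2_eq_iff)
    have s0: "s \<noteq> 0" using \<open>\<phi> y \<noteq> s\<close> \<phi>y by auto
    show "swappable C x y"
      unfolding swappable_def
    proof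
      fix t assume t: "t \<in> fiber (B x) - {x, y}"
      have tB: "B t = l + s\<^sup>2" "t \<in> unit_disk" using t Bx by (auto simp: fiber_def)
      have Bxe: "B x \<in> ball l e" if "\<epsilon> \<le> e" for e
        using \<delta>sq[OF s\<delta>] that by (simp add: Bx dist_norm)
      have "t \<in> U" using e1(2)[OF Bxe[OF \<epsilon>(2)]] t by blast
      moreover have "t \<notin> ball p r3"
      proof
        assume t3: "t \<in> ball p r3"
        then have "(\<phi> t)\<^sup>2 = s\<^sup>2" using sq[of t] r3(2) tB by auto
        then have "\<phi> t = \<phi> x \<or> \<phi> t = \<phi> y" using \<phi>y by (auto simp: power2_eq_iff s_def)
        then have "t = x \<or> t = y" using inj_onD[OF r3(4) _ t3] x3 by blast
        then show False using t by blast
      qed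
      ultimately obtain q where q: "q \<in> ?Q" "t \<in> ball q (R q)" unfolding U_def by blast
      \<comment> \<open>A half turn from \<open>s\<close> to \<open>-s\<close> in the coordinate
        \<open>\<phi>\<close>, hence a full turn of \<open>l + (z \<theta>)\<^sup>2\<close> around
        \<open>l\<close>. The lift \<open>X\<close> near \<open>p\<close> moves from
        \<open>x\<close> to \<open>y\<close>, while the lift \<open>T\<close> near the regular point
        \<open>q\<close> returns to \<open>t\<close>.\<close>
      define z where "z \<theta> = s * cis (pi * \<theta>)" for \<theta>
      define X where "X \<theta> = \<psi> (z \<theta>)" for \<theta>
      define T where "T \<theta> = u q (l + (z \<theta>)\<^sup>2)" for \<theta>
      have z: "norm (z \<theta>) < \<delta>" "z \<theta> \<noteq> 0" for \<theta> using s\<delta> s0 by (auto simp: z_def norm_mult)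
      have zc: "continuous_on S z" for S unfolding z_def cis_conv_exp by (intro continuous_intros)
      have zim: "z \<theta> \<in> \<phi> ` ball p r3" for \<theta> using z(1)[of \<theta>] \<delta>(2) by auto
      have X: "X \<theta> \<in> ball p r3" "\<phi> (X \<theta>) = z \<theta>" for \<theta>
        using zim[of \<theta>] \<psi>(3) by (auto simp: X_def)
      have BX: "B (X \<theta>) = l + (z \<theta>)\<^sup>2" for \<theta> using sq[of "X \<theta>"] X[of \<theta>] r3(2) by auto
      have w: "l + (z \<theta>)\<^sup>2 \<in> ball l e" if "\<epsilon> \<le> e" for e \<theta>
        using \<delta>sq[OF z(1)[of \<theta>]] that by (simp add: dist_norm)
      have XD: "X \<theta> \<in> D0" for \<theta>
        unfolding D0_iff BX using X(1)[of \<theta>] r3(3) w[OF \<epsilon>(3), of \<theta>] e2(2) z(2)[of \<theta>] by auto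
      have T: "T \<theta> \<in> ball q (R q)" "B (T \<theta>) = l + (z \<theta>)\<^sup>2" for \<theta>
        using u[OF q(1)] w[OF \<epsilon>(4)[OF q(1)], of \<theta>] by (auto simp: T_def)
      have TD: "T \<theta> \<in> fiber (B (X \<theta>))" for \<theta>
        using T[of \<theta>] u[OF q(1)] BX by (auto simp: fiber_def)
      have "C (T 0) (X 0) = C (T 1) (X 1)"
      proof (rule loc_const_path[OF C, of "{0..1}"])
        show "continuous_on {0..1} X" unfolding X_def
          by (rule continuous_on_compose2[OF holomorphic_on_imp_continuous_on[OF \<psi>(1)] zc]) (use zim in auto)
        have "u q holomorphic_on ball l (E q)" using u[OF q(1)] by blast
        then show "continuous_on {0..1} T" unfolding T_def
          by (rule continuous_on_compose2[OF holomorphic_on_imp_continuous_on])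
            (use w[OF \<epsilon>(4)[OF q(1)]] in \<open>auto intro!: continuous_intros zc\<close>)
        show "T \<theta> \<in> D0 \<and> X \<theta> \<in> fiber (B (T \<theta>))" for \<theta>
          using D0_transfer[OF XD TD] T(2) BX XD by (auto simp: fiber_def)
      qed auto
      moreover have "X 0 = x" using \<psi>(3)[OF x3(1)] by (simp add: X_def z_def s_def)
      moreover have "X 1 = y" using \<psi>(3)[OF x3(2)] by (simp add: X_def z_def \<phi>y)
      moreover have "u q (B t) = t" using u[OF q(1)] q(2) by blast
      then have "T 0 = t" "T 1 = t" by (simp_all add: T_def z_def tB(1))
      ultimately show "C t x = C t y" by simp
    qed
  qed
qed

lemma swappable_near:
  assumes C: "loc_const C" and q: "q \<in> unit_disk"
  obtains r where "r > 0" "\<And>x y. x \<in> D0 \<Longrightarrow> x \<in> ball q r \<Longrightarrow> y \<in> D0 \<Longrightarrow> y \<in> ball q r \<Longrightarrow> B x = B y \<Longrightarrow> x \<noteq> y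
    \<Longrightarrow> swappable C x y"
proof (cases "q \<in> crit")
  case True
  then show ?thesis using swappable_near_critical[OF C] that by metis
next
  case False
  \<comment> \<open>Near a regular point \<open>B\<close> is injective, so there are no pairs to
    consider.\<close>
  then have "deriv B q \<noteq> 0" using q by (simp add: crit_def critical_set_def)
  then obtain r where "r > 0" "inj_on B (ball q r)"
    using has_complex_derivative_locally_injective[OF B_holomorphic_disk q open_ball] by blast
  then show ?thesis using that[of r] by (auto simp: inj_on_def)
qed

end

section \<open>Locally constant functions on pairs of points of a fiber\<close>

context blaschke_simple
begin

text \<open>The function \<open>G\<close> of the overview, before its extension across
  \<open>exc\<close>.\<close>

definition nonswap_prod :: "(complex \<Rightarrow> complex \<Rightarrow> complex) \<Rightarrow> complex \<Rightarrow> complex" where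
  "nonswap_prod C x = (\<Prod>y\<in>nonswap C x. x - y)"

lemma nonswap_prod_holomorphic:
  assumes C: "loc_const C"
  shows "nonswap_prod C holomorphic_on D0"
  unfolding holomorphic_on_def
proof
  fix x assume x: "x \<in> D0"
  obtain \<delta> v where \<delta>: "\<delta> > 0" and hol: "\<And>y. y \<in> nonswap C x \<Longrightarrow> v y holomorphic_on ball x \<delta>"
    and eq: "\<And>z. z \<in> ball x \<delta> \<Longrightarrow> nonswap C z = (\<lambda>y. v y z) ` nonswap C x"
    and inj: "\<And>z. z \<in> ball x \<delta> \<Longrightarrow> inj_on (\<lambda>y. v y z) (nonswap C x)"
    using nonswap_local[OF C x] by metis
  have "(\<lambda>z. \<Prod>y\<in>nonswap C x. z - v y z) holomorphic_on ball x \<delta>"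
    by (intro holomorphic_intros hol)
  then have "nonswap_prod C holomorphic_on ball x \<delta>"
  proof (rule holomorphic_transform)
    show "(\<Prod>y\<in>nonswap C x. z - v y z) = nonswap_prod C z" if z: "z \<in> ball x \<delta>" for z
      unfolding nonswap_prod_def eq[OF z] by (subst prod.reindex[OF inj[OF z]]) (simp add: o_def)
  qed
  then have "nonswap_prod C field_differentiable at x"
    using \<delta> by (intro holomorphic_on_imp_differentiable_at[of _ "ball x \<delta>"]) auto
  then show "nonswap_prod C field_differentiable (at x within D0)"
    by (rule field_differentiable_at_within)
qed

lemma card_nonswap_constant:
  assumes C: "loc_const C" and "x \<in> D0" "y \<in> D0"
  shows "card (nonswap C x) = card (nonswap C y)"
proof (rule locally_constant_D0[OF _ assms(2,3)])
  fix x assume x: "x \<in> D0"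
  obtain \<delta> v where \<delta>: "\<delta> > 0"
    and eq: "\<And>z. z \<in> ball x \<delta> \<Longrightarrow> nonswap C z = (\<lambda>y. v y z) ` nonswap C x"
    and inj: "\<And>z. z \<in> ball x \<delta> \<Longrightarrow> inj_on (\<lambda>y. v y z) (nonswap C x)"
    using nonswap_local[OF C x] by metis
  show "\<exists>\<delta>>0. \<forall>z\<in>ball x \<delta>. card (nonswap C z) = card (nonswap C x)"
  proof (intro exI[of _ \<delta>] conjI ballI \<delta>)
    fix z assume z: "z \<in> ball x \<delta>"
    show "card (nonswap C z) = card (nonswap C x)"
      unfolding eq[OF z] by (rule card_image[OF inj[OF z]])
  qed
qed

lemma eventually_at_D0: "q \<in> unit_disk \<Longrightarrow> \<forall>\<^sub>F x in at q. x \<in> D0"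
proof -
  assume q: "q \<in> unit_disk"
  have "open (unit_disk - (exc - {q}))" by (simp add: finite_exc finite_imp_closed open_Diff)
  then have "\<forall>\<^sub>F x in at q. x \<in> unit_disk - (exc - {q}) - {q}"
    using q by (intro eventually_at_in_open) auto
  then show ?thesis by eventually_elim auto
qed

text \<open>By \<open>swappable_near\<close> a point of \<open>nonswap C x\<close> cannot lie in
  \<open>ball q r\<close>; with \<open>x\<close> in the ball of half the radius, each factor has
  modulus between \<open>r / 2\<close> and 2. The upper bound makes the singularities at
  \<open>exc\<close> removable, and the lower bound keeps the extension free of zeros.\<close>

lemma nonswap_prod_bounds:
  assumes C: "loc_const C" and q: "q \<in> unit_disk"
  obtains \<kappa> K where "\<kappa> > 0" "\<forall>\<^sub>F x in at q. \<kappa> \<le> norm (nonswap_prod C x) \<and> norm (nonswap_prod C x) \<le> K"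
proof -
  obtain r where r: "r > 0" "\<And>x y. x \<in> D0 \<Longrightarrow> x \<in> ball q r \<Longrightarrow> y \<in> D0 \<Longrightarrow> y \<in> ball q r \<Longrightarrow> B x = B y \<Longrightarrow> x \<noteq> y
      \<Longrightarrow> swappable C x y"
    using swappable_near[OF C q] by blast
  obtain x0 where x0: "x0 \<in> D0"
    using eventually_happens[OF eventually_at_D0[OF q]] by auto
  define N where "N = card (nonswap C x0)"
  have "\<forall>\<^sub>F x in at q. x \<in> ball q (r / 2)"
    using r(1) eventually_at_in_open'[of "ball q (r/2)" q] by simp
  then have "\<forall>\<^sub>F x in at q. (r / 2) ^ N \<le> norm (nonswap_prod C x) \<and> norm (nonswap_prod C x) \<le> 2 ^ N"
    using eventually_at_D0[OF q]
  proof eventually_elim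
    case (elim x)
    have N: "card (nonswap C x) = N" unfolding N_def using card_nonswap_constant[OF C elim(2) x0] .
    have bd: "r / 2 \<le> norm (x - y) \<and> norm (x - y) \<le> 2" if y: "y \<in> nonswap C x" for y
    proof
      have yf: "y \<in> fiber (B x)" "x \<noteq> y" "\<not> swappable C x y" using y by (auto simp: nonswap_def)
      have "y \<notin> ball q r"
        using r(2)[OF elim(2) _ D0_transfer[OF elim(2) yf(1)]] yf elim(1) r(1) by (auto simp: fiber_def)
      then show "r / 2 \<le> norm (x - y)"
        using elim(1) dist_triangle[of q y x] by (simp add: dist_norm)
      have "norm x < 1" "norm y < 1" using elim(2) yf(1) by (auto simp: fiber_def)
      then show "norm (x - y) \<le> 2" using norm_triangle_ineq4[of x y] by simp
    qed
    have "(\<Prod>y\<in>nonswap C x. r / 2) \<le> (\<Prod>y\<in>nonswap C x. norm (x - y))"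
      using bd r(1) by (intro prod_mono) auto
    moreover have "(\<Prod>y\<in>nonswap C x. norm (x - y)) \<le> (\<Prod>y\<in>nonswap C x. 2)"
      using bd by (intro prod_mono) auto
    ultimately show ?case using N by (simp add: nonswap_prod_def prod_norm)
  qed
  then show ?thesis using that[of "(r / 2) ^ N"] r(1) by simp
qed

lemma nonswap_prod_eq_exp:
  assumes C: "loc_const C"
  obtains h where "h holomorphic_on unit_disk" "\<And>x. x \<in> D0 \<Longrightarrow> nonswap_prod C x = exp (h x)"
proof -
  have "\<exists>g. g holomorphic_on unit_disk \<and> (\<forall>z\<in>unit_disk - exc. g z = nonswap_prod C z)"
  proof (rule removable_singularities[OF finite_exc])
    show "nonswap_prod C \<in> O[at q](\<lambda>_. 1)" if q: "q \<in> exc" for q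
    proof -
      have "q \<in> unit_disk" using q exc_subset by blast
      then obtain \<kappa> K where "\<forall>\<^sub>F x in at q. \<kappa> \<le> norm (nonswap_prod C x) \<and> norm (nonswap_prod C x) \<le> K"
        using nonswap_prod_bounds[OF C] by metis
      then show ?thesis by (intro bigoI[where c = K]) (auto elim: eventually_mono)
    qed
  qed (use exc_subset nonswap_prod_holomorphic[OF C] in auto)
  then obtain g where g: "g holomorphic_on unit_disk" "\<And>z. z \<in> D0 \<Longrightarrow> g z = nonswap_prod C z" by blast
  have "g q \<noteq> 0" if q: "q \<in> unit_disk" for q
  proof -
    obtain \<kappa> K where \<kappa>: "\<kappa> > 0" "\<forall>\<^sub>F x in at q. \<kappa> \<le> norm (nonswap_prod C x) \<and> norm (nonswap_prod C x) \<le> K"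
      using nonswap_prod_bounds[OF C q] by blast
    have "isCont g q"
      by (rule field_differentiable_imp_continuous_at holomorphic_on_imp_differentiable_at[OF g(1) open_ball q])+
    then have "((\<lambda>x. norm (g x)) \<longlongrightarrow> norm (g q)) (at q)" by (intro tendsto_norm) (simp add: isCont_def)
    moreover have "\<forall>\<^sub>F x in at q. \<kappa> \<le> norm (g x)"
      using \<kappa>(2) eventually_at_D0[OF q] by eventually_elim (simp add: g(2))
    ultimately have "\<kappa> \<le> norm (g q)" by (rule tendsto_lowerbound) simp
    then show ?thesis using \<kappa>(1) by auto
  qed
  then obtain h where h: "h holomorphic_on unit_disk" "\<And>z. z \<in> unit_disk \<Longrightarrow> g z = exp (h z)"
    using contractible_imp_holomorphic_log[OF g(1) convex_imp_contractible[OF convex_ball]] by metis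
  show ?thesis by (rule that[OF h(1)]) (use h(2) g(2) in auto)
qed

lemma annulus_in_D0:
  obtains r where "\<rho> \<le> r" "r < 1" "\<And>x. r < norm x \<Longrightarrow> norm x < 1 \<Longrightarrow> x \<in> D0"
proof -
  define r where "r = Max (insert \<rho> (norm ` exc))"
  show ?thesis
  proof (rule that[of r])
    show "\<rho> \<le> r" unfolding r_def by (rule Max_ge) (auto simp: finite_exc)
    show "r < 1" unfolding r_def using finite_exc exc_subset \<rho>(2) by (subst Max_less_iff) auto
    show "x \<in> D0" if "r < norm x" "norm x < 1" for x
    proof -
      have "x \<notin> exc"
      proof
        assume "x \<in> exc"
        then have "norm x \<le> r" unfolding r_def by (intro Max_ge) (auto simp: finite_exc)
        then show False using that by simp
      qed
      then show ?thesis using that by simp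
    qed
  qed
qed

text \<open>Since \<open>norm \<circ> B\<close> increases along rays near the circle, a fiber cannot contain two points on the same
  ray there.\<close>

lemma one_minus_quotient_not_nonpos:
  assumes x: "\<rho> \<le> norm x" "norm x < 1" and y: "y \<in> fiber (B x)" "y \<noteq> x"
  shows "1 - y / x \<notin> \<real>\<^sub>\<le>\<^sub>0"
proof
  assume neg: "1 - y / x \<in> \<real>\<^sub>\<le>\<^sub>0"
  have x0: "x \<noteq> 0" using x(1) \<rho>(1) by auto
  obtain t where t: "1 - y / x = of_real t" "t \<le> 0"
    using neg by (auto elim!: nonpos_Reals_cases)
  \<comment> \<open>So \<open>y\<close> lies on the ray of \<open>x\<close>, and strictly farther
    out because \<open>y \<noteq> x\<close>; there \<open>B\<close> has larger modulus, although
    both points are in one fiber.\<close>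
  have "y / x = of_real (1 - t)" using t(1) by (simp add: algebra_simps)
  then have yx: "y = of_real (1 - t) * x" using x0 by (simp add: field_simps)
  have "t \<noteq> 0" using yx y(2) by auto
  then have "1 - t > 1" using t by simp
  then have "norm (B x) < norm (B y)"
    using norm_B_radial[OF x(1), of "1 - t"] y(1) unfolding yx by (simp add: fiber_def)
  then show False using y(1) by (simp add: fiber_def)
qed

lemma nonswap_empty:
  assumes C: "loc_const C" and x: "x \<in> D0"
  shows "nonswap C x = {}"
proof -
  obtain h where h: "h holomorphic_on unit_disk" "\<And>x. x \<in> D0 \<Longrightarrow> nonswap_prod C x = exp (h x)"
    using nonswap_prod_eq_exp[OF C] by blast
  obtain r where r: "\<rho> \<le> r" "r < 1" "\<And>x. r < norm x \<Longrightarrow> norm x < 1 \<Longrightarrow> x \<in> D0"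
    using annulus_in_D0 by blast
  define A where "A = ball 0 1 - cball (0::complex) r"
  have A: "open A" "\<And>z. z \<in> A \<longleftrightarrow> r < norm z \<and> norm z < 1" "A \<subseteq> D0"
    using r(3) by (auto simp: A_def)
  have r0: "0 < r" using r(1) \<rho>(1) by linarith
  define N where "N = card (nonswap C x)"
  have N: "card (nonswap C z) = N" if "z \<in> D0" for z
    unfolding N_def by (rule card_nonswap_constant[OF C that x])
  \<comment> \<open>The sum is over an unordered set, and by \<open>slit\<close> every term can use
    the principal branch. Hence \<open>L\<close> is single valued on the annulus although the points
    of the fiber may be permuted along it.\<close>
  define L where "L z = (\<Sum>y\<in>nonswap C z. Ln (1 - y / z))" for z
  have slit: "1 - y / z \<notin> \<real>\<^sub>\<le>\<^sub>0" if "z \<in> A" "y \<in> nonswap C z" for y z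
    using that r(1) by (intro one_minus_quotient_not_nonpos) (auto simp: A(2) nonswap_def)
  have Lhol: "L holomorphic_on A"
    unfolding holomorphic_on_def
  proof
    fix s assume s: "s \<in> A"
    then have sD: "s \<in> D0" using A(3) by blast
    obtain \<delta> v where \<delta>: "\<delta> > 0" and hol: "\<And>y. y \<in> nonswap C s \<Longrightarrow> v y holomorphic_on ball s \<delta>"
      and eq: "\<And>z. z \<in> ball s \<delta> \<Longrightarrow> nonswap C z = (\<lambda>y. v y z) ` nonswap C s"
      and inj: "\<And>z. z \<in> ball s \<delta> \<Longrightarrow> inj_on (\<lambda>y. v y z) (nonswap C s)"
      using nonswap_local[OF C sD] by metis
    let ?S = "A \<inter> ball s \<delta>"
    have "(\<lambda>z. \<Sum>y\<in>nonswap C s. Ln (1 - v y z / z)) holomorphic_on ?S"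
    proof (intro holomorphic_intros)
      show "v y holomorphic_on ?S" if "y \<in> nonswap C s" for y
        using hol[OF that] by (rule holomorphic_on_subset) auto
      show "1 - v y z / z \<notin> \<real>\<^sub>\<le>\<^sub>0" if "y \<in> nonswap C s" "z \<in> ?S" for y z
        using that by (intro slit) (auto simp: eq)
    qed (use A(2) r0 in auto)
    then have "L holomorphic_on ?S"
    proof (rule holomorphic_transform)
      show "(\<Sum>y\<in>nonswap C s. Ln (1 - v y z / z)) = L z" if "z \<in> ?S" for z
      proof -
        have z: "z \<in> ball s \<delta>" using that by simp
        show ?thesis unfolding L_def eq[OF z] by (subst sum.reindex[OF inj[OF z]]) (simp add: o_def)
      qed
    qed
    then have "L field_differentiable at s"
      using \<delta> s A(1) by (intro holomorphic_on_imp_differentiable_at[of _ ?S]) auto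
    then show "L field_differentiable (at s within A)" by (rule field_differentiable_at_within)
  qed
  have eqN: "exp (h z - L z) = z ^ N" if z: "z \<in> A" for z
  proof -
    have z0: "z \<noteq> 0" using z A(2) r0 by auto
    have "exp (L z) = (\<Prod>y\<in>nonswap C z. 1 - y / z)"
      unfolding L_def exp_sum[OF finite_nonswap]
    proof (rule prod.cong[OF refl])
      fix y assume "y \<in> nonswap C z"
      then have "1 - y / z \<noteq> 0" using z0 by (auto simp: nonswap_def)
      then show "exp (Ln (1 - y / z)) = 1 - y / z" by simp
    qed
    then have "exp (L z) * z ^ N = (\<Prod>y\<in>nonswap C z. 1 - y / z) * (\<Prod>y\<in>nonswap C z. z)"
      using N[of z] z A(3) by auto
    also have "\<dots> = nonswap_prod C z"
      unfolding nonswap_prod_def prod.distrib[symmetric] using z0 by (simp add: algebra_simps)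
    also have "\<dots> = exp (h z)" using h(2) z A(3) by blast
    finally show ?thesis by (simp add: exp_diff field_simps)
  qed
  \<comment> \<open>By \<open>eqN\<close> this is a single-valued logarithm of \<open>z ^ N\<close>
    on the annulus, so its derivative is \<open>N / z\<close>. The integral of that derivative over
    a circle is 0, and it is also \<open>N\<close> times \<open>2 * pi * \<i>\<close>.\<close>
  define f where "f z = h z - L z" for z
  have fhol: "f holomorphic_on A"
    unfolding f_def by (intro holomorphic_intros Lhol holomorphic_on_subset[OF h(1)]) (auto simp: A(2))
  have fder: "(f has_field_derivative of_nat N / z) (at z)" if z: "z \<in> A" for z
  proof -
    have z0: "z \<noteq> 0" using z A(2) r0 by auto
    have d: "(f has_field_derivative deriv f z) (at z)" by (rule holomorphic_derivI[OF fhol A(1) z])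
    then have "((\<lambda>z. exp (f z)) has_field_derivative exp (f z) * deriv f z) (at z)"
      by (auto intro!: derivative_eq_intros)
    moreover have "((\<lambda>z. exp (f z)) has_field_derivative of_nat N * z ^ (N - 1)) (at z)"
    proof (rule has_field_derivative_transform_within_open[OF _ A(1) z])
      show "((\<lambda>z. z ^ N) has_field_derivative of_nat N * z ^ (N - 1)) (at z)"
        by (auto intro!: derivative_eq_intros)
    qed (simp add: eqN f_def)
    ultimately have "exp (f z) * deriv f z = of_nat N * z ^ (N - 1)" by (rule DERIV_unique)
    then have "z ^ N * deriv f z = of_nat N * z ^ (N - 1)" using eqN[OF z] by (simp add: f_def)
    then have "z ^ N * (deriv f z * z) = of_nat N * z ^ (N - 1) * z" by (simp only: mult.assoc[symmetric])
    also have "\<dots> = z ^ N * of_nat N" by (cases N) (simp_all add: mult_ac)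
    finally have "deriv f z = of_nat N / z" using z0 by (simp add: field_simps)
    then show ?thesis using d by simp
  qed
  define R where "R = (1 + r) / 2"
  have R: "R > 0" "r < R" "R < 1" using r(2) r0 by (auto simp: R_def)
  have "((\<lambda>z. of_nat N / z) has_contour_integral (f (pathfinish (circlepath 0 R)) - f (pathstart (circlepath 0 R)))) (circlepath 0 R)"
    by (rule contour_integral_primitive[where S = A])
      (use fder R A(2) in \<open>auto intro: has_field_derivative_at_within simp: path_image_circlepath\<close>)
  then have "((\<lambda>z. of_nat N / z) has_contour_integral 0) (circlepath 0 R)" by simp
  moreover have "((\<lambda>z. of_nat N / z) has_contour_integral (of_nat N * (2 * of_real pi * \<i>))) (circlepath 0 R)"
    using has_contour_integral_lmul[OF Cauchy_integral_circlepath_simple[of "\<lambda>_. 1" 0 R 0], of "of_nat N"] R(1)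
    by simp
  ultimately have "of_nat N * (2 * of_real pi * \<i>) = (0::complex)"
    using contour_integral_unique by metis
  then have "N = 0" by simp
  then show ?thesis using finite_nonswap N_def by auto
qed

theorem loc_const_two_values:
  assumes C: "loc_const C"
  obtains \<alpha> \<beta> where "\<And>x. x \<in> D0 \<Longrightarrow> C x x = \<alpha>" "\<And>x y. x \<in> D0 \<Longrightarrow> y \<in> fiber (B x) \<Longrightarrow> y \<noteq> x \<Longrightarrow> C x y = \<beta>"
proof -
  \<comment> \<open>The pair \<open>y\<close>, \<open>z\<close> is swappable by
    \<open>nonswap_empty\<close>; reading this in row \<open>x\<close> shows that the row is
    constant off the diagonal.\<close>
  have sw: "C x y = C x z" if "x \<in> D0" "y \<in> fiber (B x)" "z \<in> fiber (B x)" "y \<noteq> x" "z \<noteq> x" for x y z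
  proof (cases "y = z")
    case False
    have "y \<in> D0" using D0_transfer that by blast
    then have "nonswap C y = {}" by (rule nonswap_empty[OF C])
    moreover have By: "B y = B x" using that by (simp add: fiber_def)
    ultimately have "swappable C y z" using False that by (auto simp: nonswap_def)
    then show ?thesis using that D0_in_fiber[OF that(1)] By by (auto simp: swappable_def)
  qed simp
  \<comment> \<open>The off-diagonal value of row \<open>x\<close>; a fiber with a single point has
    none, and 0 is a placeholder.\<close>
  define b where "b x = (if fiber (B x) = {x} then 0 else C x (SOME y. y \<in> fiber (B x) \<and> y \<noteq> x))" for x
  have b: "C x y = b x" if "x \<in> D0" "y \<in> fiber (B x)" "y \<noteq> x" for x y
  proof -
    have "\<exists>y. y \<in> fiber (B x) \<and> y \<noteq> x" using that by blast
    then have s: "(SOME y. y \<in> fiber (B x) \<and> y \<noteq> x) \<in> fiber (B x)" "(SOME y. y \<in> fiber (B x) \<and> y \<noteq> x) \<noteq> x"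
      using someI_ex[of "\<lambda>y. y \<in> fiber (B x) \<and> y \<noteq> x"] by blast+
    have "fiber (B x) \<noteq> {x}" using that by blast
    then have "b x = C x (SOME y. y \<in> fiber (B x) \<and> y \<noteq> x)" unfolding b_def by (rule if_not_P)
    then show ?thesis using sw[OF that(1,2) s(1) that(3) s(2)] by simp
  qed
  have loc: "\<exists>\<delta>>0. \<forall>z\<in>ball x \<delta>. C z z = C x x \<and> b z = b x" if x: "x \<in> D0" for x
  proof -
    obtain e u r where br: "branches (B x) e u r" using branches_at_D0[OF x] .
    obtain d where d: "0 < d" "d \<le> e"
      "\<And>w y z. w \<in> ball (B x) d \<Longrightarrow> y \<in> fiber (B x) \<Longrightarrow> z \<in> fiber (B x) \<Longrightarrow> C (u y w) (u z w) = C y z"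
      using loc_const_branches[OF C br] by blast
    obtain \<delta> where \<delta>: "\<delta> > 0" "\<And>y. y \<in> ball x \<delta> \<Longrightarrow> y \<in> D0 \<and> B y \<in> ball (B x) d \<and> B y \<in> ball (B x) e \<and> u x (B y) = y"
      using branches_near[OF x br d(1,2)] by blast
    have xF: "x \<in> fiber (B x)" by (rule D0_in_fiber[OF x])
    have "C z z = C x x \<and> b z = b x" if z: "z \<in> ball x \<delta>" for z
    proof
      have zz: "z \<in> D0" "B z \<in> ball (B x) d" "B z \<in> ball (B x) e" "u x (B z) = z" using \<delta>(2)[OF z] by auto
      show "C z z = C x x" using d(3)[OF zz(2) xF xF] zz(4) by simp
      have F: "fiber (B z) = (\<lambda>y. u y (B z)) ` fiber (B x)" by (rule branchesD(6)[OF br zz(3)])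
      show "b z = b x"
      proof (cases "fiber (B x) = {x}")
        case True
        then have "fiber (B z) = {z}" using F zz(4) by simp
        then show ?thesis using True by (simp add: b_def)
      next
        case False
        then obtain y where y: "y \<in> fiber (B x)" "y \<noteq> x" using xF by blast
        have "u y (B z) \<noteq> u x (B z)"
          using inj_onD[OF branchesD(7)[OF br zz(3)] _ y(1) xF] y(2) by blast
        then have "C z (u y (B z)) = b z" using zz F y(1) by (intro b) auto
        moreover have "C z (u y (B z)) = C x y" using d(3)[OF zz(2) xF y(1)] zz(4) by simp
        ultimately show ?thesis using b[OF x y] by simp
      qed
    qed
    then show ?thesis using \<delta>(1) by blast
  qed
  have "C x x = C y y" if "x \<in> D0" "y \<in> D0" for x y
    by (rule locally_constant_D0[where g = "\<lambda>x. C x x", OF _ that]) (use loc in blast)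
  moreover have "b x = b y" if "x \<in> D0" "y \<in> D0" for x y
    by (rule locally_constant_D0[OF _ that]) (use loc in blast)
  moreover obtain x0 where "x0 \<in> D0" using eventually_happens[OF eventually_at_D0[of 0]] by auto
  ultimately show ?thesis using that[of "C x0 x0" "b x0"] b by metis
qed

end

section \<open>Averaging over fibers\<close>

context blaschke
begin

lemma B_measurable [measurable]: "B \<in> borel_measurable borel"
  unfolding B_def blaschke_factor_def
  by (intro borel_measurable_times borel_measurable_prod borel_measurable_divide borel_measurable_const
      borel_measurable_continuous_onI continuous_intros)

lemma mult_op_B: "bergman_fun (mult_op B f) z = B z * bergman_fun f z"
  by (rule mult_op_apply[OF B_holomorphic_disk bounded_B])

lemma bergman_fun_cscale: "bergman_fun (cscale k f) z = k * bergman_fun f z"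
  by (simp add: cscale.rep_eq)

lemma complex_linear_mult_op_B: "complex_linear (mult_op B)"
  unfolding complex_linear_def
  by (intro allI bergman_eqI) (simp add: mult_op_B bergman_fun_cscale)

text \<open>If \<open>T\<close> and \<open>T'\<close> are adjoint to each other and commute with \<open>mult_op B\<close>, the measure
  \<open>(T f \<cdot> cnj g - f \<cdot> cnj (T' g)) dA\<close> has vanishing image under \<open>B\<close>.\<close>

definition defect :: "(bergman \<Rightarrow>\<^sub>L bergman) \<Rightarrow> (bergman \<Rightarrow>\<^sub>L bergman) \<Rightarrow> bergman \<Rightarrow> bergman \<Rightarrow> complex \<Rightarrow> complex" where
  "defect T T' f g z = bergman_fun (T f) z * cnj (bergman_fun g z) - bergman_fun f z * cnj (bergman_fun (T' g) z)"

lemma integrable_defect: "integrable disk_area (defect T T' f g)"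
  unfolding defect_def by (intro Bochner_Integration.integrable_diff bergman_functions_integrable bergman_fun_in)

lemma integrable_comp_B_mult:
  fixes H :: "complex \<Rightarrow> complex"
  assumes \<psi>: "continuous_on UNIV \<psi>" and H: "integrable disk_area H"
  shows "integrable disk_area (\<lambda>z. \<psi> (B z) * H z)"
proof -
  have "compact (\<psi> ` cball 0 1)"
    by (intro compact_continuous_image continuous_on_subset[OF \<psi>]) auto
  then obtain K where K: "\<And>w. w \<in> cball 0 1 \<Longrightarrow> norm (\<psi> w) \<le> K"
    using compact_imp_bounded[of "\<psi> ` cball 0 1"] unfolding bounded_iff by (metis imageI)
  have [measurable]: "\<psi> \<in> borel_measurable borel" by (rule borel_measurable_continuous_onI[OF \<psi>])
  have m: "(\<lambda>z. \<psi> (B z)) \<in> borel_measurable disk_area" by measurable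
  show ?thesis
  proof (rule Bochner_Integration.integrable_bound)
    show "integrable disk_area (\<lambda>z. of_real K * H z)" using H by simp
    show "(\<lambda>z. \<psi> (B z) * H z) \<in> borel_measurable disk_area"
      using m borel_measurable_integrable[OF H] by (rule borel_measurable_times)
    show "AE z in disk_area. norm (\<psi> (B z) * H z) \<le> norm (of_real K * H z)"
      using AE_disk_area
    proof eventually_elim
      case (elim z)
      have "norm (\<psi> (B z)) \<le> K" using norm_B_less_1[OF elim] by (intro K) simp
      then have "norm (\<psi> (B z)) * norm (H z) \<le> \<bar>K\<bar> * norm (H z)" by (intro mult_right_mono) auto
      then show ?case by (simp add: norm_mult)
    qed
  qed
qed

text \<open>Continuity makes \<open>\<psi> \<circ> B\<close> bounded on the disk, hence all
  integrals involved exist. For operators commuting with \<open>mult_op B\<close> the class is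
  closed under multiplication by \<open>w\<close> and \<open>cnj w\<close>, which leads from the
  constant 1 to real polynomials.\<close>

definition annihilates :: "(bergman \<Rightarrow>\<^sub>L bergman) \<Rightarrow> (bergman \<Rightarrow>\<^sub>L bergman) \<Rightarrow> (complex \<Rightarrow> complex) \<Rightarrow> bool" where
  "annihilates T T' \<psi> \<longleftrightarrow> continuous_on UNIV \<psi> \<and> (\<forall>f g. (\<integral>z. \<psi> (B z) * defect T T' f g z \<partial>disk_area) = 0)"

lemma annihilates_lincomb:
  assumes "annihilates T T' \<psi>" "annihilates T T' \<psi>'"
  shows "annihilates T T' (\<lambda>w. k * \<psi> w + l * \<psi>' w)"
  unfolding annihilates_def
proof (intro conjI allI)
  show "continuous_on UNIV (\<lambda>w. k * \<psi> w + l * \<psi>' w)"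
    using assms unfolding annihilates_def by (intro continuous_intros) auto
  fix f g
  have "(\<integral>z. (k * \<psi> (B z) + l * \<psi>' (B z)) * defect T T' f g z \<partial>disk_area)
      = (\<integral>z. k * (\<psi> (B z) * defect T T' f g z) + l * (\<psi>' (B z) * defect T T' f g z) \<partial>disk_area)"
    by (simp add: algebra_simps)
  also have "\<dots> = 0"
    using assms by (subst Bochner_Integration.integral_add)
      (auto simp: annihilates_def intro!: integrable_mult_right integrable_comp_B_mult integrable_defect)
  finally show "(\<integral>z. (k * \<psi> (B z) + l * \<psi>' (B z)) * defect T T' f g z \<partial>disk_area) = 0" .
qed

text \<open>A factor \<open>B\<close> is absorbed into \<open>f\<close> and a factor
  \<open>cnj B\<close> into \<open>g\<close>; commutation with \<open>mult_op B\<close> carries it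
  through \<open>T\<close> and \<open>T'\<close>.\<close>

lemma annihilates_mult:
  fixes T T' :: "bergman \<Rightarrow>\<^sub>L bergman"
  assumes T: "\<And>f. T (mult_op B f) = mult_op B (T f)" and T': "\<And>f. T' (mult_op B f) = mult_op B (T' f)"
    and \<psi>: "annihilates T T' \<psi>"
  shows "annihilates T T' (\<lambda>w. w * \<psi> w)" "annihilates T T' (\<lambda>w. cnj w * \<psi> w)"
proof -
  have 1: "(\<lambda>z. B z * \<psi> (B z) * defect T T' f g z) = (\<lambda>z. \<psi> (B z) * defect T T' (mult_op B f) g z)"
    and 2: "(\<lambda>z. cnj (B z) * \<psi> (B z) * defect T T' f g z) = (\<lambda>z. \<psi> (B z) * defect T T' f (mult_op B g) z)" for f g
    unfolding defect_def T T' by (simp_all add: mult_op_B algebra_simps)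
  show "annihilates T T' (\<lambda>w. w * \<psi> w)" "annihilates T T' (\<lambda>w. cnj w * \<psi> w)"
    using \<psi> unfolding annihilates_def 1 2 by (auto intro!: continuous_intros)
qed

lemma annihilates_real_polynomial:
  fixes T T' :: "bergman \<Rightarrow>\<^sub>L bergman"
  assumes T: "\<And>f. T (mult_op B f) = mult_op B (T f)" and T': "\<And>f. T' (mult_op B f) = mult_op B (T' f)"
    and p: "real_polynomial_function p" and \<psi>: "annihilates T T' \<psi>"
  shows "annihilates T T' (\<lambda>w. of_real (p w) * \<psi> w)"
  using p \<psi>
\<comment> \<open>The product case uses the statement for one factor with the other factor times
  \<open>\<psi>\<close> in place of \<open>\<psi>\<close>.\<close>
proof (induction arbitrary: \<psi> rule: real_polynomial_function.induct)
  case (linear h)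
  \<comment> \<open>A real linear form is a combination of \<open>w\<close> and
    \<open>cnj w\<close>, the two multipliers of \<open>annihilates_mult\<close>.\<close>
  have h: "complex_of_real (h w) = complex_of_real (h 1) * ((w + cnj w) / 2) + complex_of_real (h \<i>) * ((w - cnj w) / (2 * \<i>))" for w
  proof -
    have "h w = h (Re w *\<^sub>R 1 + Im w *\<^sub>R \<i>)" by (rule arg_cong[of _ _ h]) (simp add: complex_eq_iff)
    also have "\<dots> = Re w * h 1 + Im w * h \<i>"
      using linear(1) by (simp add: linear_add linear_scale bounded_linear.linear)
    finally have "complex_of_real (h w) = of_real (Re w) * of_real (h 1) + of_real (Im w) * of_real (h \<i>)" by simp
    moreover have "of_real (Re w) = (w + cnj w) / 2" "of_real (Im w) = (w - cnj w) / (2 * \<i>)"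
      by (simp_all add: complex_eq_iff)
    ultimately show ?thesis by (simp add: mult.commute)
  qed
  have "(\<lambda>w. of_real (h w) * \<psi> w) = (\<lambda>w. (of_real (h 1) / 2 + of_real (h \<i>) / (2 * \<i>)) * (w * \<psi> w)
      + (of_real (h 1) / 2 - of_real (h \<i>) / (2 * \<i>)) * (cnj w * \<psi> w))"
  proof
    fix w
    show "of_real (h w) * \<psi> w = (of_real (h 1) / 2 + of_real (h \<i>) / (2 * \<i>)) * (w * \<psi> w)
      + (of_real (h 1) / 2 - of_real (h \<i>) / (2 * \<i>)) * (cnj w * \<psi> w)"
      unfolding h[of w] by (simp add: field_simps)
  qed
  then show ?case
    using annihilates_lincomb[OF annihilates_mult[OF T T' linear(2)]] by simp
next
  case (const k)
  then show ?case using annihilates_lincomb[OF const const, of "of_real k" 0] by simp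
next
  case (add f g)
  then show ?case
    using annihilates_lincomb[OF add.IH(1)[OF add.prems] add.IH(2)[OF add.prems], of 1 1]
    by (simp add: distrib_right)
next
  case (mult f g)
  then show ?case using mult.IH(1)[OF mult.IH(2)[OF mult.prems]] by (simp add: mult.assoc)
qed

text \<open>Polynomials in the two real coordinates approximate \<open>\<phi>\<close> uniformly on
  the closed disk, which contains the values of \<open>B\<close> on the disk; the error is at most
  \<open>e\<close> times the integral \<open>M\<close> of the modulus of the defect.\<close>

lemma integral_comp_B_defect_eq_0:
  fixes T T' :: "bergman \<Rightarrow>\<^sub>L bergman"
  assumes T: "\<And>f. T (mult_op B f) = mult_op B (T f)" and T': "\<And>f. T' (mult_op B f) = mult_op B (T' f)"
    and adj: "\<And>f g. cinner (T f) g = cinner f (T' g)"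
    and \<phi>: "continuous_on UNIV (\<phi> :: complex \<Rightarrow> real)"
  shows "(\<integral>z. of_real (\<phi> (B z)) * defect T T' f g z \<partial>disk_area) = 0"
proof -
  let ?H = "defect T T' f g"
  let ?I = "\<lambda>q. \<integral>z. complex_of_real (q (B z)) * ?H z \<partial>disk_area"
  have one: "annihilates T T' (\<lambda>_. 1)"
    using adj unfolding annihilates_def defect_def cinner_def
    by (auto simp: bergman_functions_integrable bergman_fun_in)
  define M where "M = (\<integral>z. norm (?H z) \<partial>disk_area)"
  have intH: "integrable disk_area (\<lambda>z. norm (?H z))" by (rule integrable_norm[OF integrable_defect])
  have le: "norm (?I \<phi>) \<le> e * M" if e: "e > 0" for e
  proof -
    obtain p where p: "real_polynomial_function p" "\<And>x. x \<in> cball 0 1 \<Longrightarrow> \<bar>\<phi> x - p x\<bar> < e"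
      using Stone_Weierstrass_real_polynomial_function[OF compact_cball continuous_on_subset[OF \<phi> subset_UNIV] e]
      by blast
    have pc: "continuous_on UNIV p"
      by (intro continuous_at_imp_continuous_on ballI continuous_real_polymonial_function p(1))
    have "?I p = 0"
      using annihilates_real_polynomial[OF T T' p(1) one] by (simp add: annihilates_def)
    have i: "integrable disk_area (\<lambda>z. complex_of_real (q (B z)) * ?H z)" if "continuous_on UNIV q" for q
      using integrable_comp_B_mult[of "\<lambda>w. complex_of_real (q w)", OF _ integrable_defect] that
      by (simp add: continuous_on_of_real)
    have "?I \<phi> = ?I \<phi> - ?I p" using \<open>?I p = 0\<close> by simp
    also have "\<dots> = (\<integral>z. complex_of_real (\<phi> (B z)) * ?H z - complex_of_real (p (B z)) * ?H z \<partial>disk_area)"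
      by (intro Bochner_Integration.integral_diff[symmetric] i \<phi> pc)
    finally have "norm (?I \<phi>) \<le> (\<integral>z. norm (complex_of_real (\<phi> (B z)) * ?H z - complex_of_real (p (B z)) * ?H z) \<partial>disk_area)"
      by (simp only: integral_norm_bound)
    also have "\<dots> \<le> (\<integral>z. e * norm (?H z) \<partial>disk_area)"
    proof (rule integral_mono_AE)
      show "integrable disk_area (\<lambda>z. norm (complex_of_real (\<phi> (B z)) * ?H z - complex_of_real (p (B z)) * ?H z))"
        by (intro integrable_norm Bochner_Integration.integrable_diff i \<phi> pc)
      show "integrable disk_area (\<lambda>z. e * norm (?H z))" using intH by simp
      show "AE z in disk_area. norm (complex_of_real (\<phi> (B z)) * ?H z - complex_of_real (p (B z)) * ?H z) \<le> e * norm (?H z)"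
        using AE_disk_area
      proof eventually_elim
        case (elim z)
        have "\<bar>\<phi> (B z) - p (B z)\<bar> \<le> e" using norm_B_less_1[OF elim] by (intro less_imp_le p(2)) simp
        then have "\<bar>\<phi> (B z) - p (B z)\<bar> * norm (?H z) \<le> e * norm (?H z)" by (rule mult_right_mono) simp
        moreover have "norm (complex_of_real (\<phi> (B z)) * ?H z - complex_of_real (p (B z)) * ?H z) = \<bar>\<phi> (B z) - p (B z)\<bar> * norm (?H z)"
          by (simp add: left_diff_distrib[symmetric] norm_mult flip: of_real_diff)
        ultimately show ?case by simp
      qed
    qed
    finally show ?thesis by (simp add: M_def)
  qed
  have "norm (?I \<phi>) \<le> 0"
  proof (rule field_le_epsilon)
    fix e :: real assume e: "e > 0"
    have M: "M \<ge> 0" unfolding M_def by (intro integral_nonneg_AE) simp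
    have "norm (?I \<phi>) \<le> e / (M + 1) * M" using e M by (intro le) simp
    also have "\<dots> \<le> e" using e M by (simp add: field_simps)
    finally show "norm (?I \<phi>) \<le> 0 + e" by simp
  qed
  then show ?thesis by simp
qed

lemma integral_ball_comp_B_defect_eq_0:
  fixes T T' :: "bergman \<Rightarrow>\<^sub>L bergman"
  assumes T: "\<And>f. T (mult_op B f) = mult_op B (T f)" and T': "\<And>f. T' (mult_op B f) = mult_op B (T' f)"
    and adj: "\<And>f g. cinner (T f) g = cinner f (T' g)"
  shows "(\<integral>z. indicator (ball w0 e) (B z) *\<^sub>R defect T T' f g z \<partial>disk_area) = 0"
proof -
  let ?H = "defect T T' f g"
  \<comment> \<open>Continuous cut-offs with values in \<open>[0, 1]\<close> that converge pointwise
    to the indicator of the open ball, so that dominated convergence applies.\<close>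
  define \<phi> where "\<phi> m w = min 1 (real m * max 0 (e - dist w0 w))" for m w
  have cont: "continuous_on UNIV (\<phi> m)" for m
    unfolding \<phi>_def by (intro continuous_intros)
  have lim: "(\<lambda>m. \<phi> m w) \<longlonglongrightarrow> indicator (ball w0 e) w" for w
  proof (cases "dist w0 w < e")
    case True
    obtain k :: nat where k: "real k * (e - dist w0 w) \<ge> 1"
      using reals_Archimedean3[of "e - dist w0 w"] True by (metis diff_gt_0_iff_gt less_imp_le)
    have "\<phi> m w = 1" if "m \<ge> k" for m
    proof -
      have "real k * (e - dist w0 w) \<le> real m * (e - dist w0 w)" using that True by (intro mult_right_mono) auto
      then have "1 \<le> real m * (e - dist w0 w)" using k by linarith
      then show ?thesis using True by (simp add: \<phi>_def min_absorb1)
    qed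
    then have "\<forall>\<^sub>F m in sequentially. \<phi> m w = indicator (ball w0 e) w"
      using True by (intro eventually_sequentiallyI[of k]) simp
    then show ?thesis by (rule tendsto_eventually)
  next
    case False
    then show ?thesis by (simp add: \<phi>_def)
  qed
  have bd: "\<bar>\<phi> m w\<bar> \<le> 1" for m w by (simp add: \<phi>_def)
  have mH: "?H \<in> borel_measurable disk_area" by (rule borel_measurable_integrable[OF integrable_defect])
  have "(\<lambda>m. \<integral>z. \<phi> m (B z) *\<^sub>R ?H z \<partial>disk_area) \<longlonglongrightarrow> (\<integral>z. indicator (ball w0 e) (B z) *\<^sub>R ?H z \<partial>disk_area)"
  proof (rule integral_dominated_convergence[where w = "\<lambda>z. norm (?H z)"])
    show "(\<lambda>z. \<phi> m (B z) *\<^sub>R ?H z) \<in> borel_measurable disk_area" for m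
    proof -
      have [measurable]: "\<phi> m \<in> borel_measurable borel" by (rule borel_measurable_continuous_onI[OF cont])
      have "(\<lambda>z. \<phi> m (B z)) \<in> borel_measurable disk_area" by measurable
      then show ?thesis using mH by (rule borel_measurable_scaleR)
    qed
    show "(\<lambda>z. indicator (ball w0 e) (B z) *\<^sub>R ?H z) \<in> borel_measurable disk_area"
    proof -
      have [measurable]: "(indicator (ball w0 e) :: complex \<Rightarrow> real) \<in> borel_measurable borel"
        by (intro borel_measurable_indicator) auto
      have "(\<lambda>z. indicator (ball w0 e) (B z) :: real) \<in> borel_measurable disk_area" by measurable
      then show ?thesis using mH by (rule borel_measurable_scaleR)
    qed
    show "AE z in disk_area. (\<lambda>m. \<phi> m (B z) *\<^sub>R ?H z) \<longlonglongrightarrow> indicator (ball w0 e) (B z) *\<^sub>R ?H z"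
      by (intro AE_I2 tendsto_intros lim)
    show "AE z in disk_area. norm (\<phi> m (B z) *\<^sub>R ?H z) \<le> norm (?H z)" for m
      using bd by (intro AE_I2) (simp add: mult_left_le_one_le)
  qed (rule integrable_norm[OF integrable_defect])
  moreover have "(\<integral>z. \<phi> m (B z) *\<^sub>R ?H z \<partial>disk_area) = 0" for m
    unfolding scaleR_conv_of_real by (rule integral_comp_B_defect_eq_0[OF T T' adj cont])
  ultimately show ?thesis by (simp add: LIMSEQ_const_iff)
qed

text \<open>The preimage of a small disk of radius \<open>\<epsilon>\<close> lies between the disks of radius
  \<open>\<epsilon> / (\<bar>B' y\<bar> \<plusminus> \<eta>)\<close> around \<open>y\<close>.\<close>

lemma integral_preimage_density:
  fixes H :: "complex \<Rightarrow> complex"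
  assumes br: "branches w0 e u r" and y: "y \<in> fiber w0"
    and H: "integrable disk_area H" "isCont H y"
  shows "((\<lambda>\<epsilon>. (\<integral>z. indicator {z \<in> ball y r. B z \<in> ball w0 \<epsilon>} z *\<^sub>R H z \<partial>disk_area) / of_real (\<epsilon>\<^sup>2))
    \<longlongrightarrow> H y / of_real ((norm (deriv B y))\<^sup>2)) (at_right 0)"
proof -
  define b where "b = norm (deriv B y)"
  define A where "A \<epsilon> = {z \<in> ball y r. B z \<in> ball w0 \<epsilon>}" for \<epsilon>
  have yD: "y \<in> unit_disk" and By: "B y = w0" using y by (auto simp: fiber_def)
  have e: "e > 0" "r > 0" using branchesD(1,2)[OF br] by auto
  have "y \<in> D0" unfolding D0_iff using yD branchesD(3)[OF br, of w0] e By by auto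
  then have b: "b > 0" using D0_deriv by (simp add: b_def)
  have sub: "ball y r \<subseteq> unit_disk" by (rule branchesD(8)[OF br y])
  have A_sets: "A \<epsilon> \<in> sets borel" for \<epsilon>
  proof -
    have "A \<epsilon> = ball y r \<inter> B -` ball w0 \<epsilon>" by (auto simp: A_def)
    moreover have "open (ball y r \<inter> B -` ball w0 \<epsilon>)"
      by (intro continuous_open_preimage continuous_on_subset[OF B_continuous]) (use sub in auto)
    ultimately show ?thesis by simp
  qed
  have sandwich: "\<forall>\<^sub>F \<epsilon> in at_right 0. ball y (\<epsilon> / (b + \<eta>)) \<subseteq> A \<epsilon> \<and> A \<epsilon> \<subseteq> ball y (\<epsilon> / (b - \<eta>))
      \<and> ball y (\<epsilon> / (b - \<eta>)) \<subseteq> unit_disk \<and> A \<epsilon> \<subseteq> ball y s" if \<eta>: "0 < \<eta>" "\<eta> < b" and s: "s > 0" for \<eta> s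
  proof -
    have "(B has_derivative (\<lambda>h. deriv B y * h)) (at y)"
      using B_has_derivative[OF yD] by (simp add: has_field_derivative_def)
    then obtain s1 where s1: "s1 > 0" "\<And>z. norm (z - y) < s1 \<Longrightarrow> norm (B z - B y - deriv B y * (z - y)) \<le> \<eta> * norm (z - y)"
      using \<eta> unfolding has_derivative_at_alt by meson
    define s2 where "s2 = min (min s1 s) (min r (1 - norm y))"
    have s2: "s2 > 0" "s2 \<le> s1" "s2 \<le> s" "s2 \<le> r" using s1 s e yD by (auto simp: s2_def)
    have est: "(b - \<eta>) * norm (z - y) \<le> norm (B z - w0)" "norm (B z - w0) \<le> (b + \<eta>) * norm (z - y)" if "norm (z - y) < s1" for z
    proof -
      have "norm (deriv B y * (z - y)) = b * norm (z - y)" by (simp add: b_def norm_mult)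
      moreover have "norm (B z - w0 - deriv B y * (z - y)) \<le> \<eta> * norm (z - y)" using s1(2)[OF that] By by simp
      ultimately show "(b - \<eta>) * norm (z - y) \<le> norm (B z - w0)" "norm (B z - w0) \<le> (b + \<eta>) * norm (z - y)"
        using norm_triangle_ineq2[of "deriv B y * (z - y)" "B z - w0"] norm_triangle_ineq2[of "B z - w0" "deriv B y * (z - y)"]
        by (simp_all add: norm_minus_commute algebra_simps)
    qed
    have "isCont (u y) w0"
      using e(1) by (intro field_differentiable_imp_continuous_at holomorphic_on_imp_differentiable_at[OF branchesD(4)[OF br y]]) auto
    then obtain e1 where e1: "e1 > 0" "\<And>w. dist w w0 < e1 \<Longrightarrow> dist (u y w) (u y w0) < s2"
      using s2(1) unfolding continuous_at_eps_delta by metis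
    \<comment> \<open>\<open>e\<close> keeps \<open>B z\<close> in the domain of the sheet
      \<open>u y\<close>, and \<open>e1\<close> then brings \<open>z\<close> within
      \<open>s2\<close> of \<open>y\<close>. \<open>s2 * b\<close> keeps the inner disk within
      \<open>s2\<close>, where the linear approximation holds, and \<open>s2 * (b - \<eta>)\<close>
      keeps the outer disk inside \<open>ball y r\<close>.\<close>
    define e2 where "e2 = min (min e e1) (min (s2 * (b - \<eta>)) (s2 * b))"
    have "e2 > 0" using e e1 s2 \<eta> b by (simp add: e2_def)
    then have "\<forall>\<^sub>F \<epsilon> in at_right (0::real). 0 < \<epsilon> \<and> \<epsilon> < e2"
      unfolding eventually_at_right_field by blast
    then show ?thesis
    proof eventually_elim
      case (elim \<epsilon>)
      have \<epsilon>: "0 < \<epsilon>" "\<epsilon> < e" "\<epsilon> < e1" "\<epsilon> < s2 * (b - \<eta>)" "\<epsilon> < s2 * b" using elim by (auto simp: e2_def)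
      have As2: "norm (z - y) < s2" if z: "z \<in> A \<epsilon>" for z
      proof -
        have "B z \<in> ball w0 e" using z \<epsilon>(2) by (auto simp: A_def)
        then have "u y (B z) = z" using z by (intro branchesD(11)[OF br y]) (auto simp: A_def)
        moreover have "dist (u y (B z)) (u y w0) < s2" using z \<epsilon>(3) by (intro e1(2)) (auto simp: A_def dist_commute)
        ultimately show ?thesis using branchesD(5)[OF br y] by (simp add: dist_norm)
      qed
      have "ball y (\<epsilon> / (b + \<eta>)) \<subseteq> A \<epsilon>"
      proof
        fix z assume "z \<in> ball y (\<epsilon> / (b + \<eta>))"
        then have zn: "norm (z - y) * (b + \<eta>) < \<epsilon>" using b \<eta> by (simp add: dist_norm norm_minus_commute field_simps)
        have "norm (z - y) * b \<le> norm (z - y) * (b + \<eta>)" using \<eta> by (intro mult_left_mono) auto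
        then have "norm (z - y) * b < s2 * b" using zn \<epsilon>(5) by linarith
        then have n: "norm (z - y) < s2" using b by simp
        then have "norm (B z - w0) < \<epsilon>" using est(2)[of z] s2(2) zn by (simp add: mult.commute)
        then show "z \<in> A \<epsilon>" using n s2(4) by (simp add: A_def dist_norm norm_minus_commute)
      qed
      moreover have "A \<epsilon> \<subseteq> ball y (\<epsilon> / (b - \<eta>))"
      proof
        fix z assume z: "z \<in> A \<epsilon>"
        have "norm (B z - w0) < \<epsilon>" using z by (simp add: A_def dist_norm norm_minus_commute)
        moreover have "norm (z - y) < s1" using As2[OF z] s2(2) by linarith
        ultimately have "(b - \<eta>) * norm (z - y) < \<epsilon>" using est(1)[of z] by linarith
        then show "z \<in> ball y (\<epsilon> / (b - \<eta>))" using \<eta> by (simp add: dist_norm norm_minus_commute field_simps)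
      qed
      moreover have "ball y (\<epsilon> / (b - \<eta>)) \<subseteq> unit_disk"
      proof -
        have "s2 * (b - \<eta>) \<le> r * (b - \<eta>)" using s2(4) \<eta> by (intro mult_right_mono) auto
        then have "\<epsilon> \<le> r * (b - \<eta>)" using \<epsilon>(4) by linarith
        then have "\<epsilon> / (b - \<eta>) \<le> r" using \<eta> by (simp add: pos_divide_le_eq)
        then show ?thesis using sub subset_ball by blast
      qed
      moreover have "A \<epsilon> \<subseteq> ball y s"
        using As2 s2(3) by (force simp: dist_norm norm_minus_commute)
      ultimately show ?case by blast
    qed
  qed
  \<comment> \<open>The two disks squeeze this ratio, which therefore tends to
    \<open>1 / b\<^sup>2\<close>, the inverse of the factor by which \<open>B\<close> scales area at
    \<open>y\<close>.\<close>
  define m where "m \<epsilon> = measure disk_area (A \<epsilon>) / \<epsilon>\<^sup>2" for \<epsilon>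
  have m_bounds: "\<forall>\<^sub>F \<epsilon> in at_right 0. 1 / (b + \<eta>)\<^sup>2 \<le> m \<epsilon> \<and> m \<epsilon> \<le> 1 / (b - \<eta>)\<^sup>2 \<and> A \<epsilon> \<subseteq> ball y s"
    if \<eta>: "0 < \<eta>" "\<eta> < b" and s: "s > 0" for \<eta> s
    using sandwich[OF that] eventually_at_right_less[of 0]
  proof eventually_elim
    case (elim \<epsilon>)
    have "(\<epsilon> / (b + \<eta>))\<^sup>2 = measure disk_area (ball y (\<epsilon> / (b + \<eta>)))"
      using elim b \<eta> by (intro measure_disk_area_ball[symmetric]) auto
    also have "\<dots> \<le> measure disk_area (A \<epsilon>)"
      using elim A_sets by (intro disk_area.finite_measure_mono) auto
    finally have 1: "(\<epsilon> / (b + \<eta>))\<^sup>2 \<le> measure disk_area (A \<epsilon>)" .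
    have "measure disk_area (A \<epsilon>) \<le> measure disk_area (ball y (\<epsilon> / (b - \<eta>)))"
      using elim by (intro disk_area.finite_measure_mono) auto
    also have "\<dots> = (\<epsilon> / (b - \<eta>))\<^sup>2"
      using elim b \<eta> by (intro measure_disk_area_ball) auto
    finally have 2: "measure disk_area (A \<epsilon>) \<le> (\<epsilon> / (b - \<eta>))\<^sup>2" .
    show ?case using 1 2 elim by (simp add: m_def power_divide field_simps)
  qed
  have m_lim: "(m \<longlongrightarrow> 1 / b\<^sup>2) (at_right 0)"
  proof (rule tendstoI)
    fix \<tau> :: real assume \<tau>: "\<tau> > 0"
    have "((\<lambda>\<eta>. 1 / (b + \<eta>)\<^sup>2) \<longlongrightarrow> 1 / (b + 0)\<^sup>2) (at_right 0)" "((\<lambda>\<eta>. 1 / (b - \<eta>)\<^sup>2) \<longlongrightarrow> 1 / (b - 0)\<^sup>2) (at_right 0)"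
      using b by (intro tendsto_intros; simp)+
    then have "\<forall>\<^sub>F \<eta> in at_right 0. dist (1 / (b + \<eta>)\<^sup>2) (1 / b\<^sup>2) < \<tau>" "\<forall>\<^sub>F \<eta> in at_right 0. dist (1 / (b - \<eta>)\<^sup>2) (1 / b\<^sup>2) < \<tau>"
      using \<tau> by (auto dest: tendstoD)
    moreover have "\<forall>\<^sub>F \<eta> in at_right (0::real). 0 < \<eta> \<and> \<eta> < b"
      unfolding eventually_at_right_field using b by blast
    ultimately have "\<forall>\<^sub>F \<eta> in at_right 0. dist (1 / (b + \<eta>)\<^sup>2) (1 / b\<^sup>2) < \<tau> \<and> dist (1 / (b - \<eta>)\<^sup>2) (1 / b\<^sup>2) < \<tau> \<and> 0 < \<eta> \<and> \<eta> < b"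
      by eventually_elim simp
    then obtain \<eta> where \<eta>: "dist (1 / (b + \<eta>)\<^sup>2) (1 / b\<^sup>2) < \<tau>" "dist (1 / (b - \<eta>)\<^sup>2) (1 / b\<^sup>2) < \<tau>" "0 < \<eta>" "\<eta> < b"
      using eventually_happens[of _ "at_right (0::real)"] by auto
    show "\<forall>\<^sub>F \<epsilon> in at_right 0. dist (m \<epsilon>) (1 / b\<^sup>2) < \<tau>"
      using m_bounds[OF \<eta>(3,4) zero_less_one]
    proof eventually_elim
      case (elim \<epsilon>)
      then show ?case using \<eta>(1,2) unfolding dist_real_def by linarith
    qed
  qed
  define I where "I \<epsilon> = (\<integral>z. indicator (A \<epsilon>) z *\<^sub>R H z \<partial>disk_area) / of_real (\<epsilon>\<^sup>2)" for \<epsilon>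
  have diff: "((\<lambda>\<epsilon>. I \<epsilon> - H y * of_real (m \<epsilon>)) \<longlongrightarrow> 0) (at_right 0)"
  proof (rule tendstoI)
    fix \<tau> :: real assume \<tau>: "\<tau> > 0"
    \<comment> \<open>Any value strictly between 0 and \<open>b\<close> would do: it supplies an
      upper bound \<open>K\<close> for \<open>m\<close>, and continuity of \<open>H\<close> at
      \<open>y\<close> does the rest.\<close>
    define \<eta> where "\<eta> = b / 2"
    have \<eta>: "0 < \<eta>" "\<eta> < b" using b by (auto simp: \<eta>_def)
    define K where "K = 1 / (b - \<eta>)\<^sup>2"
    have K: "K > 0" using \<eta> by (simp add: K_def)
    obtain s where s: "s > 0" "\<And>z. dist z y < s \<Longrightarrow> dist (H z) (H y) < \<tau> / (2 * K)"
      using H(2) \<tau> K unfolding continuous_at_eps_delta by (metis divide_pos_pos mult_pos_pos zero_less_numeral)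
    show "\<forall>\<^sub>F \<epsilon> in at_right 0. dist (I \<epsilon> - H y * of_real (m \<epsilon>)) 0 < \<tau>"
      using m_bounds[OF \<eta> s(1)] eventually_at_right_less[of 0]
    proof eventually_elim
      case (elim \<epsilon>)
      have iA: "integrable disk_area (\<lambda>z. indicator (A \<epsilon>) z *\<^sub>R k)" for k :: complex
        using A_sets by (intro integrable_scaleR_left) (simp add: disk_area.emeasure_eq_measure del: emeasure_uniform_measure)
      have iH: "integrable disk_area (\<lambda>z. indicator (A \<epsilon>) z *\<^sub>R H z)"
        using H(1) A_sets by (intro integrable_mult_indicator) auto
      have "(\<integral>z. indicator (A \<epsilon>) z *\<^sub>R H z \<partial>disk_area) - H y * of_real (measure disk_area (A \<epsilon>))
          = (\<integral>z. indicator (A \<epsilon>) z *\<^sub>R H z \<partial>disk_area) - (\<integral>z. indicator (A \<epsilon>) z *\<^sub>R H y \<partial>disk_area)"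
        using A_sets by (simp add: scaleR_conv_of_real disk_area.emeasure_eq_measure mult.commute del: emeasure_uniform_measure)
      also have "\<dots> = (\<integral>z. indicator (A \<epsilon>) z *\<^sub>R H z - indicator (A \<epsilon>) z *\<^sub>R H y \<partial>disk_area)"
        by (rule Bochner_Integration.integral_diff[symmetric, OF iH iA])
      finally have "norm ((\<integral>z. indicator (A \<epsilon>) z *\<^sub>R H z \<partial>disk_area) - H y * of_real (measure disk_area (A \<epsilon>)))
          \<le> (\<integral>z. norm (indicator (A \<epsilon>) z *\<^sub>R H z - indicator (A \<epsilon>) z *\<^sub>R H y) \<partial>disk_area)"
        by (simp only: integral_norm_bound)
      also have "\<dots> \<le> (\<integral>z. indicator (A \<epsilon>) z *\<^sub>R (\<tau> / (2 * K)) \<partial>disk_area)"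
      proof (rule integral_mono)
        show "integrable disk_area (\<lambda>z. norm (indicator (A \<epsilon>) z *\<^sub>R H z - indicator (A \<epsilon>) z *\<^sub>R H y))"
          by (intro integrable_norm Bochner_Integration.integrable_diff iH iA)
        show "integrable disk_area (\<lambda>z. indicator (A \<epsilon>) z *\<^sub>R (\<tau> / (2 * K)))"
          using A_sets by (intro integrable_scaleR_left) (simp add: disk_area.emeasure_eq_measure del: emeasure_uniform_measure)
        show "norm (indicator (A \<epsilon>) z *\<^sub>R H z - indicator (A \<epsilon>) z *\<^sub>R H y) \<le> indicator (A \<epsilon>) z *\<^sub>R (\<tau> / (2 * K))" for z
        proof (cases "z \<in> A \<epsilon>")
          case True
          then have "dist (H z) (H y) < \<tau> / (2 * K)" using elim by (intro s(2)) (auto simp: dist_commute)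
          then show ?thesis using True by (simp add: dist_norm)
        qed simp
      qed
      also have "\<dots> = measure disk_area (A \<epsilon>) * (\<tau> / (2 * K))"
        using A_sets by (simp add: disk_area.emeasure_eq_measure del: emeasure_uniform_measure)
      finally have "norm ((\<integral>z. indicator (A \<epsilon>) z *\<^sub>R H z \<partial>disk_area) - H y * of_real (measure disk_area (A \<epsilon>))) / \<epsilon>\<^sup>2
          \<le> measure disk_area (A \<epsilon>) * (\<tau> / (2 * K)) / \<epsilon>\<^sup>2"
        by (rule divide_right_mono) simp
      also have "\<dots> = m \<epsilon> * (\<tau> / (2 * K))" by (simp add: m_def)
      also have "\<dots> \<le> K * (\<tau> / (2 * K))" using elim \<tau> K by (intro mult_right_mono) (auto simp: K_def)
      also have "\<dots> < \<tau>" using \<tau> K by simp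
      finally have "norm (((\<integral>z. indicator (A \<epsilon>) z *\<^sub>R H z \<partial>disk_area) - H y * of_real (measure disk_area (A \<epsilon>))) / of_real (\<epsilon>\<^sup>2)) < \<tau>"
        by (simp add: norm_divide norm_power)
      then show ?case by (simp add: I_def m_def diff_divide_distrib)
    qed
  qed
  have "((\<lambda>\<epsilon>. (I \<epsilon> - H y * of_real (m \<epsilon>)) + H y * of_real (m \<epsilon>)) \<longlongrightarrow> 0 + H y * of_real (1 / b\<^sup>2)) (at_right 0)"
    by (intro tendsto_intros diff m_lim)
  then show ?thesis by (simp add: I_def A_def b_def)
qed

text \<open>The preimage of a small disk around \<open>B x\<close> consists of one piece near each
  point of the fiber. The integrals of the defect over the pieces add up to 0, and division by
  \<open>\<epsilon>\<^sup>2\<close> turns them into densities in the limit.\<close>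

theorem sum_defect_fiber_eq_0:
  fixes T T' :: "bergman \<Rightarrow>\<^sub>L bergman"
  assumes T: "\<And>f. T (mult_op B f) = mult_op B (T f)" and T': "\<And>f. T' (mult_op B f) = mult_op B (T' f)"
    and adj: "\<And>f g. cinner (T f) g = cinner f (T' g)" and x: "x \<in> D0"
  shows "(\<Sum>y\<in>fiber (B x). defect T T' f g y / of_real ((norm (deriv B y))\<^sup>2)) = 0"
proof -
  obtain e u r where br: "branches (B x) e u r" using branches_at_D0[OF x] .
  let ?H = "defect T T' f g"
  let ?A = "\<lambda>\<epsilon> y. {z \<in> ball y r. B z \<in> ball (B x) \<epsilon>}"
  have cont: "isCont ?H y" if "y \<in> fiber (B x)" for y
  proof -
    have "isCont (bergman_fun h) y" for h
      using that by (intro field_differentiable_imp_continuous_at holomorphic_on_imp_differentiable_at[OF bergman_fun_holomorphic])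
        (auto simp: fiber_def)
    then show ?thesis unfolding defect_def by (intro continuous_intros) auto
  qed
  have "((\<lambda>\<epsilon>. \<Sum>y\<in>fiber (B x). (\<integral>z. indicator (?A \<epsilon> y) z *\<^sub>R ?H z \<partial>disk_area) / of_real (\<epsilon>\<^sup>2))
    \<longlongrightarrow> (\<Sum>y\<in>fiber (B x). ?H y / of_real ((norm (deriv B y))\<^sup>2))) (at_right 0)"
    by (intro tendsto_sum integral_preimage_density[OF br] integrable_defect cont)
  moreover have "\<forall>\<^sub>F \<epsilon> in at_right 0. (\<Sum>y\<in>fiber (B x). (\<integral>z. indicator (?A \<epsilon> y) z *\<^sub>R ?H z \<partial>disk_area) / of_real (\<epsilon>\<^sup>2)) = 0"
  proof -
    have "\<forall>\<^sub>F \<epsilon> in at_right (0::real). 0 < \<epsilon> \<and> \<epsilon> < e"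
      unfolding eventually_at_right_field using branchesD(1)[OF br] by blast
    then show ?thesis
    proof eventually_elim
      case (elim \<epsilon>)
      have A_sets: "?A \<epsilon> y \<in> sets borel" if "y \<in> fiber (B x)" for y
      proof -
        have "?A \<epsilon> y = ball y r \<inter> B -` ball (B x) \<epsilon>" by auto
        moreover have "open (ball y r \<inter> B -` ball (B x) \<epsilon>)"
          by (intro continuous_open_preimage continuous_on_subset[OF B_continuous])
            (use branchesD(8)[OF br that] in auto)
        ultimately show ?thesis by simp
      qed
      have ind: "(\<Sum>y\<in>fiber (B x). indicator (?A \<epsilon> y) z *\<^sub>R ?H z) = indicator (ball (B x) \<epsilon>) (B z) *\<^sub>R ?H z"
        if z: "z \<in> unit_disk" for z
      proof (cases "B z \<in> ball (B x) \<epsilon>")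
        case True
        then have Be: "B z \<in> ball (B x) e" using elim by auto
        have "z \<in> fiber (B z)" using z by (simp add: fiber_def)
        then obtain y where y: "y \<in> fiber (B x)" "z = u y (B z)" using branchesD(6)[OF br Be] by auto
        have zy: "z \<in> ball y r" using branchesD(10)[OF br y(1) Be] y(2) by simp
        have "indicator (?A \<epsilon> t) z = (if t = y then 1 else 0 :: real)" if "t \<in> fiber (B x)" for t
        proof (cases "t = y")
          case False
          then have "z \<notin> ball t r" using zy branchesD(12)[OF br that y(1)] by blast
          then show ?thesis using False by simp
        qed (use zy True in simp)
        then have "(\<Sum>t\<in>fiber (B x). indicator (?A \<epsilon> t) z *\<^sub>R ?H z) = (\<Sum>t\<in>fiber (B x). if t = y then ?H z else 0)"
          by (intro sum.cong) auto
        then show ?thesis using True y(1) by (simp add: finite_fiber)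
      qed simp
      have "(\<Sum>y\<in>fiber (B x). \<integral>z. indicator (?A \<epsilon> y) z *\<^sub>R ?H z \<partial>disk_area)
          = (\<integral>z. (\<Sum>y\<in>fiber (B x). indicator (?A \<epsilon> y) z *\<^sub>R ?H z) \<partial>disk_area)"
        using A_sets by (intro Bochner_Integration.integral_sum[symmetric] integrable_mult_indicator integrable_defect) auto
      also have "\<dots> = (\<integral>z. indicator (ball (B x) \<epsilon>) (B z) *\<^sub>R ?H z \<partial>disk_area)"
      proof (rule Bochner_Integration.integral_cong[OF refl])
        fix z
        show "(\<Sum>y\<in>fiber (B x). indicator (?A \<epsilon> y) z *\<^sub>R ?H z) = indicator (ball (B x) \<epsilon>) (B z) *\<^sub>R ?H z"
        proof (cases "z \<in> unit_disk")
          case False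
          then have "?H z = 0" by (simp add: defect_def bergman_fun_outside)
          then show ?thesis by simp
        qed (rule ind)
      qed
      also have "\<dots> = 0" by (rule integral_ball_comp_B_defect_eq_0[OF T T' adj])
      finally show ?case by (simp add: sum_divide_distrib[symmetric])
    qed
  qed
  then have "((\<lambda>\<epsilon>. \<Sum>y\<in>fiber (B x). (\<integral>z. indicator (?A \<epsilon> y) z *\<^sub>R ?H z \<partial>disk_area) / of_real (\<epsilon>\<^sup>2)) \<longlongrightarrow> 0) (at_right 0)"
    by (rule tendsto_eventually)
  ultimately show ?thesis by (rule tendsto_unique[OF trivial_limit_at_right_real])
qed

end

section \<open>Operators in the commutant\<close>

lemma bergman_fun_add: "bergman_fun (f + g) z = bergman_fun f z + bergman_fun g z"
  by (simp add: plus_bergman.rep_eq)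

lemma bergman_fun_diff: "bergman_fun (f - g) z = bergman_fun f z - bergman_fun g z"
  by (simp add: minus_bergman.rep_eq)

lemma bergman_fun_0 [simp]: "bergman_fun 0 z = 0"
  by (simp add: zero_bergman.rep_eq)

lemma bergman_fun_sum: "bergman_fun (\<Sum>i\<in>I. f i) z = (\<Sum>i\<in>I. bergman_fun (f i) z)"
  by (induction I rule: infinite_finite_induct) (simp_all add: bergman_fun_add)

lemma bergman_of_lincomb:
  assumes "f holomorphic_on UNIV" "g holomorphic_on UNIV"
  shows "bergman_of (\<lambda>z. f z - k * g z) = bergman_of f - cscale k (bergman_of g)"
proof (rule bergman_eqI)
  fix z assume z: "z \<in> unit_disk"
  have "(\<lambda>z. f z - k * g z) holomorphic_on UNIV" using assms by (intro holomorphic_intros)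
  then show "bergman_fun (bergman_of (\<lambda>z. f z - k * g z)) z = bergman_fun (bergman_of f - cscale k (bergman_of g)) z"
    using assms z by (simp add: bergman_of_polynomial bergman_fun_diff cscale.rep_eq)
qed

text \<open>The derivative is both complex linear and antilinear; comparison at \<open>1\<close> and
  \<open>\<i>\<close> shows that it is 0.\<close>

lemma holomorphic_eq_cnj_holomorphic_imp_constant:
  assumes S: "open S" "connected S" and h: "h holomorphic_on S" "k holomorphic_on S"
    and eq: "\<And>z. z \<in> S \<Longrightarrow> h z = cnj (k z)"
  shows "h constant_on S"
proof (rule has_field_derivative_0_imp_constant_on[OF _ S(2,1)])
  fix z assume z: "z \<in> S"
  have dh: "(h has_field_derivative deriv h z) (at z)" and dk: "(k has_field_derivative deriv k z) (at z)"
    using holomorphic_derivI[OF h(1) S(1) z] holomorphic_derivI[OF h(2) S(1) z] .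
  have "((\<lambda>z. cnj (k z)) has_derivative (\<lambda>v. cnj (deriv k z * v))) (at z)"
    using dk unfolding has_field_derivative_def by (rule has_derivative_cnj)
  then have "(h has_derivative (\<lambda>v. cnj (deriv k z * v))) (at z)"
    by (rule has_derivative_transform_within_open[OF _ S(1) z]) (simp add: eq)
  then have e: "(\<lambda>v. deriv h z * v) = (\<lambda>v. cnj (deriv k z * v))"
    using dh unfolding has_field_derivative_def by (rule has_derivative_unique[rotated])
  have "deriv h z = cnj (deriv k z)" using fun_cong[OF e, of 1] by simp
  moreover have "deriv h z * \<i> = - cnj (deriv k z) * \<i>" using fun_cong[OF e, of \<i>] by simp
  then have "deriv h z = - cnj (deriv k z)" by (metis complex_i_not_zero mult_right_cancel)
  ultimately have "deriv h z = 0" by simp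
  then show "(h has_field_derivative 0) (at z)" using dh by simp
qed

context blaschke
begin

text \<open>The points of the fiber are simple zeros of \<open>B - B x\<close>, so the quotient has
  removable singularities there; near the circle \<open>B - B x\<close> is bounded away from 0, so
  the quotient stays square integrable.\<close>

lemma bergman_division:
  assumes x: "x \<in> D0" and f: "\<And>y. y \<in> fiber (B x) \<Longrightarrow> bergman_fun f y = 0"
  obtains g where "f = mult_op B g - cscale (B x) g"
proof -
  let ?F = "bergman_fun f"
  define w where "w = B x"
  define q where "q z = ?F z / (B z - w)" for z
  have "\<exists>g. g holomorphic_on unit_disk \<and> (\<forall>z\<in>unit_disk - fiber w. g z = q z)"
  proof (rule removable_singularities[OF finite_fiber])
    show "q holomorphic_on unit_disk - fiber w"
      unfolding q_def
      by (intro holomorphic_intros holomorphic_on_subset[OF bergman_fun_holomorphic] holomorphic_on_subset[OF B_holomorphic_disk])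
        (auto simp: fiber_def)
    fix y assume y: "y \<in> fiber w"
    have yD: "y \<in> unit_disk" "B y = w" using y by (auto simp: fiber_def)
    have "y \<in> D0" using D0_transfer[OF x] y by (simp add: w_def)
    then have d: "deriv B y \<noteq> 0" by (rule D0_deriv)
    have "(?F has_field_derivative deriv ?F y) (at y)"
      by (rule holomorphic_derivI[OF bergman_fun_holomorphic open_ball yD(1)])
    then have "((\<lambda>z. (?F z - ?F y) / (z - y)) \<longlongrightarrow> deriv ?F y) (at y)"
      by (simp add: has_field_derivative_iff)
    moreover have "((\<lambda>z. (B z - B y) / (z - y)) \<longlongrightarrow> deriv B y) (at y)"
      using B_has_derivative[OF yD(1)] by (simp add: has_field_derivative_iff)
    ultimately have "((\<lambda>z. ((?F z - ?F y) / (z - y)) / ((B z - B y) / (z - y))) \<longlongrightarrow> deriv ?F y / deriv B y) (at y)"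
      using d by (intro tendsto_divide)
    then have "((\<lambda>z. norm (((?F z - ?F y) / (z - y)) / ((B z - B y) / (z - y)))) \<longlongrightarrow> norm (deriv ?F y / deriv B y)) (at y)"
      by (rule tendsto_norm)
    then have "\<forall>\<^sub>F z in at y. norm (((?F z - ?F y) / (z - y)) / ((B z - B y) / (z - y))) < norm (deriv ?F y / deriv B y) + 1"
      by (rule order_tendstoD) simp
    moreover have "\<forall>\<^sub>F z in at y. z \<noteq> y" by (simp add: eventually_at_filter)
    ultimately have "\<forall>\<^sub>F z in at y. norm (q z) \<le> (norm (deriv ?F y / deriv B y) + 1) * norm (1::complex)"
      by eventually_elim (use f[of y] y yD in \<open>simp add: q_def w_def\<close>)
    then show "q \<in> O[at y](\<lambda>_. 1)" by (rule bigoI)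
  qed (auto simp: fiber_def)
  then obtain g0 where g0: "g0 holomorphic_on unit_disk" "\<And>z. z \<in> unit_disk - fiber w \<Longrightarrow> g0 z = q z" by blast
  have F: "?F z = (B z - w) * g0 z" if "z \<in> unit_disk" for z
    using that g0(2)[of z] f[of z] by (cases "z \<in> fiber w") (auto simp: fiber_def q_def w_def)
  have nw: "norm w < 1" using norm_B_less_1[of x] x by (simp add: w_def)
  \<comment> \<open>A level between \<open>norm w\<close> and 1: the set \<open>K\<close> where
    \<open>B\<close> has modulus at most \<open>s\<close> is compact in the open disk, so
    \<open>g0\<close> is bounded on it, and off \<open>K\<close> the modulus of
    \<open>B z - w\<close> is at least \<open>s - norm w\<close>.\<close>
  define s where "s = (1 + norm w) / 2"
  have s: "norm w < s" "s < 1" using nw by (auto simp: s_def)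
  define K where "K = cball 0 1 \<inter> B -` cball 0 s"
  have "compact K"
    unfolding K_def compact_eq_bounded_closed
    by (intro conjI bounded_Int continuous_closed_preimage B_continuous) auto
  moreover have "K \<subseteq> unit_disk"
  proof
    fix z assume "z \<in> K"
    then have z: "norm z \<le> 1" "norm (B z) \<le> s" by (auto simp: K_def)
    then have "norm z \<noteq> 1" using norm_B_eq_1[of z] s(2) by auto
    then show "z \<in> unit_disk" using z(1) by simp
  qed
  ultimately have "compact (g0 ` K)"
    by (intro compact_continuous_image holomorphic_on_imp_continuous_on holomorphic_on_subset[OF g0(1)])
  then obtain M where M: "\<And>z. z \<in> K \<Longrightarrow> norm (g0 z) \<le> M"
    using compact_imp_bounded[of "g0 ` K"] unfolding bounded_iff by (metis imageI)
  define g where "g z = (if z \<in> unit_disk then g0 z else 0)" for z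
  have ghol: "g holomorphic_on unit_disk"
    using g0(1) by (rule holomorphic_transform) (simp add: g_def)
  have gmeas: "g \<in> borel_measurable borel"
  proof -
    have "(\<lambda>z. indicator unit_disk z *\<^sub>R g0 z) \<in> borel_measurable borel"
      by (intro borel_measurable_continuous_on_indicator holomorphic_on_imp_continuous_on g0) auto
    also have "(\<lambda>z. indicator unit_disk z *\<^sub>R g0 z) = g" by (auto simp: g_def indicator_def)
    finally show ?thesis .
  qed
  define k where "k = 1 / (s - norm w)"
  have bound: "norm ((norm (g z))\<^sup>2) \<le> norm (M\<^sup>2 + k\<^sup>2 * (norm (?F z))\<^sup>2)" for z
  proof (cases "z \<in> unit_disk")
    case True
    have "(norm (g z))\<^sup>2 \<le> M\<^sup>2 + k\<^sup>2 * (norm (?F z))\<^sup>2"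
    proof (cases "z \<in> K")
      case True
      then have "norm (g z) \<le> M" using M[OF True] \<open>z \<in> unit_disk\<close> by (simp add: g_def)
      then have "(norm (g z))\<^sup>2 \<le> M\<^sup>2" by (intro power_mono) auto
      then show ?thesis by (simp add: add_increasing2)
    next
      case False
      then have "norm (B z) > s" using True by (simp add: K_def)
      then have "s - norm w \<le> norm (B z - w)" using norm_triangle_ineq2[of "B z" w] by linarith
      then have "(s - norm w) * norm (g z) \<le> norm (B z - w) * norm (g z)" by (rule mult_right_mono) simp
      also have "\<dots> = norm (?F z)" using F[OF True] True by (simp add: g_def norm_mult)
      finally have "norm (g z) \<le> k * norm (?F z)" using s(1) by (simp add: k_def field_simps)
      then have "(norm (g z))\<^sup>2 \<le> (k * norm (?F z))\<^sup>2" by (intro power_mono) auto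
      then show ?thesis by (simp add: power_mult_distrib add_increasing)
    qed
    then show ?thesis by simp
  qed (simp add: g_def)
  have "integrable disk_area (\<lambda>z. (norm (g z))\<^sup>2)"
  proof (rule Bochner_Integration.integrable_bound)
    show "integrable disk_area (\<lambda>z. M\<^sup>2 + k\<^sup>2 * (norm (?F z))\<^sup>2)"
      using bergman_fun_in[of f] by (simp add: bergman_functions_def)
  qed (use gmeas bound in auto)
  then have "g \<in> bergman_functions"
    using ghol by (auto simp: bergman_functions_def g_def)
  then have G: "bergman_fun (Abs_bergman g) = g" by (rule Abs_bergman_inverse)
  have "f = mult_op B (Abs_bergman g) - cscale w (Abs_bergman g)"
    by (rule bergman_eqI) (simp add: bergman_fun_diff mult_op_B bergman_fun_cscale G F g_def algebra_simps)
  then show ?thesis using that by (simp add: w_def)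
qed

text \<open>\<open>T f\<close> is again a multiple of \<open>B - B x\<close>. Consequently the value
  of \<open>T f\<close> at \<open>x\<close> depends only on the values of \<open>f\<close> on the
  fiber of \<open>x\<close>, which makes a description of \<open>T\<close> by matrices
  possible.\<close>

lemma vanishes_on_fiber:
  fixes T :: "bergman \<Rightarrow>\<^sub>L bergman"
  assumes lin: "complex_linear T" and T: "\<And>f. T (mult_op B f) = mult_op B (T f)"
    and x: "x \<in> D0" and f: "\<And>y. y \<in> fiber (B x) \<Longrightarrow> bergman_fun f y = 0"
  shows "bergman_fun (T f) x = 0"
proof -
  obtain g where g: "f = mult_op B g - cscale (B x) g" using bergman_division[OF x f] by blast
  have "T f = mult_op B (T g) - cscale (B x) (T g)"
    by (simp add: g blinfun.diff_right T complex_linear_apply[OF lin])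
  then show ?thesis by (simp add: bergman_fun_diff mult_op_B bergman_fun_cscale)
qed

definition lagrange :: "complex set \<Rightarrow> complex \<Rightarrow> complex \<Rightarrow> complex" where
  "lagrange F y z = (\<Prod>t\<in>F - {y}. (z - t) / (y - t))"

lemma lagrange_holomorphic: "lagrange F y holomorphic_on UNIV"
  unfolding lagrange_def by (intro holomorphic_intros) auto

lemma lagrange_values: "finite F \<Longrightarrow> z \<in> F \<Longrightarrow> lagrange F y z = (if z = y then 1 else 0)"
  unfolding lagrange_def by (auto intro!: prod.neutral)

text \<open>The matrix of \<open>T\<close> with respect to the quotients
  \<open>f y / deriv B y\<close>. This normalization absorbs the weights in
  \<open>sum_defect_fiber_eq_0\<close>, so that adjoints correspond to conjugate transposes.\<close>

definition coeff_mat :: "(bergman \<Rightarrow>\<^sub>L bergman) \<Rightarrow> complex \<Rightarrow> complex \<Rightarrow> complex" where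
  "coeff_mat T x y = bergman_fun (T (bergman_of (lagrange (fiber (B x)) y))) x * deriv B y / deriv B x"

lemma bergman_lagrange:
  "y \<in> fiber w \<Longrightarrow> z \<in> fiber w \<Longrightarrow> bergman_fun (bergman_of (lagrange (fiber w) y)) z = (if z = y then 1 else 0)"
  using bergman_of_polynomial[OF lagrange_holomorphic fiberD(1)] lagrange_values[OF finite_fiber] by simp

lemma coeff_mat_expansion:
  fixes T :: "bergman \<Rightarrow>\<^sub>L bergman"
  assumes lin: "complex_linear T" and T: "\<And>f. T (mult_op B f) = mult_op B (T f)" and x: "x \<in> D0"
  shows "bergman_fun (T f) x = deriv B x * (\<Sum>y\<in>fiber (B x). coeff_mat T x y * bergman_fun f y / deriv B y)"
proof -
  let ?F = "fiber (B x)" and ?l = "\<lambda>y. bergman_of (lagrange (fiber (B x)) y)"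
  \<comment> \<open>Subtracting the Lagrange interpolant leaves a function that vanishes on the
    fiber.\<close>
  define h where "h = f - (\<Sum>y\<in>?F. cscale (bergman_fun f y) (?l y))"
  have "bergman_fun h z = 0" if z: "z \<in> ?F" for z
  proof -
    have "(\<Sum>y\<in>?F. bergman_fun f y * bergman_fun (?l y) z) = (\<Sum>y\<in>?F. if z = y then bergman_fun f y else 0)"
      using z by (intro sum.cong) (auto simp: bergman_lagrange)
    then show ?thesis
      using z by (simp add: h_def bergman_fun_diff bergman_fun_sum bergman_fun_cscale finite_fiber)
  qed
  then have "bergman_fun (T h) x = 0" by (rule vanishes_on_fiber[OF lin T x])
  then have "bergman_fun (T f) x = (\<Sum>y\<in>?F. bergman_fun f y * bergman_fun (T (?l y)) x)"
    by (simp add: h_def blinfun.diff_right blinfun.sum_right bergman_fun_diff bergman_fun_sum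
        complex_linear_apply[OF lin] bergman_fun_cscale)
  also have "\<dots> = deriv B x * (\<Sum>y\<in>?F. coeff_mat T x y * bergman_fun f y / deriv B y)"
    unfolding sum_distrib_left
  proof (rule sum.cong[OF refl])
    fix y assume "y \<in> ?F"
    then have "deriv B y \<noteq> 0" "deriv B x \<noteq> 0" using D0_deriv D0_transfer[OF x] x by blast+
    then show "bergman_fun f y * bergman_fun (T (?l y)) x = deriv B x * (coeff_mat T x y * bergman_fun f y / deriv B y)"
      by (simp add: coeff_mat_def)
  qed
  finally show ?thesis .
qed

text \<open>In \<open>sum_defect_fiber_eq_0\<close> for the Lagrange functions of \<open>y\<close>
  and \<open>x\<close>, one term with \<open>T\<close> and one with \<open>T'\<close>
  survive.\<close>

lemma coeff_mat_adjoint: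
  fixes T T' :: "bergman \<Rightarrow>\<^sub>L bergman"
  assumes T: "\<And>f. T (mult_op B f) = mult_op B (T f)" and T': "\<And>f. T' (mult_op B f) = mult_op B (T' f)"
    and adj: "\<And>f g. cinner (T f) g = cinner f (T' g)" and x: "x \<in> D0" and y: "y \<in> fiber (B x)"
  shows "coeff_mat T x y = cnj (coeff_mat T' y x)"
proof -
  let ?F = "fiber (B x)" and ?l = "\<lambda>y. bergman_of (lagrange (fiber (B x)) y)"
  have By: "B y = B x" using y by (simp add: fiber_def)
  have xF: "x \<in> ?F" by (rule D0_in_fiber[OF x])
  have nz: "deriv B y \<noteq> 0" "deriv B x \<noteq> 0" using D0_deriv D0_transfer[OF x y] x by blast+
  define p where "p z = complex_of_real ((norm (deriv B z))\<^sup>2)" for z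
  have p: "p z = deriv B z * cnj (deriv B z)" for z unfolding p_def by (rule complex_norm_square)
  have "0 = (\<Sum>z\<in>?F. defect T T' (?l y) (?l x) z / p z)"
    using sum_defect_fiber_eq_0[OF T T' adj x, of "?l y" "?l x"] by (simp add: p_def)
  also have "\<dots> = (\<Sum>z\<in>?F. (if z = x then bergman_fun (T (?l y)) z / p z else 0)
      - (if z = y then cnj (bergman_fun (T' (?l x)) z) / p z else 0))"
    using xF y by (intro sum.cong) (auto simp: defect_def bergman_lagrange diff_divide_distrib)
  also have "\<dots> = bergman_fun (T (?l y)) x / p x - cnj (bergman_fun (T' (?l x)) y) / p y"
    using xF y by (simp add: sum_subtractf finite_fiber)
  finally have "bergman_fun (T (?l y)) x / p x = cnj (bergman_fun (T' (?l x)) y) / p y" by simp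
  then have "bergman_fun (T (?l y)) x * (deriv B y * cnj (deriv B y)) = cnj (bergman_fun (T' (?l x)) y) * (deriv B x * cnj (deriv B x))"
    using nz by (simp add: p frac_eq_eq)
  then show ?thesis
    using nz by (simp add: coeff_mat_def By field_simps)
qed

text \<open>Splitting off one root at a time moves the moving roots \<open>u t w\<close> into scalar
  coefficients, until \<open>T\<close> acts on functions that do not depend on \<open>w\<close>. The
  factor \<open>\<phi>\<close> collects the powers of \<open>z\<close> that arise on the
  way.\<close>

lemma holomorphic_apply_operator:
  fixes T :: "bergman \<Rightarrow>\<^sub>L bergman"
  assumes lin: "complex_linear T" and Y: "finite Y" and u: "\<And>t. t \<in> Y \<Longrightarrow> u t holomorphic_on S"
    and v: "v holomorphic_on S" "v ` S \<subseteq> unit_disk" and \<phi>: "\<phi> holomorphic_on UNIV"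
  shows "(\<lambda>w. bergman_fun (T (bergman_of (\<lambda>z. \<phi> z * (\<Prod>t\<in>Y. z - u t w)))) (v w)) holomorphic_on S"
  using Y u \<phi>
proof (induction Y arbitrary: \<phi> rule: finite_induct)
  case empty
  show ?case
    using holomorphic_on_compose_gen[OF v(1) bergman_fun_holomorphic v(2)] by (simp add: o_def)
next
  case (insert s Y)
  have "bergman_of (\<lambda>z. \<phi> z * (\<Prod>t\<in>insert s Y. z - u t w))
      = bergman_of (\<lambda>z. (\<phi> z * z) * (\<Prod>t\<in>Y. z - u t w)) - cscale (u s w) (bergman_of (\<lambda>z. \<phi> z * (\<Prod>t\<in>Y. z - u t w)))" for w
  proof -
    have "(\<lambda>z. \<phi> z * (\<Prod>t\<in>insert s Y. z - u t w)) = (\<lambda>z. (\<phi> z * z) * (\<Prod>t\<in>Y. z - u t w) - u s w * (\<phi> z * (\<Prod>t\<in>Y. z - u t w)))"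
      using insert.hyps by (simp add: algebra_simps)
    then show ?thesis
      using insert.prems by (simp add: bergman_of_lincomb holomorphic_intros)
  qed
  then have "bergman_fun (T (bergman_of (\<lambda>z. \<phi> z * (\<Prod>t\<in>insert s Y. z - u t w)))) (v w)
      = bergman_fun (T (bergman_of (\<lambda>z. (\<phi> z * z) * (\<Prod>t\<in>Y. z - u t w)))) (v w)
        - u s w * bergman_fun (T (bergman_of (\<lambda>z. \<phi> z * (\<Prod>t\<in>Y. z - u t w)))) (v w)" for w
    by (simp add: blinfun.diff_right complex_linear_apply[OF lin] bergman_fun_diff bergman_fun_cscale)
  moreover have "(\<lambda>w. bergman_fun (T (bergman_of (\<lambda>z. (\<phi> z * z) * (\<Prod>t\<in>Y. z - u t w)))) (v w)
        - u s w * bergman_fun (T (bergman_of (\<lambda>z. \<phi> z * (\<Prod>t\<in>Y. z - u t w)))) (v w)) holomorphic_on S"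
    using insert.prems by (intro holomorphic_intros insert.IH) auto
  ultimately show ?case by simp
qed

lemma coeff_mat_holomorphic:
  fixes T :: "bergman \<Rightarrow>\<^sub>L bergman"
  assumes lin: "complex_linear T" and br: "branches w0 e u r" and x: "x \<in> fiber w0" and y: "y \<in> fiber w0"
  shows "(\<lambda>w. coeff_mat T (u x w) (u y w)) holomorphic_on ball w0 e"
proof -
  let ?F = "fiber w0"
  note hol = branchesD(4)[OF br]
  have D: "u t w \<in> unit_disk" "B (u t w) = w" if "t \<in> ?F" "w \<in> ball w0 e" for t w
    using branchesD(13)[OF br that] by (auto simp: fiber_def)
  have D0: "u t w \<in> D0" if "t \<in> ?F" "w \<in> ball w0 e" for t w
    using D[OF that] branchesD(3)[OF br that(2)] unfolding D0_iff by simp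
  have ne: "u y w \<noteq> u t w" if "t \<in> ?F - {y}" "w \<in> ball w0 e" for t w
    using inj_onD[OF branchesD(7)[OF br that(2)] _ y, of t] that(1) by auto
  \<comment> \<open>The Lagrange polynomial of the moving fiber is rewritten over the fixed index
    set \<open>fiber w0\<close>, the form required by
    \<open>holomorphic_apply_operator\<close>.\<close>
  have lag: "bergman_of (lagrange (fiber w) (u y w))
      = bergman_of (\<lambda>z. inverse (\<Prod>t\<in>?F - {y}. u y w - u t w) * (\<Prod>t\<in>?F - {y}. z - u t w))" if w: "w \<in> ball w0 e" for w
  proof -
    have "fiber w - {u y w} = (\<lambda>t. u t w) ` (?F - {y})"
      using branchesD(6)[OF br w] ne[OF _ w] y by (auto simp: eq_commute[of "u _ w" "u y w"])
    moreover have "inj_on (\<lambda>t. u t w) (?F - {y})"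
      by (rule inj_on_subset[OF branchesD(7)[OF br w]]) auto
    ultimately have "lagrange (fiber w) (u y w) z = (\<Prod>t\<in>?F - {y}. (z - u t w) / (u y w - u t w))" for z
      by (simp add: lagrange_def prod.reindex)
    then have "lagrange (fiber w) (u y w) = (\<lambda>z. inverse (\<Prod>t\<in>?F - {y}. u y w - u t w) * (\<Prod>t\<in>?F - {y}. z - u t w))"
      unfolding prod_dividef by (intro ext) (simp only: divide_inverse mult.commute)
    then show ?thesis by simp
  qed
  have dB: "deriv B holomorphic_on unit_disk" by (rule holomorphic_deriv[OF B_holomorphic_disk open_ball])
  have dBu: "(\<lambda>w. deriv B (u t w)) holomorphic_on ball w0 e" if "t \<in> ?F" for t
    by (rule holomorphic_on_compose_gen[OF hol[OF that] dB, unfolded o_def]) (use D(1)[OF that] in blast)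
  have "(\<lambda>w. bergman_fun (T (bergman_of (\<lambda>z. 1 * (\<Prod>t\<in>?F - {y}. z - u t w)))) (u x w)) holomorphic_on ball w0 e"
    by (rule holomorphic_apply_operator[OF lin]) (use hol x D(1)[OF x] finite_fiber in auto)
  then have "(\<lambda>w. inverse (\<Prod>t\<in>?F - {y}. u y w - u t w) *
        bergman_fun (T (bergman_of (\<lambda>z. \<Prod>t\<in>?F - {y}. z - u t w))) (u x w) * deriv B (u y w) / deriv B (u x w)) holomorphic_on ball w0 e"
    using D0_deriv[OF D0[OF x]] ne
    by (intro holomorphic_intros dBu x y) (auto intro!: hol y simp: finite_fiber)
  then show ?thesis
  proof (rule holomorphic_transform)
    fix w assume w: "w \<in> ball w0 e"
    define k where "k = inverse (\<Prod>t\<in>?F - {y}. u y w - u t w)"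
    have "bergman_of (\<lambda>z. k * (\<Prod>t\<in>?F - {y}. z - u t w)) = cscale k (bergman_of (\<lambda>z. \<Prod>t\<in>?F - {y}. z - u t w))"
      by (rule bergman_eqI) (simp add: bergman_of_polynomial bergman_fun_cscale cscale.rep_eq holomorphic_intros)
    then have "bergman_fun (T (bergman_of (lagrange (fiber w) (u y w)))) (u x w)
        = k * bergman_fun (T (bergman_of (\<lambda>z. \<Prod>t\<in>?F - {y}. z - u t w))) (u x w)"
      using lag[OF w] by (simp add: k_def complex_linear_apply[OF lin] bergman_fun_cscale)
    then show "inverse (\<Prod>t\<in>?F - {y}. u y w - u t w) *
        bergman_fun (T (bergman_of (\<lambda>z. \<Prod>t\<in>?F - {y}. z - u t w))) (u x w) * deriv B (u y w) / deriv B (u x w)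
        = coeff_mat T (u x w) (u y w)"
      using D(2)[OF x w] by (simp add: coeff_mat_def k_def)
  qed
qed

lemma coeff_mat_loc_const:
  fixes T T' :: "bergman \<Rightarrow>\<^sub>L bergman"
  assumes lin: "complex_linear T" "complex_linear T'"
    and T: "\<And>f. T (mult_op B f) = mult_op B (T f)" and T': "\<And>f. T' (mult_op B f) = mult_op B (T' f)"
    and adj: "\<And>f g. cinner (T f) g = cinner f (T' g)"
  shows "loc_const (coeff_mat T)"
  unfolding loc_const_def
proof (intro ballI)
  fix x y assume x: "x \<in> D0" and y: "y \<in> fiber (B x)"
  obtain e u r where br: "branches (B x) e u r" using branches_at_D0[OF x] .
  have e: "0 < e" "0 < r" using branchesD(1,2)[OF br] by auto
  obtain \<delta> where \<delta>: "\<delta> > 0" "\<And>y. y \<in> ball x \<delta> \<Longrightarrow> y \<in> D0 \<and> B y \<in> ball (B x) e \<and> B y \<in> ball (B x) e \<and> u x (B y) = y"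
    using branches_near[OF x br e(1) order_refl] by blast
  have xF: "x \<in> fiber (B x)" by (rule D0_in_fiber[OF x])
  have "(\<lambda>w. coeff_mat T (u x w) (u y w)) constant_on ball (B x) e"
  proof (rule holomorphic_eq_cnj_holomorphic_imp_constant)
    show "(\<lambda>w. coeff_mat T (u x w) (u y w)) holomorphic_on ball (B x) e"
      by (rule coeff_mat_holomorphic[OF lin(1) br xF y])
    show "(\<lambda>w. coeff_mat T' (u y w) (u x w)) holomorphic_on ball (B x) e"
      by (rule coeff_mat_holomorphic[OF lin(2) br y xF])
    show "coeff_mat T (u x w) (u y w) = cnj (coeff_mat T' (u y w) (u x w))" if w: "w \<in> ball (B x) e" for w
    proof (rule coeff_mat_adjoint[OF T T' adj])
      have "u x w \<in> fiber w" "u y w \<in> fiber w" using branchesD(13)[OF br xF w] branchesD(13)[OF br y w] .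
      then show "u x w \<in> D0" "u y w \<in> fiber (B (u x w))"
        using branchesD(3)[OF br w] unfolding D0_iff by (auto simp: fiber_def)
    qed
  qed auto
  then obtain k where k: "\<And>w. w \<in> ball (B x) e \<Longrightarrow> coeff_mat T (u x w) (u y w) = k" unfolding constant_on_def by blast
  have kxy: "coeff_mat T x y = k" using k[of "B x"] e branchesD(5)[OF br xF] branchesD(5)[OF br y] by simp
  show "\<exists>e>0. \<forall>x'\<in>D0. \<forall>y'\<in>fiber (B x'). dist x' x < e \<longrightarrow> dist y' y < e \<longrightarrow> coeff_mat T x' y' = coeff_mat T x y"
  \<comment> \<open>\<open>\<delta>\<close> keeps \<open>x'\<close> on the sheet through
    \<open>x\<close>, and \<open>r\<close> keeps \<open>y'\<close> on the sheet through
    \<open>y\<close>.\<close>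
  proof (intro exI[of _ "min \<delta> r"] conjI ballI impI)
    fix x' y' assume x': "x' \<in> D0" and y': "y' \<in> fiber (B x')" and d: "dist x' x < min \<delta> r" "dist y' y < min \<delta> r"
    have xx: "B x' \<in> ball (B x) e" "u x (B x') = x'" using \<delta>(2)[of x'] d(1) by (auto simp: dist_commute)
    have "u y (B y') = y'"
      using branchesD(11)[OF br y, of y'] d(2) xx(1) y' by (auto simp: dist_commute fiber_def)
    then have "u y (B x') = y'" using y' by (simp add: fiber_def)
    then show "coeff_mat T x' y' = coeff_mat T x y" using k[OF xx(1)] xx(2) kxy by simp
  qed (use \<delta>(1) e(2) in simp)
qed

text \<open>For \<open>x\<close> in \<open>D0\<close>, \<open>deriv B x * fiber_trace f x\<close> is
  the sum of \<open>f (\<sigma> x) * deriv \<sigma> x\<close> over all local branches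
  \<open>\<sigma>\<close> of the inverse of \<open>B\<close> composed with \<open>B\<close>.\<close>

definition fiber_trace :: "bergman \<Rightarrow> complex \<Rightarrow> complex" where
  "fiber_trace f x = (\<Sum>y\<in>fiber (B x). bergman_fun f y / deriv B y)"

end

lemma (in blaschke_simple) bergman_eqI_D0:
  assumes "\<And>z. z \<in> D0 \<Longrightarrow> bergman_fun f z = bergman_fun g z"
  shows "f = g"
proof (rule bergman_eqI)
  fix q assume q: "q \<in> unit_disk"
  have "isCont (bergman_fun h) q" for h
    by (rule field_differentiable_imp_continuous_at holomorphic_on_imp_differentiable_at[OF bergman_fun_holomorphic open_ball q])+
  then have "((\<lambda>z. bergman_fun f z - bergman_fun g z) \<longlongrightarrow> bergman_fun f q - bergman_fun g q) (at q)"
    by (intro tendsto_intros) (simp_all add: isCont_def)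
  moreover have "\<forall>\<^sub>F z in at q. bergman_fun f z - bergman_fun g z = 0"
    using eventually_at_D0[OF q] by eventually_elim (simp add: assms)
  then have "((\<lambda>z. bergman_fun f z - bergman_fun g z) \<longlongrightarrow> 0) (at q)" by (rule tendsto_eventually)
  ultimately have "bergman_fun f q - bergman_fun g q = 0" by (rule tendsto_unique[rotated]) simp
  then show "bergman_fun f q = bergman_fun g q" by simp
qed

theorem (in blaschke_simple) Vstar_structure:
  assumes T: "T \<in> Vstar B"
  obtains \<alpha> \<beta> where "\<And>f x. x \<in> D0 \<Longrightarrow> bergman_fun (T f) x = \<alpha> * bergman_fun f x + \<beta> * (deriv B x * fiber_trace f x)"
proof -
  let ?T' = "hilbert_adjoint T"
  have lin: "complex_linear T" "complex_linear ?T'"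
    using T commutant_complex_linear complex_linear_hilbert_adjoint unfolding Vstar_def by blast+
  have T': "?T' \<in> commutant {mult_op B, hilbert_adjoint (mult_op B)}"
    using T hilbert_adjoint_in_commutant[OF complex_linear_mult_op_B] by (simp add: Vstar_def)
  have comm: "T (mult_op B f) = mult_op B (T f)" "?T' (mult_op B f) = mult_op B (?T' f)" for f
    using commutant_apply[OF T[unfolded Vstar_def]] commutant_apply[OF T'] by simp_all
  have "loc_const (coeff_mat T)"
    by (rule coeff_mat_loc_const[OF lin comm hilbert_adjoint[OF lin(1)]])
  then obtain \<alpha> \<beta> where ab: "\<And>x. x \<in> D0 \<Longrightarrow> coeff_mat T x x = \<alpha>"
    "\<And>x y. x \<in> D0 \<Longrightarrow> y \<in> fiber (B x) \<Longrightarrow> y \<noteq> x \<Longrightarrow> coeff_mat T x y = \<beta>"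
    using loc_const_two_values by metis
  show ?thesis
  \<comment> \<open>The trace already contains the diagonal term, with coefficient
    \<open>\<beta>\<close>.\<close>
  proof (rule that[of "\<alpha> - \<beta>" \<beta>])
    fix f x assume x: "x \<in> D0"
    have xF: "x \<in> fiber (B x)" by (rule D0_in_fiber[OF x])
    have "(\<Sum>y\<in>fiber (B x). coeff_mat T x y * bergman_fun f y / deriv B y)
        = (\<Sum>y\<in>fiber (B x). \<beta> * (bergman_fun f y / deriv B y) + (if y = x then (\<alpha> - \<beta>) * (bergman_fun f x / deriv B x) else 0))"
      using ab x by (intro sum.cong) (auto simp: algebra_simps diff_divide_distrib)
    also have "\<dots> = \<beta> * fiber_trace f x + (\<alpha> - \<beta>) * (bergman_fun f x / deriv B x)"
      using xF by (simp add: sum.distrib fiber_trace_def sum_distrib_left finite_fiber)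
    finally show "bergman_fun (T f) x = (\<alpha> - \<beta>) * bergman_fun f x + \<beta> * (deriv B x * fiber_trace f x)"
      using coeff_mat_expansion[OF lin(1) comm(1) x, of f] D0_deriv[OF x] by (simp add: field_simps)
  qed
qed

section \<open>The distinguished reducing subspace\<close>

text \<open>The mean of \<open>F * cnj (z * g)\<close> over the unit circle. The extra factor
  \<open>z\<close> comes from the differential of \<open>cnj z\<close> along the circle, which is
  \<open>- \<i> * cnj z\<close> times that of the angle.\<close>

definition circle_pairing :: "(complex \<Rightarrow> complex) \<Rightarrow> (complex \<Rightarrow> complex) \<Rightarrow> complex" where
  "circle_pairing F g = integral {0..1} (\<lambda>t. F (circlepath 0 1 t) * cnj (circlepath 0 1 t * g (circlepath 0 1 t)))"

lemma norm_circlepath_unit: "norm (circlepath 0 1 t) = 1"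
  by (simp add: circlepath)

lemma continuous_on_comp_circlepath:
  assumes "continuous_on (cball 0 1) F"
  shows "continuous_on {0..1} (\<lambda>t. F (circlepath 0 1 t))"
  by (rule continuous_on_compose2[OF assms]) (auto simp: norm_circlepath_unit path_def[symmetric])

lemma circle_pairing_integrable:
  assumes "continuous_on (cball 0 1) F" "continuous_on (cball 0 1) g"
  shows "(\<lambda>t. F (circlepath 0 1 t) * cnj (circlepath 0 1 t * g (circlepath 0 1 t))) integrable_on {0..1}"
  by (intro integrable_continuous_real continuous_intros continuous_on_comp_circlepath assms)

lemma bounded_on_disk:
  assumes "continuous_on (cball 0 1) (g :: complex \<Rightarrow> complex)"
  shows "bounded (g ` unit_disk)"
proof -
  have "compact (g ` cball 0 1)" by (intro compact_continuous_image assms) auto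
  then show ?thesis by (rule bounded_subset[OF compact_imp_bounded]) auto
qed

text \<open>Both sides are the Taylor coefficient of \<open>F\<close> of order \<open>m + 1\<close>:
  the left by \<open>cinner_monomial\<close> for the derivative, the right by Cauchy's formula, as
  \<open>cnj z = 1 / z\<close> on the circle.\<close>

lemma cinner_deriv_monomial:
  assumes F: "F holomorphic_on S" "open S" "cball 0 1 \<subseteq> S"
  shows "cinner (bergman_of (deriv F)) (bergman_of (\<lambda>z. z ^ m)) = circle_pairing F (\<lambda>z. z ^ m)"
proof -
  have sub: "unit_disk \<subseteq> S" using F(3) by auto
  have Fc: "continuous_on (cball 0 1) F" "F holomorphic_on ball 0 1"
    using F holomorphic_on_subset[OF F(1) sub] by (auto intro!: holomorphic_on_imp_continuous_on intro: holomorphic_on_subset)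
  have dF: "deriv F holomorphic_on S" by (rule holomorphic_deriv[OF F(1,2)])
  have ev: "\<forall>\<^sub>F z in nhds 0. bergman_fun (bergman_of (deriv F)) z = deriv F z"
  proof -
    have "deriv F holomorphic_on unit_disk" "bounded (deriv F ` unit_disk)"
      using holomorphic_on_subset[OF dF sub] holomorphic_on_subset[OF dF F(3)]
      by (auto intro!: bounded_on_disk holomorphic_on_imp_continuous_on)
    then have "bergman_fun (bergman_of (deriv F)) z = deriv F z" if "z \<in> unit_disk" for z
      using that by (simp add: bergman_fun_bergman_of)
    moreover have "\<forall>\<^sub>F z in nhds 0. z \<in> unit_disk" by (intro eventually_nhds_in_open) auto
    ultimately show ?thesis by (auto elim: eventually_mono)
  qed
  have "cinner (bergman_of (deriv F)) (bergman_of (\<lambda>z. z ^ m)) = (deriv ^^ m) (deriv F) 0 / fact m / (m + 1)"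
    unfolding cinner_monomial higher_deriv_cong_ev[OF ev refl] ..
  also have "(deriv ^^ m) (deriv F) = (deriv ^^ Suc m) F" by (simp only: funpow_Suc_right o_def)
  also have "(deriv ^^ Suc m) F 0 / fact m / (m + 1) = (deriv ^^ Suc m) F 0 / fact (Suc m)"
    by (simp add: field_simps)
  finally have 1: "cinner (bergman_of (deriv F)) (bergman_of (\<lambda>z. z ^ m)) = (deriv ^^ Suc m) F 0 / fact (Suc m)" .
  have vd: "vector_derivative (circlepath 0 1) (at t within {0..1}) = 2 * of_real pi * \<i> * circlepath 0 1 t"
    if "t \<in> {0..1}" for t
    using that by (subst vector_derivative_circlepath01) (auto simp: circlepath mult_ac)
  have "((\<lambda>u. F u / (u - 0) ^ Suc (Suc m)) has_contour_integral 2 * of_real pi * \<i> / fact (Suc m) * (deriv ^^ Suc m) F 0) (circlepath 0 1)"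
    using Cauchy_has_contour_integral_higher_derivative_circlepath[OF Fc, of 0 "Suc m"] by simp
  then have "((\<lambda>t. F (circlepath 0 1 t) / (circlepath 0 1 t) ^ Suc (Suc m) * (2 * of_real pi * \<i> * circlepath 0 1 t)) has_integral
      2 * of_real pi * \<i> / fact (Suc m) * (deriv ^^ Suc m) F 0) {0..1}"
    unfolding has_contour_integral_def
    by (rule has_integral_cong[THEN iffD1, rotated]) (simp add: vd)
  then have "((\<lambda>t. F (circlepath 0 1 t) / (circlepath 0 1 t) ^ Suc (Suc m) * (2 * of_real pi * \<i> * circlepath 0 1 t) / (2 * of_real pi * \<i>)) has_integral
      2 * of_real pi * \<i> / fact (Suc m) * (deriv ^^ Suc m) F 0 / (2 * of_real pi * \<i>)) {0..1}"
    by (rule has_integral_divide)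
  moreover have "F (circlepath 0 1 t) / (circlepath 0 1 t) ^ Suc (Suc m) * (2 * of_real pi * \<i> * circlepath 0 1 t) / (2 * of_real pi * \<i>)
      = F (circlepath 0 1 t) * cnj (circlepath 0 1 t * circlepath 0 1 t ^ m)" for t
  proof -
    define z where "z = circlepath 0 1 t"
    have "z * cnj z = 1" using complex_norm_square[of z] norm_circlepath_unit[of t] by (simp add: z_def)
    then have "(z * cnj z) ^ Suc m = 1" by simp
    then have p: "z ^ Suc m * cnj (z ^ Suc m) = 1" by (simp only: power_mult_distrib complex_cnj_power)
    have z0: "z \<noteq> 0" using \<open>z * cnj z = 1\<close> by auto
    have "F z / z ^ Suc (Suc m) * (2 * of_real pi * \<i> * z) / (2 * of_real pi * \<i>) = F z / z ^ Suc m"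
      using z0 by (simp add: field_simps)
    also have "\<dots> = F z * cnj (z ^ Suc m)"
      using p z0 by (simp add: divide_eq_eq mult.assoc) (simp add: mult_ac)
    finally show ?thesis by (simp add: z_def)
  qed
  ultimately have "((\<lambda>t. F (circlepath 0 1 t) * cnj (circlepath 0 1 t * circlepath 0 1 t ^ m)) has_integral (deriv ^^ Suc m) F 0 / fact (Suc m)) {0..1}"
    by simp
  then have "circle_pairing F (\<lambda>z. z ^ m) = (deriv ^^ Suc m) F 0 / fact (Suc m)"
    unfolding circle_pairing_def by (rule integral_unique)
  with 1 show ?thesis by simp
qed

text \<open>This is Stokes' theorem for \<open>F' cnj g dA\<close>; it is checked on monomials \<open>g\<close> and extended to all \<open>g\<close>
  by uniform approximation.\<close>

lemma cinner_deriv_eq_circle_pairing: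
  assumes F: "F holomorphic_on S" "open S" "cball 0 1 \<subseteq> S" and g: "g holomorphic_on ball 0 R" "R > 1"
  shows "cinner (bergman_of (deriv F)) (bergman_of g) = circle_pairing F g"
proof -
  define f where "f = bergman_of (deriv F)"
  have Fc: "continuous_on (cball 0 1) F"
    using F by (auto intro!: holomorphic_on_imp_continuous_on intro: holomorphic_on_subset)
  obtain C where C: "\<And>z. z \<in> cball 0 1 \<Longrightarrow> norm (F z) \<le> C"
    using compact_imp_bounded[OF compact_continuous_image[OF Fc compact_cball]] unfolding bounded_iff by (metis imageI)
  have C0: "0 \<le> C" using order_trans[OF norm_ge_zero C[of 0]] by simp
  define b where "b m = (deriv ^^ m) g 0 / fact m" for m
  define p where "p N z = (\<Sum>m<N. b m * z ^ m)" for N z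
  have psum: "(\<lambda>m. b m * z ^ m) sums g z" if "z \<in> ball 0 R" for z
    using holomorphic_power_series[OF g(1) that] by (simp add: b_def)
  have summ: "summable (\<lambda>m. norm (b m))"
  proof -
    \<comment> \<open>Convergence at a point beyond radius 1 gives absolute convergence at radius 1,
      hence uniform convergence of the polynomials \<open>p N\<close> on the closed disk.\<close>
    define s where "s = (1 + R) / 2"
    have s: "1 < s" "s < R" using g(2) by (auto simp: s_def)
    then have "summable (\<lambda>m. b m * (of_real s) ^ m)" using psum[of "of_real s"] by (simp add: sums_iff)
    then have "summable (\<lambda>m. norm (b m * 1 ^ m))" by (rule powser_insidea) (use s in simp)
    then show ?thesis by simp
  qed
  have unif: "uniform_limit (cball 0 1) p g sequentially"
  proof -
    have "uniform_limit (cball 0 1) (\<lambda>N z. \<Sum>m<N. b m * z ^ m) (\<lambda>z. \<Sum>m. b m * z ^ m) sequentially"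
    proof (rule Weierstrass_m_test[OF _ summ])
      show "norm (b m * z ^ m) \<le> norm (b m)" if "z \<in> cball 0 1" for m z
        using that by (simp add: norm_mult norm_power mult_left_le power_le_one)
    qed
    then show ?thesis unfolding p_def
      by (rule uniform_limit_cong[THEN iffD1, rotated -1])
        (use psum g(2) in \<open>auto simp: sums_iff\<close>)
  qed
  have pU: "p N holomorphic_on UNIV" for N unfolding p_def by (intro holomorphic_intros)
  have gc: "continuous_on (cball 0 1) g" "g holomorphic_on unit_disk"
    using g by (auto intro!: holomorphic_on_imp_continuous_on intro: holomorphic_on_subset)
  have pc: "continuous_on (cball 0 1) (p N)" for N
    using pU holomorphic_on_imp_continuous_on continuous_on_subset by blast
  have eqp: "cinner f (bergman_of (p N)) = circle_pairing F (p N)" for N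
  proof (induction N)
    case 0
    have "p 0 = (\<lambda>z. 0)" by (simp add: p_def fun_eq_iff)
    moreover have "bergman_of (\<lambda>z. 0) = 0" by (rule bergman_eqI) (simp add: bergman_of_polynomial)
    ultimately show ?case by (simp add: circle_pairing_def)
  next
    case (Suc N)
    have p: "p (Suc N) = (\<lambda>z. p N z - (- b N) * z ^ N)" by (simp add: p_def fun_eq_iff)
    have "bergman_of (p (Suc N)) = bergman_of (p N) - cscale (- b N) (bergman_of (\<lambda>z. z ^ N))"
      unfolding p by (rule bergman_of_lincomb) (auto intro: pU holomorphic_intros)
    then have "cinner f (bergman_of (p (Suc N))) = circle_pairing F (p N) + cnj (b N) * circle_pairing F (\<lambda>z. z ^ N)"
      by (simp add: cinner_diff_right cinner_cscale_right Suc.IH[unfolded f_def] f_def cinner_deriv_monomial[OF F] del: bergman.scale_minus_left)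
    also have "\<dots> = circle_pairing F (p (Suc N))"
    proof -
      have 1: "(\<lambda>t. F (circlepath 0 1 t) * cnj (circlepath 0 1 t * p N (circlepath 0 1 t))) integrable_on {0..1}"
        and 2: "(\<lambda>t. F (circlepath 0 1 t) * cnj (circlepath 0 1 t * circlepath 0 1 t ^ N)) integrable_on {0..1}"
        by (intro circle_pairing_integrable[OF Fc] pc continuous_intros)+
      have "cnj (b N) * circle_pairing F (\<lambda>z. z ^ N) = integral {0..1} (\<lambda>t. cnj (b N) * (F (circlepath 0 1 t) * cnj (circlepath 0 1 t * circlepath 0 1 t ^ N)))"
        by (simp add: circle_pairing_def)
      then have "circle_pairing F (p N) + cnj (b N) * circle_pairing F (\<lambda>z. z ^ N)
          = integral {0..1} (\<lambda>t. F (circlepath 0 1 t) * cnj (circlepath 0 1 t * p N (circlepath 0 1 t))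
            + cnj (b N) * (F (circlepath 0 1 t) * cnj (circlepath 0 1 t * circlepath 0 1 t ^ N)))"
        using integral_add[OF 1 integrable_on_mult_right[OF 2, of "cnj (b N)"]] by (simp add: circle_pairing_def)
      also have "\<dots> = circle_pairing F (p (Suc N))"
        unfolding circle_pairing_def p by (intro integral_cong) (simp add: algebra_simps)
      finally show ?thesis .
    qed
    finally show ?case .
  qed
  \<comment> \<open>Both sides are continuous in \<open>g\<close> for uniform convergence on the
    closed disk: the inner product with constant \<open>norm f\<close>, the pairing with the bound
    \<open>C\<close> of \<open>F\<close>.\<close>
  have le: "norm (cinner f (bergman_of g) - circle_pairing F g) \<le> (norm f + C) * e" if e: "e > 0" for e
  proof -
    obtain N where N: "\<And>z. z \<in> cball 0 1 \<Longrightarrow> norm (p N z - g z) < e"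
      using uniform_limitD[OF unif e] unfolding eventually_sequentially dist_norm by blast
    have "bergman_of g - bergman_of (p N) = bergman_of (\<lambda>z. g z - p N z)"
    proof (rule bergman_eqI)
      fix z assume z: "z \<in> unit_disk"
      have "(\<lambda>z. g z - p N z) holomorphic_on unit_disk"
        by (intro holomorphic_intros gc holomorphic_on_subset[OF pU]) auto
      moreover have "bounded ((\<lambda>z. g z - p N z) ` unit_disk)" by (intro bounded_on_disk continuous_intros gc pc)
      ultimately show "bergman_fun (bergman_of g - bergman_of (p N)) z = bergman_fun (bergman_of (\<lambda>z. g z - p N z)) z"
        using z gc(2) bounded_on_disk[OF gc(1)] bergman_of_polynomial[OF pU z]
        by (simp add: bergman_fun_diff bergman_fun_bergman_of)
    qed
    moreover have "norm (bergman_of (\<lambda>z. g z - p N z)) \<le> e"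
    proof (rule norm_bergman_of_le)
      show "norm (g z - p N z) \<le> e" if "z \<in> unit_disk" for z
        using N[of z] that by (simp add: norm_minus_commute less_imp_le)
    qed (intro holomorphic_intros gc holomorphic_on_subset[OF pU], auto)
    ultimately have "norm (cinner f (bergman_of g - bergman_of (p N))) \<le> norm f * e"
      by (intro order_trans[OF norm_cinner_le] mult_left_mono) auto
    then have 1: "norm (cinner f (bergman_of g) - circle_pairing F (p N)) \<le> norm f * e"
      by (simp add: cinner_diff_right eqp)
    have i: "(\<lambda>t. F (circlepath 0 1 t) * cnj (circlepath 0 1 t * q (circlepath 0 1 t))) integrable_on {0..1}" if "continuous_on (cball 0 1) q" for q
      by (rule circle_pairing_integrable[OF Fc that])
    have "circle_pairing F (p N) - circle_pairing F g = integral {0..1} (\<lambda>t. F (circlepath 0 1 t) * cnj (circlepath 0 1 t * (p N (circlepath 0 1 t) - g (circlepath 0 1 t))))"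
      unfolding circle_pairing_def by (subst integral_diff[OF i i, symmetric]) (auto simp: pc gc algebra_simps)
    also have "norm \<dots> \<le> integral {0..1} (\<lambda>t::real. C * e)"
    proof (rule integral_norm_bound_integral)
      show "(\<lambda>t. F (circlepath 0 1 t) * cnj (circlepath 0 1 t * (p N (circlepath 0 1 t) - g (circlepath 0 1 t)))) integrable_on {0..1}"
        by (rule i) (intro continuous_intros pc gc)
      fix t :: real
      have "norm (F (circlepath 0 1 t)) * norm (p N (circlepath 0 1 t) - g (circlepath 0 1 t)) \<le> C * e"
        using C[of "circlepath 0 1 t"] N[of "circlepath 0 1 t"] C0
        by (intro mult_mono) (auto simp: norm_circlepath_unit)
      then show "norm (F (circlepath 0 1 t) * cnj (circlepath 0 1 t * (p N (circlepath 0 1 t) - g (circlepath 0 1 t)))) \<le> C * e"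
        by (simp add: norm_mult norm_circlepath_unit complex_mod_cnj del: complex_cnj_mult complex_cnj_diff)
    qed auto
    finally have 2: "norm (circle_pairing F (p N) - circle_pairing F g) \<le> C * e" by simp
    show ?thesis
      using norm_triangle_ineq[of "cinner f (bergman_of g) - circle_pairing F (p N)" "circle_pairing F (p N) - circle_pairing F g"] 1 2
      by (simp add: distrib_right)
  qed
  have "norm (cinner f (bergman_of g) - circle_pairing F g) \<le> 0"
  proof (rule field_le_epsilon)
    fix e :: real assume e: "e > 0"
    have pos: "norm f + C + 1 > 0" using C0 by (simp add: add_nonneg_pos)
    have "norm (cinner f (bergman_of g) - circle_pairing F g) \<le> (norm f + C) * (e / (norm f + C + 1))"
      using e pos by (intro le) simp
    also have "\<dots> \<le> e" using e pos by (simp add: field_simps)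
    finally show "norm (cinner f (bergman_of g) - circle_pairing F g) \<le> 0 + e" by simp
  qed
  then show ?thesis by (simp add: f_def)
qed

section \<open>The functions \<open>B' B ^ k\<close> and the adjoint of multiplication by
  \<open>B\<close>\<close>

context blaschke
begin

lemma deriv_B_holomorphic: "deriv B holomorphic_on big_disk"
  by (rule holomorphic_deriv[OF B_holomorphic open_ball])

definition bpow :: "nat \<Rightarrow> bergman" where
  "bpow k = bergman_of (\<lambda>z. deriv B z * B z ^ k)"

lemma bpow_apply: "z \<in> unit_disk \<Longrightarrow> bergman_fun (bpow k) z = deriv B z * B z ^ k"
proof -
  assume z: "z \<in> unit_disk"
  have hol: "(\<lambda>z. deriv B z * B z ^ k) holomorphic_on big_disk"
    by (intro holomorphic_intros deriv_B_holomorphic B_holomorphic)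
  have "continuous_on (cball 0 1) (\<lambda>z. deriv B z * B z ^ k)"
    using hol cball_subset_big_disk by (meson holomorphic_on_imp_continuous_on holomorphic_on_subset)
  then show ?thesis
    using z holomorphic_on_subset[OF hol unit_disk_subset_big_disk] unfolding bpow_def
    by (simp add: bergman_fun_bergman_of bounded_on_disk)
qed

lemma mult_op_bpow: "mult_op B (bpow k) = bpow (Suc k)"
  by (rule bergman_eqI) (simp add: mult_op_B bpow_apply)

text \<open>Provides the primitive to which the Stokes formula is applied.\<close>

lemma bpow_eq_deriv: "bpow k = bergman_of (deriv (\<lambda>z. B z ^ Suc k / of_nat (Suc k)))"
proof -
  have "deriv (\<lambda>z. B z ^ Suc k / of_nat (Suc k)) z = deriv B z * B z ^ k" if z: "z \<in> unit_disk" for z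
  proof -
    have nz: "of_nat (Suc k) \<noteq> (0::complex)" by (rule of_nat_neq_0)
    have "((\<lambda>z. B z ^ Suc k / of_nat (Suc k)) has_field_derivative
        (of_nat (Suc k) * (deriv B z * B z ^ k)) / of_nat (Suc k)) (at z)"
      using DERIV_power_Suc[OF B_has_derivative[OF z], of k] by (intro DERIV_cdivide) (simp add: algebra_simps)
    then show ?thesis using nz by (intro DERIV_imp_deriv) simp
  qed
  then show ?thesis unfolding bpow_def bergman_of_def by (intro arg_cong[of _ _ Abs_bergman]) auto
qed

lemma cinner_bpow:
  "cinner (bpow k) (bergman_of g) = circle_pairing (\<lambda>z. B z ^ Suc k / of_nat (Suc k)) g"
  if "g holomorphic_on big_disk"
  unfolding bpow_eq_deriv
proof (rule cinner_deriv_eq_circle_pairing[OF _ open_ball cball_subset_big_disk that])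
  show "(\<lambda>z. B z ^ Suc k / of_nat (Suc k)) holomorphic_on big_disk"
    by (intro holomorphic_intros B_holomorphic) simp
  show "1 < 1 / \<rho>" using \<rho>(1,2) by simp
qed

lemma bergman_eqI_monomials:
  assumes "\<And>m. cinner f (bergman_of (\<lambda>z. z ^ m)) = cinner g (bergman_of (\<lambda>z. z ^ m))"
  shows "f = g"
proof (rule bergman_eqI)
  fix z assume z: "z \<in> unit_disk"
  have "taylor_coeff f m / (m + 1) = taylor_coeff g m / (m + 1)" for m
    using assms[of m] unfolding cinner_monomial .
  then have "taylor_coeff f m = taylor_coeff g m" for m
    by (simp only: divide_cancel_right of_nat_eq_0_iff) simp
  then show "bergman_fun f z = bergman_fun g z"
    using taylor_coeff_sums[OF z, of f] taylor_coeff_sums[OF z, of g] sums_unique2 by fastforce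
qed

text \<open>On the circle \<open>B * cnj B = 1\<close>, so the factor \<open>B\<close> in the second
  argument lowers the power of \<open>B\<close> in the primitive from \<open>Suc k\<close> to
  \<open>k\<close>, while the denominator \<open>Suc k\<close> stays.\<close>

lemma cinner_bpow_mult_op:
  "cinner (bpow k) (mult_op B (bergman_of (\<lambda>z. z ^ m))) = circle_pairing (\<lambda>z. B z ^ k / of_nat (Suc k)) (\<lambda>z. z ^ m)"
proof -
  have hol: "(\<lambda>z. B z * z ^ m) holomorphic_on big_disk" by (intro holomorphic_intros B_holomorphic)
  have "continuous_on (cball 0 1) (\<lambda>z. B z * z ^ m)"
    using hol cball_subset_big_disk by (meson holomorphic_on_imp_continuous_on holomorphic_on_subset)
  then have "mult_op B (bergman_of (\<lambda>z. z ^ m)) = bergman_of (\<lambda>z. B z * z ^ m)"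
    using holomorphic_on_subset[OF hol unit_disk_subset_big_disk]
    by (intro bergman_eqI)
      (simp add: mult_op_B bergman_of_polynomial bergman_fun_bergman_of bounded_on_disk holomorphic_intros)
  then have "cinner (bpow k) (mult_op B (bergman_of (\<lambda>z. z ^ m))) = circle_pairing (\<lambda>z. B z ^ Suc k / of_nat (Suc k)) (\<lambda>z. B z * z ^ m)"
    using cinner_bpow[OF hol] by simp
  also have "\<dots> = circle_pairing (\<lambda>z. B z ^ k / of_nat (Suc k)) (\<lambda>z. z ^ m)"
    unfolding circle_pairing_def
  proof (rule integral_cong)
    fix t :: real
    let ?z = "circlepath 0 1 t"
    have "B ?z * cnj (B ?z) = 1"
      using complex_norm_square[of "B ?z"] norm_B_eq_1[OF norm_circlepath_unit] by simp
    moreover have "b ^ Suc k / q * cnj (z * (b * z ^ m)) = (b * cnj b) * (b ^ k / q * cnj (z * z ^ m))" for b q z :: complex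
      by (simp add: mult_ac)
    ultimately show "B ?z ^ Suc k / of_nat (Suc k) * cnj (?z * (B ?z * ?z ^ m)) = B ?z ^ k / of_nat (Suc k) * cnj (?z * ?z ^ m)"
      by (simp only: mult_1)
  qed
  finally show ?thesis .
qed

lemma adjoint_mult_op_bpow_0: "hilbert_adjoint (mult_op B) (bpow 0) = 0"
proof (rule bergman_eqI_monomials)
  fix m
  have "cinner (hilbert_adjoint (mult_op B) (bpow 0)) (bergman_of (\<lambda>z. z ^ m)) = circle_pairing (\<lambda>z. 1) (\<lambda>z. z ^ m)"
    using cinner_bpow_mult_op[of 0 m] by (simp add: hilbert_adjoint'[OF complex_linear_mult_op_B])
  \<comment> \<open>The Stokes formula is read backwards: the remaining power of \<open>B\<close> is
    the constant 1, whose derivative is 0.\<close>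
  also have "\<dots> = cinner (bergman_of (deriv (\<lambda>z. 1))) (bergman_of (\<lambda>z. z ^ m))"
    by (rule cinner_deriv_monomial[symmetric, where S = UNIV]) auto
  also have "bergman_of (deriv (\<lambda>z. 1)) = 0"
    by (rule bergman_eqI) (simp add: bergman_of_polynomial)
  finally show "cinner (hilbert_adjoint (mult_op B) (bpow 0)) (bergman_of (\<lambda>z. z ^ m)) = cinner 0 (bergman_of (\<lambda>z. z ^ m))" by simp
qed

lemma adjoint_mult_op_bpow_Suc:
  "hilbert_adjoint (mult_op B) (bpow (Suc k)) = cscale (of_nat (Suc k) / of_nat (Suc (Suc k))) (bpow k)"
proof (rule bergman_eqI_monomials)
  fix m
  \<comment> \<open>The quotient of the denominators in the primitives of \<open>bpow k\<close> and
    \<open>bpow (Suc k)\<close>.\<close>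
  define q :: complex where "q = of_nat (Suc k) / of_nat (Suc (Suc k))"
  have nz: "of_nat (Suc k) \<noteq> (0::complex)" by (rule of_nat_neq_0)
  have hm: "(\<lambda>z. z ^ m) holomorphic_on big_disk" by (intro holomorphic_intros)
  have "cinner (hilbert_adjoint (mult_op B) (bpow (Suc k))) (bergman_of (\<lambda>z. z ^ m))
      = circle_pairing (\<lambda>z. B z ^ Suc k / of_nat (Suc (Suc k))) (\<lambda>z. z ^ m)"
    by (simp only: cinner_bpow_mult_op hilbert_adjoint'[OF complex_linear_mult_op_B])
  also have "\<dots> = integral {0..1} (\<lambda>t. q * (B (circlepath 0 1 t) ^ Suc k / of_nat (Suc k) * cnj (circlepath 0 1 t * circlepath 0 1 t ^ m)))"
    unfolding circle_pairing_def q_def using nz by (intro integral_cong) (simp add: field_simps del: of_nat_Suc power_Suc)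
  also have "\<dots> = q * circle_pairing (\<lambda>z. B z ^ Suc k / of_nat (Suc k)) (\<lambda>z. z ^ m)"
    unfolding circle_pairing_def by (rule integral_mult_right)
  also have "\<dots> = cinner (cscale q (bpow k)) (bergman_of (\<lambda>z. z ^ m))"
    by (simp only: cinner_cscale_left cinner_bpow[OF hm])
  finally show "cinner (hilbert_adjoint (mult_op B) (bpow (Suc k))) (bergman_of (\<lambda>z. z ^ m))
      = cinner (cscale (of_nat (Suc k) / of_nat (Suc (Suc k))) (bpow k)) (bergman_of (\<lambda>z. z ^ m))"
    by (simp only: q_def)
qed

text \<open>The orthogonal complement of the distinguished reducing subspace, which is spanned by the
  functions \<open>B' B ^ k\<close>.\<close>

definition distinguished_comp :: "bergman set" where
  "distinguished_comp = {f. \<forall>k. cinner f (bpow k) = 0}"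

lemma reducing_distinguished_comp: "reducing_subspace (mult_op B) distinguished_comp"
proof -
  have "bergman.subspace distinguished_comp"
    by (auto simp: bergman.subspace_def distinguished_comp_def cinner_add_left cinner_cscale_left)
  moreover have "closed distinguished_comp"
  proof -
    show ?thesis unfolding distinguished_comp_def
      by (intro closed_Collect_all closed_Collect_eq linear_continuous_on bounded_linear_cinner_left
          continuous_on_const)
  qed
  moreover have "mult_op B f \<in> distinguished_comp" if f: "f \<in> distinguished_comp" for f
  proof -
    have "cinner (mult_op B f) (bpow k) = 0" for k
      using f by (cases k)
        (simp_all add: distinguished_comp_def hilbert_adjoint[OF complex_linear_mult_op_B] adjoint_mult_op_bpow_0 adjoint_mult_op_bpow_Suc cinner_cscale_right)
    then show ?thesis by (simp add: distinguished_comp_def)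
  qed
  moreover have "hilbert_adjoint (mult_op B) f \<in> distinguished_comp" if f: "f \<in> distinguished_comp" for f
    using f by (simp add: distinguished_comp_def hilbert_adjoint'[OF complex_linear_mult_op_B] mult_op_bpow)
  ultimately show ?thesis by (auto simp: reducing_subspace_def)
qed

text \<open>Order at least 2 enters here. If \<open>B\<close> were injective, its first two zeros
  would coincide and \<open>B\<close> would have a multiple zero, where the derivative vanishes; an
  injective holomorphic function has no such point. The pair found this way is then moved off the
  exceptional fibers.\<close>

lemma exists_fiber_pair:
  obtains x y where "x \<in> D0" "y \<in> D0" "x \<noteq> y" "B x = B y"
proof -
  have "\<not> inj_on B unit_disk"
  proof
    assume inj: "inj_on B unit_disk"
    have z: "B (a k) = 0" if "k < n" for k
    proof -
      have "(\<Prod>j<n. blaschke_factor (a j) (a k)) = 0"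
        using that by (intro prod_zero) (auto simp: blaschke_factor_def intro!: bexI[of _ k])
      then show ?thesis by (simp add: B_def)
    qed
    define p where "p = a 0"
    have p: "p \<in> unit_disk" "a 1 = p" using inj_onD[OF inj, of "a 0" "a 1"] a n z by (auto simp: p_def)
    define f where "f w = c * (\<Prod>k\<in>{1..<n}. blaschke_factor (a k) w)" for w
    have Bf: "B = (\<lambda>w. blaschke_factor p w * f w)"
    proof
      fix w
      have "{..<n} = insert 0 {1..<n}" using n by auto
      then show "B w = blaschke_factor p w * f w" by (simp add: B_def f_def p_def)
    qed
    have nz: "1 - cnj (a k) * p \<noteq> 0" if "k < n" for k
    proof (rule one_minus_cnj_mult_neq_0)
      show "norm (a k) * norm p < 1"
        using a[OF that] p(1) mult_strict_mono[of "norm (a k)" 1 "norm p" 1] by simp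
    qed
    have fd: "f field_differentiable at p"
    proof -
      have "f holomorphic_on unit_disk"
        unfolding f_def blaschke_factor_def
      proof (intro holomorphic_intros)
        fix k w assume "k \<in> {1..<n}" "w \<in> unit_disk"
        then show "1 - cnj (a k) * w \<noteq> 0"
          using a[of k] mult_strict_mono[of "norm (a k)" 1 "norm w" 1] by (intro one_minus_cnj_mult_neq_0) auto
      qed
      then show ?thesis using p(1) by (intro holomorphic_on_imp_differentiable_at[of _ unit_disk]) auto
    qed
    have bd: "blaschke_factor p field_differentiable at p"
    proof -
      have "blaschke_factor p holomorphic_on unit_disk"
        unfolding blaschke_factor_def
      proof (intro holomorphic_intros)
        fix w assume "w \<in> unit_disk"
        then show "1 - cnj p * w \<noteq> 0"
          using p mult_strict_mono[of "norm p" 1 "norm w" 1] by (intro one_minus_cnj_mult_neq_0) auto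
      qed
      then show ?thesis using p(1) by (intro holomorphic_on_imp_differentiable_at[of _ unit_disk]) auto
    qed
    have f0: "f p = 0" using n p(2) by (auto simp: f_def blaschke_factor_def intro!: bexI[of _ 1])
    have "deriv B p = 0"
      unfolding Bf by (subst deriv_mult[OF bd fd]) (simp add: f0 blaschke_factor_def)
    moreover have "deriv B p \<noteq> 0"
      using holomorphic_injective_imp_regular[OF B_holomorphic_disk open_ball inj p(1)] .
    ultimately show False by simp
  qed
  then obtain x y where xy: "x \<in> unit_disk" "y \<in> unit_disk" "x \<noteq> y" "B x = B y" by (auto simp: inj_on_def)
  define r where "r = dist x y / 2"
  have r: "r > 0" using xy(3) by (simp add: r_def)
  have disj: "ball x r \<inter> ball y r = {}" by (rule disjoint_ballI) (simp add: r_def)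
  have nc: "\<not> B constant_on unit_disk" by (rule B_not_constant) (use unit_disk_subset_big_disk in auto)
  have op: "open (B ` (ball z r \<inter> unit_disk))" for z
    by (rule open_mapping_thm[OF B_holomorphic_disk open_ball connected_ball _ _ nc]) auto
  \<comment> \<open>The images of disjoint disks around \<open>x\<close> and \<open>y\<close> are
    open and share the value \<open>B x\<close>; among their infinitely many common values is one
    that is not critical.\<close>
  define W where "W = B ` (ball x r \<inter> unit_disk) \<inter> B ` (ball y r \<inter> unit_disk)"
  have "open W" unfolding W_def by (intro open_Int op)
  moreover have "B x \<in> B ` (ball x r \<inter> unit_disk)" using xy(1) r by simp
  moreover have "B x \<in> B ` (ball y r \<inter> unit_disk)" using xy(2) r unfolding xy(4) by simp
  ultimately have "\<not> finite W" using finite_imp_not_open[of W] by (auto simp: W_def)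
  then obtain w where w: "w \<in> W" "w \<notin> B ` crit" using finite_crit finite_subset[of W "B ` crit"] by blast
  obtain s where s: "s \<in> ball x r \<inter> unit_disk" "w = B s" using w(1) by (auto simp: W_def)
  obtain t where t: "t \<in> ball y r \<inter> unit_disk" "w = B t" using w(1) unfolding W_def by blast
  show ?thesis
  proof (rule that[of s t])
    show "s \<in> D0" "t \<in> D0" using s t w(2) by (auto simp: D0_iff simp del: Diff_iff)
    show "s \<noteq> t" using s(1) t(1) disj by blast
    show "B s = B t" using s t by simp
  qed
qed

lemma distinguished_comp_not_UNIV: "distinguished_comp \<noteq> UNIV"
proof
  assume "distinguished_comp = UNIV"
  then have "cinner (bpow 0) (bpow 0) = 0" by (auto simp: distinguished_comp_def)
  then have "bpow 0 = 0" by (simp add: cinner_self_eq_0)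
  then have "deriv B z = 0" if "z \<in> unit_disk" for z using bpow_apply[OF that, of 0] by simp
  moreover obtain x where "x \<in> D0" using exists_fiber_pair by blast
  ultimately show False using D0_deriv[of x] by auto
qed

lemma distinguished_comp_not_0: "distinguished_comp \<noteq> {0}"
proof
  assume N0: "distinguished_comp = {0}"
  obtain x y where xy: "x \<in> D0" "y \<in> D0" "x \<noteq> y" "B x = B y" using exists_fiber_pair by blast
  have D: "x \<in> unit_disk" "y \<in> unit_disk" using xy by auto
  \<comment> \<open>The difference of the functionals \<open>f x / deriv B x\<close> and
    \<open>f y / deriv B y\<close>, cleared of denominators. It vanishes on every
    \<open>bpow j\<close>, so its Riesz vector lies in \<open>distinguished_comp\<close>.\<close>
  define \<phi> where "\<phi> f = deriv B y * bergman_fun f x - deriv B x * bergman_fun f y" for f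
  define K where "K = norm (deriv B y) * (1 / (1 - norm x)\<^sup>2) + norm (deriv B x) * (1 / (1 - norm y)\<^sup>2)"
  have bound: "norm (\<phi> f) \<le> K * norm f" for f
  proof -
    have "norm (\<phi> f) \<le> norm (deriv B y) * norm (bergman_fun f x) + norm (deriv B x) * norm (bergman_fun f y)"
      unfolding \<phi>_def using norm_triangle_ineq4 by (metis norm_mult)
    also have "\<dots> \<le> norm (deriv B y) * (norm f / (1 - norm x)\<^sup>2) + norm (deriv B x) * (norm f / (1 - norm y)\<^sup>2)"
      using D by (intro add_mono mult_left_mono norm_bergman_fun_le) auto
    also have "\<dots> = K * norm f" by (simp add: K_def algebra_simps)
    finally show ?thesis .
  qed
  obtain k where k: "\<And>f. \<phi> f = cinner f k"
  proof (rule riesz_representation_bergman[of \<phi> K])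
    show "\<phi> (f + g) = \<phi> f + \<phi> g" for f g by (simp add: \<phi>_def bergman_fun_add algebra_simps)
    show "\<phi> (cscale l f) = l * \<phi> f" for l f by (simp add: \<phi>_def bergman_fun_cscale algebra_simps)
  qed (use bound in auto)
  have "cinner k (bpow j) = 0" for j
  proof -
    have "\<phi> (bpow j) = 0" using D xy(4) by (simp add: \<phi>_def bpow_apply)
    then show ?thesis using k[of "bpow j"] cinner_commute[of k "bpow j"] by simp
  qed
  then have "k = 0" using N0 by (auto simp: distinguished_comp_def)
  \<comment> \<open>A test function that vanishes at \<open>y\<close> but not at
    \<open>x\<close>.\<close>
  then have "\<phi> (bergman_of (\<lambda>z. z - y)) = 0" using k by simp
  moreover have "\<phi> (bergman_of (\<lambda>z. z - y)) = deriv B y * (x - y)"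
    using D by (simp add: \<phi>_def bergman_of_polynomial holomorphic_intros)
  ultimately show False using D0_deriv[OF xy(2)] xy(3) by simp
qed

end

section \<open>Minimal reducing subspaces\<close>

lemma orthogonal_projection_fixes_iff:
  "is_orthogonal_projection P M \<Longrightarrow> f \<in> M \<longleftrightarrow> P f = f"
  unfolding is_orthogonal_projection_def by metis

definition orthogonal_comp :: "bergman set \<Rightarrow> bergman set" where
  "orthogonal_comp M = {f. \<forall>h\<in>M. cinner f h = 0}"

lemma orthogonal_comp_iff:
  assumes "is_orthogonal_projection P M"
  shows "f \<in> orthogonal_comp M \<longleftrightarrow> P f = 0"
proof
  assume "f \<in> orthogonal_comp M"
  moreover have "P f \<in> M" "\<forall>h\<in>M. cinner (f - P f) h = 0"
    using assms by (auto simp: is_orthogonal_projection_def)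
  ultimately have "cinner (P f) (P f) = 0" by (simp add: orthogonal_comp_def cinner_diff_left)
  then show "P f = 0" by (simp add: cinner_self_eq_0)
next
  assume "P f = 0"
  moreover have "\<forall>h\<in>M. cinner (f - P f) h = 0"
    using assms by (simp add: is_orthogonal_projection_def)
  ultimately show "f \<in> orthogonal_comp M" by (simp add: orthogonal_comp_def)
qed

lemma reducing_orthogonal_comp:
  assumes T: "complex_linear T" and M: "reducing_subspace T M"
  shows "reducing_subspace T (orthogonal_comp M)"
proof -
  have "bergman.subspace (orthogonal_comp M)"
    by (auto simp: bergman.subspace_def orthogonal_comp_def cinner_add_left cinner_cscale_left)
  moreover have "closed (orthogonal_comp M)"
    unfolding orthogonal_comp_def Ball_def
    by (intro closed_Collect_all closed_Collect_imp open_Collect_const closed_Collect_eq linear_continuous_on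
        bounded_linear_cinner_left continuous_on_const)
  moreover have "T f \<in> orthogonal_comp M" "hilbert_adjoint T f \<in> orthogonal_comp M" if "f \<in> orthogonal_comp M" for f
    using that M by (auto simp: orthogonal_comp_def reducing_subspace_def hilbert_adjoint[OF T] hilbert_adjoint'[OF T])
  ultimately show ?thesis by (auto simp: reducing_subspace_def)
qed

lemma Vstar_lincomb:
  assumes "S \<in> Vstar \<phi>" "T \<in> Vstar \<phi>" and lin: "complex_linear (mult_op \<phi>)"
  shows "cscale_op x S + cscale_op y T \<in> Vstar \<phi>"
  unfolding Vstar_def
proof (rule commutantI)
  show "complex_linear (cscale_op x S + cscale_op y T)"
    using assms commutant_complex_linear[of S] commutant_complex_linear[of T]
    by (simp add: Vstar_def complex_linear_def blinfun.add_left cscale_op_apply bergman.scale_right_distrib mult.commute)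
  show "(cscale_op x S + cscale_op y T) (A f) = A ((cscale_op x S + cscale_op y T) f)"
    if "A \<in> {mult_op \<phi>, hilbert_adjoint (mult_op \<phi>)}" for A f
  proof -
    have "complex_linear A" using that lin complex_linear_hilbert_adjoint by blast
    then show ?thesis
      using commutant_apply[OF assms(1)[unfolded Vstar_def] that] commutant_apply[OF assms(2)[unfolded Vstar_def] that]
      by (simp add: blinfun.add_left cscale_op_apply blinfun.add_right complex_linear_apply)
  qed
qed

section \<open>The commutant and the classification of reducing subspaces\<close>

context blaschke_simple
begin

text \<open>\<open>Vstar_structure\<close> places the commutant in a family with two parameters. The
  projection \<open>P\<close> has a nonzero trace coefficient, so it can take the place of the trace
  term.\<close>

lemma Vstar_eq_combinations:
  obtains P where "is_orthogonal_projection P distinguished_comp" "P \<in> Vstar B"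
    "\<And>T. T \<in> Vstar B \<longleftrightarrow> (\<exists>x y. T = cscale_op x id_blinfun + cscale_op y P)"
proof -
  obtain P where P: "is_orthogonal_projection P distinguished_comp"
    using orthogonal_projection_operator_exists reducing_distinguished_comp unfolding reducing_subspace_def by metis
  have PV: "P \<in> Vstar B"
    unfolding Vstar_def by (rule orthogonal_projection_in_commutant[OF complex_linear_mult_op_B reducing_distinguished_comp P])
  have IV: "id_blinfun \<in> Vstar B"
    unfolding Vstar_def by (rule commutantI) (auto simp: complex_linear_def)
  obtain \<alpha> \<beta> where ab: "\<And>f x. x \<in> D0 \<Longrightarrow> bergman_fun (P f) x = \<alpha> * bergman_fun f x + \<beta> * (deriv B x * fiber_trace f x)"
    using Vstar_structure[OF PV] by blast
  \<comment> \<open>Otherwise \<open>P\<close> would be a scalar; it fixes a nonzero vector, so it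
    would be the identity, but \<open>distinguished_comp\<close> is not the whole space.\<close>
  have "\<beta> \<noteq> 0"
  proof
    assume b: "\<beta> = 0"
    have Pf: "P f = cscale \<alpha> f" for f
      by (rule bergman_eqI_D0) (simp add: ab b bergman_fun_cscale)
    have "0 \<in> distinguished_comp" using reducing_distinguished_comp by (simp add: reducing_subspace_def bergman.subspace_def)
    then obtain f where f: "f \<in> distinguished_comp" "f \<noteq> 0" using distinguished_comp_not_0 by blast
    have "cscale \<alpha> f = f" using Pf[of f] orthogonal_projection_fixes_iff[OF P, of f] f(1) by simp
    then have "cscale (\<alpha> - 1) f = 0" by (simp add: bergman.scale_left_diff_distrib)
    then have "\<alpha> = 1" using f(2) by simp
    then have "g \<in> distinguished_comp" for g using Pf[of g] orthogonal_projection_fixes_iff[OF P, of g] by simp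
    then show False using distinguished_comp_not_UNIV by blast
  qed
  have "\<exists>x y. T = cscale_op x id_blinfun + cscale_op y P" if T: "T \<in> Vstar B" for T
  proof -
    obtain \<alpha>' \<beta>' where ab': "\<And>f x. x \<in> D0 \<Longrightarrow> bergman_fun (T f) x = \<alpha>' * bergman_fun f x + \<beta>' * (deriv B x * fiber_trace f x)"
      using Vstar_structure[OF T] by blast
    \<comment> \<open>The coefficient of \<open>P\<close> matches the trace terms; what remains is a
      multiple of the identity.\<close>
    have "T = cscale_op (\<alpha>' - \<beta>' / \<beta> * \<alpha>) id_blinfun + cscale_op (\<beta>' / \<beta>) P"
    proof (rule blinfun_eqI, rule bergman_eqI_D0)
      fix f z assume z: "z \<in> D0"
      show "bergman_fun (T f) z = bergman_fun ((cscale_op (\<alpha>' - \<beta>' / \<beta> * \<alpha>) id_blinfun + cscale_op (\<beta>' / \<beta>) P) f) z"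
        using \<open>\<beta> \<noteq> 0\<close>
        by (simp add: blinfun.add_left cscale_op_apply bergman_fun_add bergman_fun_cscale ab[OF z] ab'[OF z] field_simps)
    qed
    then show ?thesis by blast
  qed
  then show ?thesis
    using that P PV Vstar_lincomb[OF IV PV complex_linear_mult_op_B] by blast
qed

theorem Vstar_and_minimal_reducing_subspaces:
  "card {M. minimal_reducing_subspace (mult_op B) M} = 2 \<and>
   bergman_op.dim (Vstar B) = 2 \<and>
   (\<forall>S\<in>Vstar B. \<forall>T\<in>Vstar B. S o\<^sub>L T = T o\<^sub>L S)"
proof -
  obtain P where P: "is_orthogonal_projection P distinguished_comp" and PV: "P \<in> Vstar B"
    and V: "\<And>T. T \<in> Vstar B \<longleftrightarrow> (\<exists>x y. T = cscale_op x id_blinfun + cscale_op y P)"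
    using Vstar_eq_combinations by blast
  let ?N' = "orthogonal_comp distinguished_comp"
  have Plin: "complex_linear P" and PN: "\<And>f. P f \<in> distinguished_comp" using P by (auto simp: is_orthogonal_projection_def)
  have PP: "P (P f) = P f" for f using PN orthogonal_projection_fixes_iff[OF P] by metis
  have N_iff: "f \<in> distinguished_comp \<longleftrightarrow> P f = f" for f by (rule orthogonal_projection_fixes_iff[OF P])
  have N'_iff: "f \<in> ?N' \<longleftrightarrow> P f = 0" for f by (rule orthogonal_comp_iff[OF P])
  have "0 \<in> distinguished_comp" using reducing_distinguished_comp by (simp add: reducing_subspace_def bergman.subspace_def)
  then obtain f1 where f1: "f1 \<in> distinguished_comp" "f1 \<noteq> 0" using distinguished_comp_not_0 by blast
  obtain g where g: "g \<notin> distinguished_comp" using distinguished_comp_not_UNIV by blast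
  define f2 where "f2 = g - P g"
  have f2: "f2 \<in> ?N'" "f2 \<noteq> 0" using g PP by (auto simp: f2_def N'_iff N_iff blinfun.diff_right)
  have P1: "P f1 = f1" and P2: "P f2 = 0" using f1(1) f2(1) N_iff N'_iff by auto
  have app: "(cscale_op x id_blinfun + cscale_op y P) f = cscale x f + cscale y (P f)" for x y f
    by (simp add: blinfun.add_left cscale_op_apply)
  have red_N': "reducing_subspace (mult_op B) ?N'"
    by (rule reducing_orthogonal_comp[OF complex_linear_mult_op_B reducing_distinguished_comp])
  \<comment> \<open>The projection onto \<open>M\<close> is a combination of the identity and
    \<open>P\<close> with coefficients \<open>x\<close> and \<open>y\<close>. It multiplies
    \<open>f1\<close> by \<open>x + y\<close> and \<open>f2\<close> by \<open>x\<close>; idempotence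
    forces both numbers to be 0 or 1, which leaves four subspaces.\<close>
  have classify: "M = {0} \<or> M = UNIV \<or> M = distinguished_comp \<or> M = ?N'" if M: "reducing_subspace (mult_op B) M" for M
  proof -
    obtain Q where Q: "is_orthogonal_projection Q M"
      using orthogonal_projection_operator_exists M unfolding reducing_subspace_def by metis
    have "Q \<in> Vstar B"
      unfolding Vstar_def by (rule orthogonal_projection_in_commutant[OF complex_linear_mult_op_B M Q])
    then obtain x y where xy: "Q = cscale_op x id_blinfun + cscale_op y P" using V by blast
    have Qf: "Q f = cscale x f + cscale y (P f)" for f unfolding xy by (rule app)
    have QQ: "Q (Q f) = Q f" for f
      using Q orthogonal_projection_fixes_iff[OF Q, of "Q f"] by (simp add: is_orthogonal_projection_def)
    have M_iff: "f \<in> M \<longleftrightarrow> Q f = f" for f by (rule orthogonal_projection_fixes_iff[OF Q])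
    have Q1: "Q f1 = cscale (x + y) f1" by (simp add: Qf P1 bergman.scale_left_distrib)
    have Q2: "Q f2 = cscale x f2" by (simp add: Qf P2)
    have Qlin: "complex_linear Q" using Q by (simp add: is_orthogonal_projection_def)
    have "cscale ((x + y) * (x + y) - (x + y)) f1 = 0"
      using QQ[of f1] by (simp add: Q1 complex_linear_apply[OF Qlin] bergman.scale_left_diff_distrib)
    then have "(x + y) * (x + y) - (x + y) = 0" using f1(2) by (simp only: bergman.scale_eq_0_iff) simp
    then have c1: "x + y = 0 \<or> x + y = 1" by (metis diff_eq_diff_eq eq_iff_diff_eq_0 mult_cancel_right1)
    have "cscale (x * x - x) f2 = 0"
      using QQ[of f2] by (simp add: Q2 complex_linear_apply[OF Qlin] bergman.scale_left_diff_distrib)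
    then have "x * x - x = 0" using f2(2) by (simp only: bergman.scale_eq_0_iff) simp
    then have c2: "x = 0 \<or> x = 1" by (metis eq_iff_diff_eq_0 mult_cancel_right1)
    consider "x = 0" "y = 0" | "x = 0" "y = 1" | "x = 1" "y = -1" | "x = 1" "y = 0"
      using c1 c2 by (auto simp: add_eq_0_iff)
    then show ?thesis
    proof cases
      case 1
      then have "M = {0}" by (auto simp: M_iff Qf)
      then show ?thesis by simp
    next
      case 2
      then have "M = distinguished_comp" by (auto simp: M_iff N_iff Qf)
      then show ?thesis by simp
    next
      case 3
      then have "M = ?N'" by (auto simp: M_iff N'_iff Qf)
      then show ?thesis by simp
    next
      case 4
      then have "M = UNIV" by (auto simp: M_iff Qf)
      then show ?thesis by simp
    qed
  qed
  have ne: "distinguished_comp \<noteq> {0}" "?N' \<noteq> {0}" "distinguished_comp \<noteq> UNIV" "?N' \<noteq> UNIV" "\<not> distinguished_comp \<subseteq> ?N'" "\<not> ?N' \<subseteq> distinguished_comp"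
    using f1 f2 g N'_iff N_iff by auto
  have "{M. minimal_reducing_subspace (mult_op B) M} = {distinguished_comp, ?N'}"
  proof (intro equalityI subsetI)
    fix M assume "M \<in> {M. minimal_reducing_subspace (mult_op B) M}"
    then have M: "reducing_subspace (mult_op B) M" "M \<noteq> {0}"
      "\<And>L. reducing_subspace (mult_op B) L \<Longrightarrow> L \<subseteq> M \<Longrightarrow> L = {0} \<or> L = M"
      by (auto simp: minimal_reducing_subspace_def)
    have "M \<noteq> UNIV" using M(3)[OF reducing_distinguished_comp] ne by auto
    then show "M \<in> {distinguished_comp, ?N'}" using classify[OF M(1)] M(2) by blast
  next
    fix M assume "M \<in> {distinguished_comp, ?N'}"
    then consider "M = distinguished_comp" | "M = ?N'" by blast
    then show "M \<in> {M. minimal_reducing_subspace (mult_op B) M}"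
    proof cases
      case 1
      have "L = {0} \<or> L = distinguished_comp" if "reducing_subspace (mult_op B) L" "L \<subseteq> distinguished_comp" for L
        using classify[OF that(1)] that(2) ne by blast
      then show ?thesis using 1 ne reducing_distinguished_comp by (simp add: minimal_reducing_subspace_def)
    next
      case 2
      have "L = {0} \<or> L = ?N'" if "reducing_subspace (mult_op B) L" "L \<subseteq> ?N'" for L
        using classify[OF that(1)] that(2) ne by blast
      then show ?thesis using 2 ne red_N' by (simp add: minimal_reducing_subspace_def)
    qed
  qed
  moreover have "distinguished_comp \<noteq> ?N'" using ne by blast
  ultimately have "card {M. minimal_reducing_subspace (mult_op B) M} = 2" by simp
  moreover have "bergman_op.dim (Vstar B) = 2"
  proof -
    have "bergman_op.span {id_blinfun, P} = Vstar B"
    proof (intro equalityI subsetI)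
      fix T assume "T \<in> bergman_op.span {id_blinfun, P}"
      then obtain x y where "T - cscale_op x id_blinfun - cscale_op y P = 0"
        by (auto simp: bergman_op.span_insert)
      then have "T = cscale_op x id_blinfun + cscale_op y P" by (simp add: algebra_simps)
      then show "T \<in> Vstar B" using V by blast
    next
      fix T assume "T \<in> Vstar B"
      then obtain x y where "T = cscale_op x id_blinfun + cscale_op y P" using V by blast
      then show "T \<in> bergman_op.span {id_blinfun, P}"
        by (simp only:) (intro bergman_op.span_add bergman_op.span_scale bergman_op.span_base; simp)
    qed
    moreover have nP: "id_blinfun \<noteq> P"
      using P2 f2(2) by (metis id_blinfun.rep_eq id_apply)
    moreover have "bergman_op.independent {id_blinfun, P}"
    proof -
      have "id_blinfun \<notin> bergman_op.span {P}"
      proof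
        assume "id_blinfun \<in> bergman_op.span {P}"
        then obtain k where "id_blinfun = cscale_op k P" by (auto simp: bergman_op.span_singleton)
        then have "id_blinfun f2 = cscale k (P f2)" by (metis cscale_op_apply)
        then show False using P2 f2(2) by simp
      qed
      moreover have "P \<noteq> 0" using P1 f1(2) by auto
      ultimately show ?thesis using nP by (simp add: bergman_op.independent_insert)
    qed
    ultimately have "bergman_op.dim (Vstar B) = card {id_blinfun, P}"
      by (intro bergman_op.dim_eq_card) (metis bergman_op.span_span)
    then show ?thesis using nP by simp
  qed
  moreover have "S o\<^sub>L T = T o\<^sub>L S" if ST: "S \<in> Vstar B" "T \<in> Vstar B" for S T
  proof -
    obtain x y x' y' where S: "S = cscale_op x id_blinfun + cscale_op y P" and T: "T = cscale_op x' id_blinfun + cscale_op y' P"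
      using ST V by metis
    show ?thesis
      by (rule blinfun_eqI)
        (simp add: S T app blinfun.add_right complex_linear_apply[OF Plin] bergman.scale_right_distrib PP mult.commute add_ac)
  qed
  ultimately show ?thesis by blast
qed

end

text \<open>In the factorization \<open>f w = g w * (w - z)\<close> near \<open>z\<close> the
  derivative at \<open>z\<close> is \<open>g z\<close>, which is nonzero.\<close>

lemma deriv_nonzero_of_zorder_1:
  assumes f: "f holomorphic_on S" "open S" "connected S" "z \<in> S" and nz: "\<exists>w\<in>S. f w \<noteq> 0" and z: "zorder f z = 1"
  shows "deriv f z \<noteq> 0"
proof -
  obtain r where r: "r > 0" "zor_poly f z holomorphic_on cball z r"
    "\<And>w. w \<in> cball z r \<Longrightarrow> f w = zor_poly f z w * (w - z) ^ nat (zorder f z) \<and> zor_poly f z w \<noteq> 0"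
    using zorder_exist_zero[OF f nz] by blast
  let ?g = "zor_poly f z"
  have "?g holomorphic_on ball z r" using r(2) by (rule holomorphic_on_subset) auto
  then have "(?g has_field_derivative deriv ?g z) (at z)" by (rule holomorphic_derivI) (use r(1) in auto)
  then have "((\<lambda>w. ?g w * (w - z)) has_field_derivative deriv ?g z * (z - z) + 1 * ?g z) (at z)"
    by (intro DERIV_mult) (auto intro!: derivative_eq_intros)
  then have "(f has_field_derivative deriv ?g z * (z - z) + 1 * ?g z) (at z)"
    by (rule has_field_derivative_transform_within_open[of _ _ _ "ball z r"]) (use r z in auto)
  then have "deriv f z = ?g z" by (simp add: DERIV_imp_deriv)
  then show ?thesis using r by auto
qed

theorem corollary4p10:
  fixes B :: "complex \<Rightarrow> complex" and n :: nat
  assumes "finite_Blaschke_product n B"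
    and "n \<ge> 2"
    and "inj_on B (critical_set B)"
    and "\<And>z. z \<in> critical_set B \<Longrightarrow> zorder (deriv B) z = 1"
  shows "card {M. minimal_reducing_subspace (mult_op B) M} = 2 \<and>
         bergman_op.dim (Vstar B) = 2 \<and>
         (\<forall>S\<in>Vstar B. \<forall>T\<in>Vstar B. S o\<^sub>L T = T o\<^sub>L S)"
proof -
  obtain c a where ca: "norm c = 1" "\<And>k. k < n \<Longrightarrow> a k \<in> unit_disk"
    and B: "\<And>z. z \<in> unit_disk \<Longrightarrow> B z = c * (\<Prod>k<n. (z - a k) / (1 - cnj (a k) * z))"
    using assms(1) unfolding finite_Blaschke_product_def by blast
  interpret bl: blaschke n c a using assms(2) ca by unfold_locales auto
  \<comment> \<open>The given \<open>B\<close> is known to agree with the explicit product only on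
    the disk; its derivatives there, its critical set and the operator \<open>mult_op B\<close> are
    determined by these values.\<close>
  have eq: "B z = bl.B z" if "z \<in> unit_disk" for z
    using B[OF that] by (simp add: bl.B_def blaschke_factor_def)
  have ev: "\<forall>\<^sub>F w in nhds z. B w = bl.B w" if "z \<in> unit_disk" for z
  proof -
    have "\<forall>\<^sub>F w in nhds z. w \<in> unit_disk" using that by (intro eventually_nhds_in_open) auto
    then show ?thesis by eventually_elim (rule eq)
  qed
  have deq: "deriv B z = deriv bl.B z" if "z \<in> unit_disk" for z
    by (rule deriv_cong_ev[OF ev[OF that] refl])
  have crit: "critical_set B = bl.crit"
    unfolding bl.crit_def critical_set_def using deq by auto
  have op: "mult_op B = mult_op bl.B"
  proof -
    have "(\<lambda>z. B z * bergman_fun f z) = (\<lambda>z. bl.B z * bergman_fun f z)" for f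
      using eq bergman_fun_outside by fastforce
    then show ?thesis by (simp add: mult_op_def)
  qed
  interpret bl: blaschke_simple n c a
  proof unfold_locales
    show "inj_on bl.B bl.crit"
      using assms(3) eq unfolding crit by (subst inj_on_cong[of _ _ B]) (auto simp: bl.crit_def critical_set_def)
    fix p assume p: "p \<in> bl.crit"
    then have pD: "p \<in> unit_disk" by (simp add: bl.crit_def critical_set_def)
    have "\<forall>\<^sub>F w in at p. deriv B w = deriv bl.B w"
      using pD eventually_at_in_open'[of unit_disk p] deq by (auto elim!: eventually_mono)
    then have "zorder (deriv bl.B) p = 1"
      using assms(4)[of p] p crit zorder_cong[of "deriv B" "deriv bl.B" p p] by simp
    \<comment> \<open>The factorization at a zero requires that the derivative of \<open>B\<close>
      is not identically 0.\<close>
    moreover obtain x where "x \<in> bl.D0" using bl.exists_fiber_pair by blast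
    then have "\<exists>w\<in>unit_disk. deriv bl.B w \<noteq> 0" using bl.D0_deriv by blast
    ultimately show "deriv (deriv bl.B) p \<noteq> 0"
      using deriv_nonzero_of_zorder_1[OF holomorphic_deriv[OF bl.B_holomorphic_disk open_ball] open_ball connected_ball pD] by blast
  qed
  show ?thesis
    using bl.Vstar_and_minimal_reducing_subspaces unfolding Vstar_def op .
qed

end
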